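(* Let $(\xi_k)_{k\ge 1}$ be a (not necessarily stationary) Markov chain on $(\Omega,\mathcal K,P)$ with values in a measurable space $(S,\mathcal B(S))$, with marginal laws $P_k(A)=P(\xi_k\in A)$ and regular transition probabilities $Q_k(x,A)=P(\xi_k\in A\mid \xi_{k-1}=x)$, $k\ge 2$. Let $g_j:S\to\mathbb R$ be measurable and $X_j=g_j(\xi_j)$, with $E(X_j)=0$ and $E(X_j^2)<\infty$ for all $j\ge 1$. Put $S_n=\sum_{k=1}^n X_k$, $\sigma_n^2=E(S_n^2)$, $\tau_n^2=\sum_{j=1}^n E(X_j^2)$, $f_k(t)=E(\exp(itX_k))$, and assume $\tau_n^2\to\infty$. Assume: (i) There are constants $a>0$ and $b<\infty$ such that for every $k\ge2$ there is $S_k'\in\mathcal B(S)$ with $P_{k-1}(S_k')=1$ and $$aP_k(A)\le Q_k(x,A)\le bP_k(A)\quad\text{for all }A\in\mathcal B(S)\text{ and }x\in S_k'.$$ Put $\gamma=a^4/b$. (ii) (Lindeberg's condition) For every $\varepsilon>0$, $\displaystyle \frac1{\tau_n^2}\sum_{k=1}^nE\big(X_k^2 I(|X_k|\ge\varepsilon\tau_n)\big)\to0$ as $n\to\infty$. (iii) (Condition A) There are $\delta>0$, $n_0\in\mathbb N$ and a function $g:\mathbb R\to\mathbb R$ such that $\exp(-g(u))$ is integrable on $\mathbb R$ and, for all $n>n_0$ and all $u$ with $1\le|u|\le\delta\tau_n$, $$\frac{\gamma}{8}\sum_{k=1}^n\Big(1-\Big|f_k\Big(\frac{u}{\tau_n}\Big)\Big|^2\Big)>g(u).$$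 (iv) (Condition B) For every $u\ne0$ there are a constant $c(u)>1$, an open interval $O_u$ containing $u$, and $n_0=n_0(u)$ such that for all $t\in O_u$ and all $n>n_0$, $$\frac{\gamma}{8\ln\tau_n}\sum_{k=1}^n\big(1-|f_k(t)|^2\big)\ge c(u).$$ Then, for every continuous function $h:\mathbb R\to\mathbb R$ with compact support, $$\lim_{n\to\infty}\sup_{u\in\mathbb R}\Big|\sqrt{2\pi}\,\sigma_n\,E\big[h(S_n-u)\big]-\exp\Big(-\frac{u^2}{2\sigma_n^2}\Big)\int_{\mathbb R} h\,d\lambda\Big|=0,$$ where $\lambda$ is Lebesgue measure.
   Context: $I(\cdot)$ denotes the indicator of an event. The constants $a,b$ in (i) do not depend on $k$, $x$ or $A$. *)

theory Defs
  imports "HOL-Probability.Probability"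
begin

definition generated_sigma ::
  "'a measure \<Rightarrow> 's measure \<Rightarrow> (nat \<Rightarrow> 'a \<Rightarrow> 's) \<Rightarrow> nat set \<Rightarrow> 'a measure" where
  "generated_sigma M N \<xi> J =
     sigma (space M) (\<Union>j\<in>J. {\<xi> j -` A \<inter> space M |A. A \<in> sets N})"

text \<open>
  Processes are indexed from 1; the value of \<open>\<xi>\<close> at index 0 is never used.
\<close>

definition markov_chain ::
  "'a measure \<Rightarrow> 's measure \<Rightarrow> (nat \<Rightarrow> 'a \<Rightarrow> 's) \<Rightarrow> bool" where
  "markov_chain M N \<xi> \<longleftrightarrow>
     (\<forall>k\<ge>1. \<xi> k \<in> measurable M N) \<and>
     (\<forall>k\<ge>2. \<forall>A\<in>sets N. AE \<omega> in M.
        real_cond_exp M (generated_sigma M N \<xi> {1..k - 1})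
          (indicator (\<xi> k -` A \<inter> space M)) \<omega>
      = real_cond_exp M (generated_sigma M N \<xi> {k - 1})
          (indicator (\<xi> k -` A \<inter> space M)) \<omega>)"

text \<open>
  Regular versions of \<open>P(\<xi>\<^sub>k \<in> A | \<xi>\<^bsub>k-1\<^esub> = x)\<close>: each \<open>Q k\<close> is a probability kernel on
  the state space, evaluated at \<open>\<xi>\<^bsub>k-1\<^esub>\<close> in the conditional expectation.
\<close>

definition regular_transitions ::
  "'a measure \<Rightarrow> 's measure \<Rightarrow> (nat \<Rightarrow> 'a \<Rightarrow> 's) \<Rightarrow> (nat \<Rightarrow> 's \<Rightarrow> 's measure) \<Rightarrow> bool" where
  "regular_transitions M N \<xi> Q \<longleftrightarrow>
     (\<forall>k\<ge>2. Q k \<in> measurable N (prob_algebra N) \<and>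
       (\<forall>A\<in>sets N. AE \<omega> in M.
          real_cond_exp M (generated_sigma M N \<xi> {k - 1})
            (indicator (\<xi> k -` A \<inter> space M)) \<omega>
        = measure (Q k (\<xi> (k - 1) \<omega>)) A))"

definition marginal ::
  "'a measure \<Rightarrow> 's measure \<Rightarrow> (nat \<Rightarrow> 'a \<Rightarrow> 's) \<Rightarrow> nat \<Rightarrow> 's measure" where
  "marginal M N \<xi> k = distr M N (\<xi> k)"

definition partial_sum :: "(nat \<Rightarrow> 'a \<Rightarrow> real) \<Rightarrow> nat \<Rightarrow> 'a \<Rightarrow> real" where
  "partial_sum X n \<omega> = (\<Sum>k=1..n. X k \<omega>)"

definition sum_sd :: "'a measure \<Rightarrow> (nat \<Rightarrow> 'a \<Rightarrow> real) \<Rightarrow> nat \<Rightarrow> real" where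
  "sum_sd M X n = sqrt (LINT \<omega>|M. (partial_sum X n \<omega>)\<^sup>2)"

definition root_sum_var :: "'a measure \<Rightarrow> (nat \<Rightarrow> 'a \<Rightarrow> real) \<Rightarrow> nat \<Rightarrow> real" where
  "root_sum_var M X n = sqrt (\<Sum>j=1..n. LINT \<omega>|M. (X j \<omega>)\<^sup>2)"

definition char_fun :: "'a measure \<Rightarrow> (nat \<Rightarrow> 'a \<Rightarrow> real) \<Rightarrow> nat \<Rightarrow> real \<Rightarrow> complex" where
  "char_fun M X k = char (distr M borel (X k))"

end

theory Submission
  imports Defs
begin

text \<open>
  Fourier inversion with the Fejer kernel reduces the local limit theorem to three facts about
  \<open>E (exp (i t S\<^sub>n))\<close>: the central limit theorem at scale \<open>1 / \<tau>\<^sub>n\<close>, an integrable bound there, and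
  decay faster than \<open>1 / \<tau>\<^sub>n\<close> on compact sets off the origin.

  The last two follow from Conditions A and B through
  \<open>|E (exp (i t S\<^sub>n))| \<le> e * exp (- a\<^sup>2 / 4 * \<Sum>k\<le>n. (1 - |f\<^sub>k t|\<^sup>2))\<close>. Indeed a transition kernel that
  dominates \<open>a\<close> times the marginal law contracts functions of mean zero in the supremum norm by \<open>1 - a\<close>,
  and two consecutive transitions multiply the supremum norm by at most \<open>1 - a\<^sup>2 / 2 * (1 - |f\<^sub>k t|\<^sup>2)\<close>.

  For the central limit theorem, adding to \<open>S\<^sub>k\<close> the corrector \<open>\<theta>\<^sub>k(\<xi>\<^sub>k) = E (S\<^sub>n - S\<^sub>k | \<xi>\<^sub>k)\<close> gives a
  martingale. By the upper kernel bound and Lindeberg's condition the correctors are uniformly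
  \<open>o(\<tau>\<^sub>n)\<close>, so no truncation is needed. The fluctuations of the conditional variances have mean zero and
  are removed by a second corrector.
\<close>

section \<open>The Fejer kernel\<close>

text \<open>Condition B controls the characteristic functions only locally, hence on compact sets,
  so the test functions must have Fourier transforms of compact support. Scaled Fejer kernels do; a
  general compactly supported \<open>h\<close> does not. It is replaced by its convolution with a
  narrow Fejer kernel. The error of this replacement must not be measured by a constant, since it is
  multiplied by \<sigma>_n; it is measured by a small multiple of two translates of the Fejer
  kernel, whose expectations are of order 1/\<sigma>_n by the limit already known for Fejer kernels.
  A second obstacle is cancellation: the variance of a dependent sum might be of smaller order than
  \<tau>_n^2. The lower kernel bound excludes this, because each martingale increment keeps, given
  the past, at least \<open>a\<close> times its second moment under the marginal law. The exponent
  a^2/4 serves because a \<le> 1 \<le> b gives \<gamma>/8 \<le> a^2/4.\<close>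

definition fejer :: "real \<Rightarrow> real" where
  "fejer x = (if x = 0 then 1 / (2 * pi) else (1 - cos x) / (pi * x\<^sup>2))"

lemma fejer_nonneg: "0 \<le> fejer x"
  by (simp add: fejer_def)

lemma fejer_measurable[measurable]: "fejer \<in> borel_measurable borel"
  unfolding fejer_def[abs_def] by measurable

lemma one_minus_cos_le: "1 - cos x \<le> x\<^sup>2 / 2" for x :: real
proof -
  have "1 - cos x = 2 * (sin (x / 2))\<^sup>2" using cos_double_sin[of "x / 2"] by simp
  also have "(sin (x / 2))\<^sup>2 \<le> (x / 2)\<^sup>2"
    using power_mono[OF abs_sin_x_le_abs_x abs_ge_zero, of "x / 2" 2] by (simp only: power2_abs)
  finally show ?thesis by (simp add: power2_eq_square)
qed

lemma fejer_le_const: "fejer x \<le> 1 / (2 * pi)"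
proof (cases "x = 0")
  case False
  have "(1 - cos x) / (pi * x\<^sup>2) \<le> (x\<^sup>2 / 2) / (pi * x\<^sup>2)"
    using one_minus_cos_le by (intro divide_right_mono) auto
  also have "\<dots> = 1 / (2 * pi)" using False by (simp add: field_simps)
  finally show ?thesis using False by (simp add: fejer_def)
qed (simp add: fejer_def)

lemma fejer_le_inverse_square: "x \<noteq> 0 \<Longrightarrow> fejer x \<le> 2 / (pi * x\<^sup>2)"
  unfolding fejer_def using cos_ge_minus_one[of x] by (auto intro!: divide_right_mono simp del: cos_ge_minus_one)

text \<open>The numerators of the two summands are \<open>1 - cos x\<close> and \<open>1 + cos x\<close>, so their zeros do not meet.\<close>

lemma fejer_pair_lower_bound: "2 / (pi * (\<bar>x\<bar> + pi)\<^sup>2) \<le> fejer x + fejer (x + pi)"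
proof -
  have *: "(1 - cos y) / (pi * r\<^sup>2) \<le> fejer y" if "\<bar>y\<bar> \<le> r" for y r :: real
  proof (cases "y = 0")
    case False
    have "(1 - cos y) / (pi * r\<^sup>2) \<le> (1 - cos y) / (pi * y\<^sup>2)"
      using False that by (intro divide_left_mono mult_left_mono mult_pos_pos) (auto simp: abs_le_square_iff[symmetric])
    then show ?thesis using False by (simp add: fejer_def)
  qed (simp add: fejer_def)
  have "2 / (pi * (\<bar>x\<bar> + pi)\<^sup>2) = (1 - cos x) / (pi * (\<bar>x\<bar> + pi)\<^sup>2) + (1 - cos (x + pi)) / (pi * (\<bar>x\<bar> + pi)\<^sup>2)"
    by (simp add: add_divide_distrib[symmetric])
  also have "\<dots> \<le> fejer x + fejer (x + pi)"
    by (intro add_mono *) (auto intro: order_trans[OF abs_triangle_ineq])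
  finally show ?thesis .
qed

text \<open>Integration by parts gives the antiderivative Si x - (1 - cos x)/x of (1 - cos x)/x^2.
  It is odd, tends to 0 at the origin and to pi/2 at infinity. Since the integrand is nonnegative,
  the fundamental theorem on each open half line yields integrability together with the
  value.\<close>

lemma fejer_integral: "integrable lborel fejer" "(\<integral>x. fejer x \<partial>lborel) = 1"
proof -
  define f where "f x = (1 - cos x) / x\<^sup>2" for x :: real
  define G where "G x = Si x - (1 - cos x) / x" for x :: real
  have DG: "DERIV G x :> f x" if "x \<noteq> 0" for x
  proof -
    have "(G has_real_derivative sin x / x - (sin x * x - (1 - cos x)) / x\<^sup>2) (at x)"
      unfolding G_def using that DERIV_Si[of x]
      by (auto intro!: derivative_eq_intros simp: power2_eq_square)
    moreover have "sin x / x - (sin x * x - (1 - cos x)) / x\<^sup>2 = f x"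
      using that by (simp add: f_def field_simps power2_eq_square)
    ultimately show ?thesis by simp
  qed
  have f_cont: "isCont f x" if "x \<noteq> 0" for x
    unfolding f_def using that by (intro continuous_intros) auto
  have f0: "0 \<le> f x" for x by (simp add: f_def)
  have G0: "(G \<longlongrightarrow> 0) (at 0)"
  proof -
    have 1: "(Si \<longlongrightarrow> Si 0) (at 0)" using isCont_Si[of 0] by (simp add: isCont_def)
    have 2: "((\<lambda>x::real. (1 - cos x) / x) \<longlongrightarrow> 0) (at 0)"
    proof (rule Lim_null_comparison)
      have "\<bar>(1 - cos x) / x\<bar> \<le> \<bar>x\<bar>" if "x \<noteq> 0" for x :: real
      proof -
        have "\<bar>1 - cos x\<bar> \<le> \<bar>x\<bar> * \<bar>x\<bar>"
          using one_minus_cos_le[of x] zero_le_square[of x] cos_le_one[of x]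
          unfolding power2_eq_square abs_mult_self_eq by linarith
        then show ?thesis using that by (simp add: abs_divide divide_le_eq)
      qed
      then show "\<forall>\<^sub>F x::real in at 0. norm ((1 - cos x) / x) \<le> \<bar>x\<bar>"
        by (auto simp: eventually_at intro!: exI[of _ 1])
      show "((\<lambda>x::real. \<bar>x\<bar>) \<longlongrightarrow> 0) (at 0)" by (auto intro!: tendsto_eq_intros)
    qed
    have "Si 0 = 0" using Si_neg[of 0] by simp
    then show ?thesis unfolding G_def using tendsto_diff[OF 1 2] by simp
  qed
  have bdd: "\<bar>(1 - cos x) / x\<bar> \<le> 2 / \<bar>x\<bar>" for x :: real
    using cos_le_one[of x] cos_ge_minus_one[of x] by (auto simp: abs_divide intro!: divide_right_mono simp del: cos_le_one cos_ge_minus_one)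
  have G_top: "(G \<longlongrightarrow> pi / 2) at_top"
  proof -
    have "((\<lambda>x::real. (1 - cos x) / x) \<longlongrightarrow> 0) at_top"
    proof (rule Lim_null_comparison)
      show "\<forall>\<^sub>F x::real in at_top. norm ((1 - cos x) / x) \<le> 2 / \<bar>x\<bar>" using bdd by (intro always_eventually) auto
      show "((\<lambda>x::real. 2 / \<bar>x\<bar>) \<longlongrightarrow> 0) at_top"
        by (intro tendsto_divide_0[OF tendsto_const] filterlim_at_top_imp_at_infinity filterlim_abs_real)
    qed
    from tendsto_diff[OF Si_at_top this] show ?thesis by (simp add: G_def[abs_def])
  qed
  have G_odd: "G (- x) = - G x" for x
    unfolding G_def using Si_neg[of x] Si_neg[of "- x"] by (cases "0 \<le> x") auto
  have G_bot: "(G \<longlongrightarrow> - pi / 2) at_bot"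
    using tendsto_minus[OF G_top] unfolding filterlim_at_bot_mirror by (simp add: G_odd)
  have pos: "set_integrable lborel (einterval 0 \<infinity>) f" "(LBINT x=0..\<infinity>. f x) = pi / 2 - 0"
    by (rule interval_integral_FTC_nonneg[where F = G];
        use DG f_cont f0 G_top in \<open>auto simp: zero_ereal_def ereal_tendsto_simps intro: filterlim_mono[OF G0 order_refl] at_le\<close>)+
  have neg: "set_integrable lborel (einterval (-\<infinity>) 0) f" "(LBINT x=-\<infinity>..0. f x) = 0 - (- pi / 2)"
    by (rule interval_integral_FTC_nonneg[where F = G];
        use DG f_cont f0 G_bot in \<open>auto simp: zero_ereal_def ereal_tendsto_simps intro: filterlim_mono[OF G0 order_refl] at_le\<close>)+
  have e: "einterval 0 \<infinity> = {0<..}" "einterval (-\<infinity>) 0 = {..<0::real}"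
    by (auto simp: einterval_def zero_ereal_def)
  have p: "set_integrable lborel {0<..} f" "(LBINT x:{0<..}. f x) = pi / 2"
    using pos by (simp_all add: e interval_lebesgue_integral_def)
  have n: "set_integrable lborel {..<0} f" "(LBINT x:{..<0}. f x) = pi / 2"
    using neg by (simp_all add: e interval_lebesgue_integral_def)
  have U: "set_integrable lborel ({0<..} \<union> {..<0}) f" "(LBINT x:{0<..} \<union> {..<0}. f x) = pi"
    using set_integrable_Un[OF p(1) n(1)] set_integral_Un[OF _ p(1) n(1)] p(2) n(2)
    by (auto simp: disjoint_iff)
  have AE: "AE x in lborel. indicator ({0<..} \<union> {..<0}) x *\<^sub>R f x = pi * fejer x"
    using AE_lborel_singleton[of 0] by eventually_elim (auto simp: f_def fejer_def indicator_def)
  have [measurable]: "f \<in> borel_measurable borel" unfolding f_def[abs_def] by measurable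
  have "integrable lborel (\<lambda>x. pi * fejer x)"
    using Bochner_Integration.integrable_cong_AE_imp[OF U(1)[unfolded set_integrable_def] _ AE] by simp
  then show "integrable lborel fejer" by simp
  have "(\<integral>x. pi * fejer x \<partial>lborel) = pi"
    using integral_cong_AE[OF _ _ AE] U(2) by (simp add: set_lebesgue_integral_def)
  then show "(\<integral>x. fejer x \<partial>lborel) = 1" by simp
qed

text \<open>The Fourier transform of \<open>fejer\<close>; its bounded support is the reason for
  choosing this kernel.\<close>

definition triangle :: "real \<Rightarrow> real" where "triangle t = max 0 (1 - \<bar>t\<bar>)"

lemma triangle_measurable[measurable]: "triangle \<in> borel_measurable borel"
  unfolding triangle_def[abs_def] by measurable

lemma triangle_bounds: "0 \<le> triangle t" "triangle t \<le> 1" by (auto simp: triangle_def)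

lemma triangle_eq_0: "1 \<le> \<bar>t\<bar> \<Longrightarrow> triangle t = 0" by (auto simp: triangle_def)

lemma fejer_eq_cos_integral:
  "integrable lborel (\<lambda>t. triangle t * cos (t * y))" "(\<integral>t. triangle t * cos (t * y) \<partial>lborel) = 2 * pi * fejer y"
proof -
  define f where "f t = triangle t * cos (t * y)" for t
  have cont: "continuous_on A f" for A
    unfolding f_def triangle_def by (intro continuous_intros)
  have si: "set_integrable lborel {-1..1} f"
    unfolding set_integrable_def by (rule borel_integrable_compact) (auto intro: cont)
  have eq: "indicator {-1..1} t *\<^sub>R f t = f t" for t
    using triangle_eq_0[of t] by (cases "\<bar>t\<bar> \<le> 1") (auto simp: f_def indicator_def)
  show "integrable lborel (\<lambda>t. triangle t * cos (t * y))"
    using si by (simp only: set_integrable_def eq) (simp add: f_def)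
  \<comment> \<open>Antiderivatives of \<open>(1 - t) * cos (t * y)\<close> and
    \<open>(1 + t) * cos (t * y)\<close>, found by parts; they cover the right and left half of the
    support. The case \<open>y = 0\<close> is separate because of the division by
    \<open>y\<close>.\<close>
  define G1 G2 where
    "G1 t = (if y = 0 then t - t\<^sup>2 / 2 else (1 - t) * sin (t * y) / y - cos (t * y) / y\<^sup>2)" and
    "G2 t = (if y = 0 then t + t\<^sup>2 / 2 else (1 + t) * sin (t * y) / y + cos (t * y) / y\<^sup>2)" for t
  have D1: "DERIV G1 t :> (1 - t) * cos (t * y)" for t
  proof (cases "y = 0")
    case True
    then have "G1 = (\<lambda>t. t - t\<^sup>2 / 2)" by (simp add: G1_def fun_eq_iff)
    then show ?thesis using True by (auto intro!: derivative_eq_intros)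
  next
    case False
    then have "G1 = (\<lambda>t. (1 - t) * sin (t * y) / y - cos (t * y) / y\<^sup>2)" by (simp add: G1_def fun_eq_iff)
    then show ?thesis using False by (auto intro!: derivative_eq_intros simp: field_simps power2_eq_square)
  qed
  have D2: "DERIV G2 t :> (1 + t) * cos (t * y)" for t
  proof (cases "y = 0")
    case True
    then have "G2 = (\<lambda>t. t + t\<^sup>2 / 2)" by (simp add: G2_def fun_eq_iff)
    then show ?thesis using True by (auto intro!: derivative_eq_intros)
  next
    case False
    then have "G2 = (\<lambda>t. (1 + t) * sin (t * y) / y + cos (t * y) / y\<^sup>2)" by (simp add: G2_def fun_eq_iff)
    then show ?thesis using False by (auto intro!: derivative_eq_intros simp: field_simps power2_eq_square)
  qed
  have 1: "(f has_integral (G1 1 - G1 0)) {0..1}"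
    by (rule fundamental_theorem_of_calculus)
       (auto simp: f_def triangle_def has_real_derivative_iff_has_vector_derivative[symmetric] intro!: has_field_derivative_at_within[OF D1[THEN DERIV_cong]])
  have 2: "(f has_integral (G2 0 - G2 (-1))) {-1..0}"
    by (rule fundamental_theorem_of_calculus)
       (auto simp: f_def triangle_def has_real_derivative_iff_has_vector_derivative[symmetric] intro!: has_field_derivative_at_within[OF D2[THEN DERIV_cong]])
  have "(f has_integral (G2 0 - G2 (-1) + (G1 1 - G1 0))) {-1..1}"
    by (rule has_integral_combine[OF _ _ 2 1]) auto
  then have "integral {-1..1} f = 2 * pi * fejer y"
    by (simp add: integral_unique) (auto simp: G1_def G2_def fejer_def field_simps)
  moreover have "(\<integral>t. f t \<partial>lborel) = integral {-1..1} f"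
    using set_borel_integral_eq_integral(2)[OF si] by (simp only: set_lebesgue_integral_def eq)
  ultimately show "(\<integral>t. triangle t * cos (t * y) \<partial>lborel) = 2 * pi * fejer y"
    by (simp add: f_def)
qed

section \<open>Fourier inversion for scaled Fejer kernels and Gaussian densities\<close>

lemma scaled_fejer_eq_cos_integral:
  assumes "0 < l"
  shows "l * fejer (l * y) = 1 / (2 * pi) * (\<integral>t. triangle (t / l) * cos (t * y) \<partial>lborel)"
  using assms lborel_integral_real_affine[of "1 / l" "\<lambda>t. triangle t * cos (t * (l * y))" 0]
  by (simp add: fejer_eq_cos_integral(2) field_simps)

lemma triangle_scaled_integrable: "0 < l \<Longrightarrow> integrable lborel (\<lambda>t. triangle (t / l))"
  using lborel_integrable_real_affine[of "\<lambda>t. triangle t * cos (t * 0)" "1 / l" 0] fejer_eq_cos_integral(1)[of 0]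
  by simp

lemma exp_square_integrable:
  assumes "0 < r" shows "integrable lborel (\<lambda>w::real. exp (- (w\<^sup>2 * r\<^sup>2 / 2)))"
proof -
  have "integrable lborel (\<lambda>w. sqrt (2 * pi) / r * normal_density 0 (1 / r) w)"
    using assms by (intro integrable_mult_right) auto
  also have "(\<lambda>w. sqrt (2 * pi) / r * normal_density 0 (1 / r) w) = (\<lambda>w. exp (- (w\<^sup>2 * r\<^sup>2 / 2)))"
    using assms by (auto simp: normal_density_def real_sqrt_mult real_sqrt_divide field_simps power_divide)
  finally show ?thesis .
qed

text \<open>The characteristic function of the standard normal law, read as a cosine transform and
  rescaled.\<close>

lemma exp_square_eq_cos_integral:
  assumes r: "0 < r"
  shows "(\<integral>w. cos (w * y) * exp (- (w\<^sup>2 * r\<^sup>2 / 2)) \<partial>lborel) = sqrt (2 * pi) / r * exp (- ((y / r)\<^sup>2 / 2))"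
proof -
  interpret N: prob_space std_normal_distribution by (rule prob_space_normal_density) simp
  have "complex_of_real (exp (- (t\<^sup>2) / 2)) = (\<integral>x. iexp (t * x) \<partial>std_normal_distribution)" for t
    using fun_cong[OF char_std_normal_distribution, of t] by (simp add: char_def)
  then have "exp (- (t\<^sup>2) / 2) = Re (\<integral>x. iexp (t * x) \<partial>std_normal_distribution)" for t
    by (metis Re_complex_of_real)
  also have "Re (\<integral>x. iexp (t * x) \<partial>std_normal_distribution) = (\<integral>x. cos (t * x) \<partial>std_normal_distribution)" for t
    by (subst integral_Re[symmetric]) (auto intro!: N.integrable_const_bound[of _ 1] simp: Re_exp)
  also have "(\<integral>x. cos (t * x) \<partial>std_normal_distribution) = (\<integral>x. std_normal_density x * cos (t * x) \<partial>lborel)" for t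
    by (subst integral_density) auto
  also have "(\<integral>x. std_normal_density x * cos (t * x) \<partial>lborel) = 1 / sqrt (2 * pi) * (\<integral>x. cos (t * x) * exp (- x\<^sup>2 / 2) \<partial>lborel)" for t
    by (simp add: std_normal_density_def mult_ac)
  finally have *: "(\<integral>x. cos (t * x) * exp (- x\<^sup>2 / 2) \<partial>lborel) = sqrt (2 * pi) * exp (- (t\<^sup>2) / 2)" for t
    by (simp add: field_simps)
  have "(\<integral>x. cos (y / r * x) * exp (- x\<^sup>2 / 2) \<partial>lborel)
      = r * (\<integral>w. cos (y / r * (0 + r * w)) * exp (- (0 + r * w)\<^sup>2 / 2) \<partial>lborel)"
    using r by (subst lborel_integral_real_affine[of r _ 0]) auto
  also have "(\<lambda>w. cos (y / r * (0 + r * w)) * exp (- (0 + r * w)\<^sup>2 / 2)) = (\<lambda>w. cos (w * y) * exp (- (w\<^sup>2 * r\<^sup>2 / 2)))"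
    using r by (auto simp: power_mult_distrib mult_ac)
  finally show ?thesis using *[of "y / r"] r by (simp add: field_simps)
qed

text \<open>The factor \<open>triangle (t / l)\<close> makes the double integral absolutely
  convergent, so Fubini applies without any decay of the characteristic function.\<close>

lemma (in prob_space) expectation_scaled_fejer:
  fixes X :: "'a \<Rightarrow> real"
  assumes [measurable]: "X \<in> borel_measurable M" and l: "0 < l"
  shows "integrable M (\<lambda>\<omega>. l * fejer (l * (X \<omega> - u)))"
    and "integrable lborel (\<lambda>t. triangle (t / l) * Re (iexp (- (t * u)) * expectation (\<lambda>\<omega>. iexp (t * X \<omega>))))"
    and "expectation (\<lambda>\<omega>. l * fejer (l * (X \<omega> - u)))
      = 1 / (2 * pi) * (\<integral>t. triangle (t / l) * Re (iexp (- (t * u)) * expectation (\<lambda>\<omega>. iexp (t * X \<omega>))) \<partial>lborel)"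
proof -
  interpret pair_sigma_finite M lborel ..
  show "integrable M (\<lambda>\<omega>. l * fejer (l * (X \<omega> - u)))"
  proof (rule integrable_const_bound)
    show "AE \<omega> in M. norm (l * fejer (l * (X \<omega> - u))) \<le> l * (1 / (2 * pi))"
      using mult_left_mono[OF fejer_le_const less_imp_le[OF l]] l fejer_nonneg by (intro AE_I2) (simp add: abs_mult)
  qed measurable
  have fi: "integrable (M \<Otimes>\<^sub>M lborel) (case_prod (\<lambda>\<omega> t. triangle (t / l) * cos (t * (X \<omega> - u))))"
  proof (rule Fubini_integrable)
    have bd: "norm (triangle (t / l) * cos (t * (X \<omega> - u))) \<le> triangle (t / l)" for t \<omega>
      using triangle_bounds[of "t / l"] mult_left_mono[OF abs_cos_le_one[of "t * (X \<omega> - u)"] triangle_bounds(1)[of "t / l"]]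
      by (simp add: abs_mult)
    have ti: "integrable lborel (\<lambda>t. triangle (t / l) * cos (t * (X \<omega> - u)))" for \<omega>
      by (rule Bochner_Integration.integrable_bound[OF triangle_scaled_integrable[OF l]])
         (use bd triangle_bounds in \<open>auto intro!: AE_I2\<close>)
    show "integrable M (\<lambda>\<omega>. \<integral>t. norm (case (\<omega>, t) of (\<omega>, t) \<Rightarrow> triangle (t / l) * cos (t * (X \<omega> - u))) \<partial>lborel)"
    proof (rule integrable_const_bound)
      show "AE \<omega> in M. norm (\<integral>t. norm (case (\<omega>, t) of (\<omega>, t) \<Rightarrow> triangle (t / l) * cos (t * (X \<omega> - u))) \<partial>lborel)
          \<le> (\<integral>t. triangle (t / l) \<partial>lborel)"
        using bd ti by (intro AE_I2) (auto intro!: integral_mono integrable_abs triangle_scaled_integrable l simp: integral_nonneg_AE)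
    qed measurable
    show "AE \<omega> in M. integrable lborel (\<lambda>t. case (\<omega>, t) of (\<omega>, t) \<Rightarrow> triangle (t / l) * cos (t * (X \<omega> - u)))"
      using ti by simp
  qed measurable
  have eq: "expectation (\<lambda>\<omega>. triangle (t / l) * cos (t * (X \<omega> - u)))
      = triangle (t / l) * Re (iexp (- (t * u)) * expectation (\<lambda>\<omega>. iexp (t * X \<omega>)))" for t
  proof -
    have i: "integrable M (\<lambda>\<omega>. iexp (t * X \<omega>))" by (rule integrable_const_bound[of _ 1]) auto
    have "cos (t * (X \<omega> - u)) = Re (iexp (- (t * u)) * iexp (t * X \<omega>))" for \<omega>
      unfolding exp_add[symmetric] by (simp add: Re_exp algebra_simps)
    then have "expectation (\<lambda>\<omega>. cos (t * (X \<omega> - u))) = expectation (\<lambda>\<omega>. Re (iexp (- (t * u)) * iexp (t * X \<omega>)))" by simp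
    also have "\<dots> = Re (iexp (- (t * u)) * expectation (\<lambda>\<omega>. iexp (t * X \<omega>)))"
      using i by (simp del: times_complex.sel)
    finally show ?thesis by simp
  qed
  have "integrable lborel (\<lambda>t. expectation (\<lambda>\<omega>. triangle (t / l) * cos (t * (X \<omega> - u))))"
    using integrable_snd[OF fi] .
  then show "integrable lborel (\<lambda>t. triangle (t / l) * Re (iexp (- (t * u)) * expectation (\<lambda>\<omega>. iexp (t * X \<omega>))))"
    unfolding eq .
  have "expectation (\<lambda>\<omega>. l * fejer (l * (X \<omega> - u)))
    = 1 / (2 * pi) * expectation (\<lambda>\<omega>. \<integral>t. triangle (t / l) * cos (t * (X \<omega> - u)) \<partial>lborel)"
    by (simp add: scaled_fejer_eq_cos_integral[OF l])
  also have "expectation (\<lambda>\<omega>. \<integral>t. triangle (t / l) * cos (t * (X \<omega> - u)) \<partial>lborel)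
    = (\<integral>t. expectation (\<lambda>\<omega>. triangle (t / l) * cos (t * (X \<omega> - u))) \<partial>lborel)"
    using Fubini_integral[OF fi] ..
  finally show "expectation (\<lambda>\<omega>. l * fejer (l * (X \<omega> - u)))
      = 1 / (2 * pi) * (\<integral>t. triangle (t / l) * Re (iexp (- (t * u)) * expectation (\<lambda>\<omega>. iexp (t * X \<omega>))) \<partial>lborel)"
    unfolding eq .
qed

text \<open>The distance of the two Fourier integrands after the substitution of
  \<open>w / t\<close> for the frequency. Here \<open>l\<close> is the bandwidth of the test kernel,
  while \<open>s\<close> and \<open>t\<close> stand for \<sigma>_n and \<tau>_n.\<close>

definition char_gap :: "(real \<Rightarrow> complex) \<Rightarrow> real \<Rightarrow> real \<Rightarrow> real \<Rightarrow> real \<Rightarrow> real" where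
  "char_gap \<phi> l s t w = norm (of_real (triangle (w / (l * t))) * \<phi> (w / t) - of_real (exp (- (w\<^sup>2 * (s / t)\<^sup>2 / 2))))"

lemma (in prob_space) iexp_expectation_measurable:
  fixes X :: "'a \<Rightarrow> real"
  assumes [measurable]: "X \<in> borel_measurable M"
  shows "(\<lambda>t. expectation (\<lambda>\<omega>. iexp (t * X \<omega>))) \<in> borel_measurable borel"
  by measurable

lemma (in prob_space) norm_iexp_expectation_le_1:
  "norm (expectation (\<lambda>\<omega>. iexp (t * X \<omega>))) \<le> 1"
proof -
  have "norm (expectation (\<lambda>\<omega>. iexp (t * X \<omega>))) \<le> expectation (\<lambda>\<omega>. norm (iexp (t * X \<omega>)))"
    by (rule integral_norm_bound)
  then show ?thesis by (simp add: prob_space)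
qed

text \<open>Both terms are Fourier integrals against the same oscillating factor. The translation
  \<open>u\<close> enters only through this factor, which has modulus 1, so the bound is uniform in
  \<open>u\<close>. The constant 1/sqrt(2 pi) left in front is estimated by 1.\<close>

lemma (in prob_space) fejer_local_bound:
  fixes X :: "'a \<Rightarrow> real"
  assumes X[measurable]: "X \<in> borel_measurable M" and l: "0 < l" and s: "0 < s" and t: "0 < t"
  defines "\<phi> \<equiv> \<lambda>t. expectation (\<lambda>\<omega>. iexp (t * X \<omega>))"
  shows "integrable lborel (char_gap \<phi> l s t)"
    and "\<bar>sqrt (2 * pi) * s * expectation (\<lambda>\<omega>. l * fejer (l * (X \<omega> - u))) - exp (- (u\<^sup>2 / (2 * s\<^sup>2)))\<bar>
      \<le> s / t * (\<integral>w. char_gap \<phi> l s t w \<partial>lborel)"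
proof -
  define q where "q w = exp (- (w\<^sup>2 * (s / t)\<^sup>2 / 2))" for w
  define p where "p w = of_real (triangle (w / (l * t))) * \<phi> (w / t)" for w
  have [measurable]: "\<phi> \<in> borel_measurable borel"
    unfolding \<phi>_def using X by (rule iexp_expectation_measurable)
  have [measurable]: "q \<in> borel_measurable borel" "p \<in> borel_measurable borel"
    unfolding q_def[abs_def] p_def[abs_def] by measurable
  have qi: "integrable lborel q" unfolding q_def[abs_def] using s t by (intro exp_square_integrable) simp
  have pb: "norm (p w) \<le> triangle (w / (l * t))" for w
    using mult_left_mono[OF norm_iexp_expectation_le_1[where X = X and t = "w / t"] triangle_bounds(1), of "w / (l * t)"]
      triangle_bounds(1)
    by (simp add: p_def norm_mult \<phi>_def)
  have pi': "integrable lborel p"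
    by (rule Bochner_Integration.integrable_bound[OF triangle_scaled_integrable[of "l * t"]])
       (use l t pb triangle_bounds in \<open>auto intro!: AE_I2\<close>)
  have gap: "char_gap \<phi> l s t = (\<lambda>w. norm (p w - q w))"
    by (simp add: char_gap_def p_def q_def fun_eq_iff)
  show "integrable lborel (char_gap \<phi> l s t)"
    unfolding gap using pi' qi by (intro integrable_norm Bochner_Integration.integrable_diff) auto
  define r where "r w = Re (iexp (- (w * (u / t))) * p w) - cos (w * (u / t)) * q w" for w
  have norm_rot: "norm (iexp (- (w * (u / t))) * z) = norm z" for w z
    by (simp only: norm_mult norm_exp_i_times mult_1)
  have i1: "integrable lborel (\<lambda>w. Re (iexp (- (w * (u / t))) * p w))"
  proof (rule Bochner_Integration.integrable_bound[OF pi'])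
    show "AE w in lborel. norm (Re (iexp (- (w * (u / t))) * p w)) \<le> norm (p w)"
      using abs_Re_le_cmod norm_rot unfolding real_norm_def by (intro AE_I2) metis
  qed measurable
  have i2: "integrable lborel (\<lambda>w. cos (w * (u / t)) * q w)"
    by (rule Bochner_Integration.integrable_bound[OF qi])
       (auto intro!: AE_I2 simp: abs_mult q_def mult_le_cancel_right1)
  have "expectation (\<lambda>\<omega>. l * fejer (l * (X \<omega> - u)))
    = 1 / (2 * pi) * (\<integral>x. triangle (x / l) * Re (iexp (- (x * u)) * \<phi> x) \<partial>lborel)"
    unfolding \<phi>_def using X l by (rule expectation_scaled_fejer)
  also have "(\<integral>x. triangle (x / l) * Re (iexp (- (x * u)) * \<phi> x) \<partial>lborel)
    = 1 / t * (\<integral>w. triangle ((0 + 1 / t * w) / l) * Re (iexp (- ((0 + 1 / t * w) * u)) * \<phi> (0 + 1 / t * w)) \<partial>lborel)"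
    using t by (subst lborel_integral_real_affine[of "1 / t" _ 0]) auto
  also have "(\<lambda>w. triangle ((0 + 1 / t * w) / l) * Re (iexp (- ((0 + 1 / t * w) * u)) * \<phi> (0 + 1 / t * w)))
    = (\<lambda>w. Re (iexp (- (w * (u / t))) * p w))"
  proof
    fix w
    have "Re (iexp (- (w * (u / t))) * p w) = Re (of_real (triangle (w / (l * t))) * (iexp (- (w * (u / t))) * \<phi> (w / t)))"
      by (simp only: p_def mult_ac)
    also have "\<dots> = triangle (w / (l * t)) * Re (iexp (- (w * (u / t))) * \<phi> (w / t))"
      by (simp only: Re_complex_of_real Im_complex_of_real times_complex.sel)
    finally show "triangle ((0 + 1 / t * w) / l) * Re (iexp (- ((0 + 1 / t * w) * u)) * \<phi> (0 + 1 / t * w))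
      = Re (iexp (- (w * (u / t))) * p w)"
      by (simp add: mult.commute del: times_complex.sel)
  qed
  finally have E: "expectation (\<lambda>\<omega>. l * fejer (l * (X \<omega> - u)))
    = 1 / (2 * pi) * (1 / t * (\<integral>w. Re (iexp (- (w * (u / t))) * p w) \<partial>lborel))" .
  have "sqrt (2 * pi) * s * (1 / (2 * pi) * (1 / t * I)) = s / t / sqrt (2 * pi) * I" for I
  proof -
    define q where "q = sqrt (2 * pi)"
    have q: "2 * pi = q * q" "q \<noteq> 0" by (simp_all add: q_def)
    show ?thesis unfolding q_def[symmetric] q(1) using q(2) t by (simp add: field_simps)
  qed
  then have 1: "sqrt (2 * pi) * s * expectation (\<lambda>\<omega>. l * fejer (l * (X \<omega> - u)))
    = s / t / sqrt (2 * pi) * (\<integral>w. Re (iexp (- (w * (u / t))) * p w) \<partial>lborel)"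
    unfolding E .
  have 2: "exp (- (u\<^sup>2 / (2 * s\<^sup>2))) = s / t / sqrt (2 * pi) * (\<integral>w. cos (w * (u / t)) * q w \<partial>lborel)"
    unfolding q_def using exp_square_eq_cos_integral[of "s / t" "u / t"] s t
    by (simp add: field_simps power_divide)
  have "\<bar>(\<integral>w. r w \<partial>lborel)\<bar> \<le> (\<integral>w. \<bar>r w\<bar> \<partial>lborel)"
    by (rule integral_abs_bound)
  also have "\<dots> \<le> (\<integral>w. char_gap \<phi> l s t w \<partial>lborel)"
  proof (rule integral_mono)
    show "integrable lborel (\<lambda>w. \<bar>r w\<bar>)" unfolding r_def using i1 i2 by auto
    show "\<bar>r w\<bar> \<le> char_gap \<phi> l s t w" for w
    proof -
      have "r w = Re (iexp (- (w * (u / t))) * (p w - q w))"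
        by (simp add: r_def Re_exp Im_exp algebra_simps)
      also have "\<bar>\<dots>\<bar> \<le> norm (iexp (- (w * (u / t))) * (p w - q w))" by (rule abs_Re_le_cmod)
      also have "\<dots> = char_gap \<phi> l s t w" by (simp only: gap norm_rot)
      finally show ?thesis .
    qed
  qed fact
  finally have 3: "\<bar>(\<integral>w. r w \<partial>lborel)\<bar> \<le> (\<integral>w. char_gap \<phi> l s t w \<partial>lborel)" .
  have "sqrt (2 * pi) * s * expectation (\<lambda>\<omega>. l * fejer (l * (X \<omega> - u))) - exp (- (u\<^sup>2 / (2 * s\<^sup>2)))
    = s / t / sqrt (2 * pi) * (\<integral>w. r w \<partial>lborel)"
    unfolding 1 2 r_def using i1 i2 by (simp add: right_diff_distrib del: times_complex.sel)
  also have "\<bar>\<dots>\<bar> \<le> s / t * (1 * (\<integral>w. char_gap \<phi> l s t w \<partial>lborel))"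
  proof -
    have "1 \<le> sqrt (2 * pi)" using pi_gt3 by simp
    then have "1 / sqrt (2 * pi) * \<bar>\<integral>w. r w \<partial>lborel\<bar> \<le> 1 * (\<integral>w. char_gap \<phi> l s t w \<partial>lborel)"
      using 3 by (intro mult_mono) auto
    then have "s / t * (1 / sqrt (2 * pi) * \<bar>\<integral>w. r w \<partial>lborel\<bar>) \<le> s / t * (1 * (\<integral>w. char_gap \<phi> l s t w \<partial>lborel))"
      using s t by (intro mult_left_mono) auto
    then show ?thesis using s t by (simp add: abs_mult)
  qed
  finally show "\<bar>sqrt (2 * pi) * s * expectation (\<lambda>\<omega>. l * fejer (l * (X \<omega> - u))) - exp (- (u\<^sup>2 / (2 * s\<^sup>2)))\<bar>
      \<le> s / t * (\<integral>w. char_gap \<phi> l s t w \<partial>lborel)" by simp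
qed

section \<open>Approximation of test functions by Fejer convolutions\<close>

lemma fejer_tail:
  assumes "0 < e"
  obtains Z where "0 < Z" "(\<integral>z. indicator {z. Z < \<bar>z\<bar>} z * fejer z \<partial>lborel) \<le> e"
proof -
  have "(\<lambda>n. \<integral>z. indicator {z. real n < \<bar>z\<bar>} z * fejer z \<partial>lborel) \<longlonglongrightarrow> (\<integral>z. (0::real) \<partial>(lborel :: real measure))"
  proof (rule integral_dominated_convergence[where w = fejer])
    show "AE z in lborel. (\<lambda>n. indicator {z. real n < \<bar>z\<bar>} z * fejer z) \<longlonglongrightarrow> 0"
    proof (rule AE_I2)
      fix z :: real
      obtain n0 where n0: "\<bar>z\<bar> < real n0" using reals_Archimedean2 by blast
      have "\<forall>\<^sub>F n in sequentially. indicator {z. real n < \<bar>z\<bar>} z * fejer z = 0"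
        using eventually_ge_at_top[of n0] by eventually_elim (use n0 in auto)
      then show "(\<lambda>n. indicator {z. real n < \<bar>z\<bar>} z * fejer z) \<longlonglongrightarrow> 0"
        by (rule tendsto_eventually)
    qed
    show "AE z in lborel. norm (indicator {z. real n < \<bar>z\<bar>} z * fejer z) \<le> fejer z" for n
      using fejer_nonneg by (intro AE_I2) (auto simp: indicator_def)
  qed (auto simp: fejer_integral)
  then have "\<forall>\<^sub>F n in sequentially. (\<integral>z. indicator {z. real n < \<bar>z\<bar>} z * fejer z \<partial>lborel) < e"
    using assms by (intro order_tendstoD) auto
  then obtain n where "(\<integral>z. indicator {z. real n < \<bar>z\<bar>} z * fejer z \<partial>lborel) < e" "0 < n"
    using eventually_gt_at_top[of 0] by (auto dest: eventually_conj simp: eventually_sequentially)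
  then show thesis by (intro that[of "real n"]) auto
qed

text \<open>The error is dominated by an integrable profile instead of a constant, so that its
  expectation can again be controlled by the Fejer local limit. Near the support of
  \<open>h\<close>, uniform continuity gives an error below the minimum of the profile there; far
  away, the convolution decays like 1/(l x^2), and the profile has the same quadratic decay.\<close>

lemma fejer_convolution_approx:
  fixes h :: "real \<Rightarrow> real"
  assumes h: "continuous_on UNIV h" and H: "\<And>x. \<bar>h x\<bar> \<le> H" and R: "1 \<le> R" "\<And>x. R < \<bar>x\<bar> \<Longrightarrow> h x = 0"
    and e: "0 < e"
  obtains l where "0 < l"
    "\<And>x. \<bar>h x - (\<integral>y. h y * (l * fejer (l * (x - y))) \<partial>lborel)\<bar> \<le> e * (fejer x + fejer (x + pi))"
proof -
  have [measurable]: "h \<in> borel_measurable borel" using h by (rule borel_measurable_continuous_onI)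
  have H0: "0 \<le> H" using H[of 0] by linarith
  \<comment> \<open>A lower bound of \<open>fejer x + fejer (x + pi)\<close> on \<bar>x\<bar> \<le>
    2R; an error of at most \<open>e * c\<close> in that range is therefore admissible.\<close>
  define c where "c = 2 / (pi * (2 * R + pi)\<^sup>2)"
  have c: "0 < c" unfolding c_def using R(1) pi_gt_zero
    by (intro divide_pos_pos mult_pos_pos zero_less_power add_pos_pos) auto
  define e' where "e' = e * c"
  have e': "0 < e'" using e c by (simp add: e'_def)
  obtain Z where Z: "0 < Z" "(\<integral>z. indicator {z. Z < \<bar>z\<bar>} z * fejer z \<partial>lborel) \<le> e' / (4 * (H + 1))"
    using fejer_tail[of "e' / (4 * (H + 1))"] e' H0 by auto
  have "uniformly_continuous_on {- (2 * R + 1)..2 * R + 1} h"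
    using h by (intro compact_uniformly_continuous) (auto intro: continuous_on_subset)
  then obtain d where d: "0 < d" "\<And>x y. x \<in> {- (2 * R + 1)..2 * R + 1} \<Longrightarrow> y \<in> {- (2 * R + 1)..2 * R + 1}
      \<Longrightarrow> \<bar>y - x\<bar> < d \<Longrightarrow> \<bar>h y - h x\<bar> < e' / 2"
    using e' unfolding uniformly_continuous_on_def dist_real_def by (metis half_gt_zero)
  \<comment> \<open>The first bound on \<open>l\<close> gives
    \<open>Z / l \<le> min (d / 2) 1\<close>: shifts from the bulk of the kernel are below the
    modulus of continuity and do not leave the interval of radius 2R + 1. The second bound makes the
    far tail of the convolution small relative to the profile.\<close>
  define l where "l = max (max 1 (Z / min (d / 2) 1)) (8 * R * H * (1 + pi)\<^sup>2 / e)"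
  have l: "0 < l" "Z / min (d / 2) 1 \<le> l" "8 * R * H * (1 + pi)\<^sup>2 / e \<le> l" by (auto simp: l_def)
  have Zl: "Z / l \<le> min (d / 2) 1"
    using l(1,2) d(1) by (simp add: field_simps min_def split: if_splits)
  show thesis
  proof (rule that[OF l(1)])
    fix x :: real
    let ?J = "\<integral>y. h y * (l * fejer (l * (x - y))) \<partial>lborel"
    show "\<bar>h x - ?J\<bar> \<le> e * (fejer x + fejer (x + pi))"
    proof (cases "\<bar>x\<bar> \<le> 2 * R")
      case True
      have "?J = 1 / l * (\<integral>z. h (x + - (1 / l) * z) * (l * fejer (l * (x - (x + - (1 / l) * z)))) \<partial>lborel)"
        using l(1) by (subst lborel_integral_real_affine[of "- (1 / l)" _ x]) auto
      also have "\<dots> = (\<integral>z. h (x - z / l) * fejer z \<partial>lborel)"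
        using l(1) by (simp flip: Bochner_Integration.integral_mult_right_zero)
      finally have J: "?J = (\<integral>z. h (x - z / l) * fejer z \<partial>lborel)" .
      have hi: "integrable lborel (\<lambda>z. h (x - z / l) * fejer z)"
        by (rule Bochner_Integration.integrable_bound[OF integrable_mult_right[OF fejer_integral(1), of H]])
           (use H H0 fejer_nonneg in \<open>auto intro!: AE_I2 mult_right_mono simp: abs_mult\<close>)
      have ti: "integrable lborel (\<lambda>z. indicator {z. Z < \<bar>z\<bar>} z * fejer z)"
        by (rule Bochner_Integration.integrable_bound[OF fejer_integral(1)])
           (use fejer_nonneg in \<open>auto intro!: AE_I2 simp: indicator_def\<close>)
      have "h x - ?J = (\<integral>z. h x * fejer z - h (x - z / l) * fejer z \<partial>lborel)"
        unfolding J using hi fejer_integral by simp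
      also have "\<bar>\<dots>\<bar> \<le> (\<integral>z. \<bar>h x * fejer z - h (x - z / l) * fejer z\<bar> \<partial>lborel)"
        by (rule integral_abs_bound)
      also have "\<dots> \<le> (\<integral>z. e' / 2 * fejer z + 2 * H * (indicator {z. Z < \<bar>z\<bar>} z * fejer z) \<partial>lborel)"
      proof (rule integral_mono)
        show "integrable lborel (\<lambda>z. \<bar>h x * fejer z - h (x - z / l) * fejer z\<bar>)"
          using hi fejer_integral(1) by auto
        show "integrable lborel (\<lambda>z. e' / 2 * fejer z + 2 * H * (indicator {z. Z < \<bar>z\<bar>} z * fejer z))"
          using fejer_integral(1) ti by auto
        fix z
        have "\<bar>h x - h (x - z / l)\<bar> \<le> e' / 2 + 2 * H * indicator {z. Z < \<bar>z\<bar>} z"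
        proof (cases "Z < \<bar>z\<bar>")
          case True
          then show ?thesis using H[of x] H[of "x - z / l"] e' by simp
        next
          case False
          then have "\<bar>z / l\<bar> \<le> Z / l" using l(1) by (simp add: divide_right_mono)
          moreover have "Z / l \<le> d / 2" "Z / l \<le> 1" using Zl by simp_all
          ultimately have "\<bar>z / l\<bar> \<le> d / 2" "\<bar>z / l\<bar> \<le> 1" by linarith+
          moreover have "\<bar>h x - h (x - y)\<bar> < e' / 2" if "\<bar>y\<bar> \<le> d / 2" "\<bar>y\<bar> \<le> 1" for y
            using \<open>\<bar>x\<bar> \<le> 2 * R\<close> d(1) that by (intro d(2)) auto
          ultimately have "\<bar>h x - h (x - z / l)\<bar> < e' / 2" by blast
          then show ?thesis using False by simp
        qed
        then have "\<bar>h x - h (x - z / l)\<bar> * fejer z \<le> (e' / 2 + 2 * H * indicator {z. Z < \<bar>z\<bar>} z) * fejer z"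
          using fejer_nonneg by (rule mult_right_mono)
        then show "\<bar>h x * fejer z - h (x - z / l) * fejer z\<bar> \<le> e' / 2 * fejer z + 2 * H * (indicator {z. Z < \<bar>z\<bar>} z * fejer z)"
          using fejer_nonneg[of z] by (simp add: left_diff_distrib[symmetric] abs_mult distrib_right mult.assoc)
      qed
      also have "\<dots> = e' / 2 + 2 * H * (\<integral>z. indicator {z. Z < \<bar>z\<bar>} z * fejer z \<partial>lborel)"
        using fejer_integral ti by simp
      also have "\<dots> \<le> e' / 2 + 2 * H * (e' / (4 * (H + 1)))"
        using Z(2) H0 by (intro add_left_mono mult_left_mono) auto
      also have "2 * H * (e' / (4 * (H + 1))) \<le> e' / 2"
        using H0 e' by (simp add: field_simps)
      finally have le: "\<bar>h x - ?J\<bar> \<le> e * c" by (simp add: e'_def mult.commute)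
      have "0 < 2 * R + pi" "0 < \<bar>x\<bar> + pi" using R(1) pi_gt_zero by linarith+
      then have "c \<le> 2 / (pi * (\<bar>x\<bar> + pi)\<^sup>2)"
        unfolding c_def using True
        by (intro divide_left_mono mult_left_mono power_mono mult_pos_pos zero_less_power) auto
      also have "\<dots> \<le> fejer x + fejer (x + pi)" by (rule fejer_pair_lower_bound)
      finally have "e * c \<le> e * (fejer x + fejer (x + pi))" using e by (intro mult_left_mono) auto
      with le show ?thesis by linarith
    next
      case False
      then have x: "2 * R < \<bar>x\<bar>" "1 \<le> \<bar>x\<bar>" "x \<noteq> 0" using R(1) by auto
      have hx: "h x = 0" using x R by (intro R(2)) auto
      have "\<bar>?J\<bar> \<le> (\<integral>y. \<bar>h y * (l * fejer (l * (x - y)))\<bar> \<partial>lborel)" by (rule integral_abs_bound)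
      also have "\<dots> \<le> (\<integral>y. H * (8 / (pi * l * x\<^sup>2)) * indicator {-R..R} y \<partial>lborel)"
      proof (rule integral_mono_AE')
        show "integrable lborel (\<lambda>y. H * (8 / (pi * l * x\<^sup>2)) * indicator {-R..R} y)"
          by (intro integrable_mult_right integrable_real_indicator) (auto simp: emeasure_lborel_Icc_eq)
        show "AE y in lborel. \<bar>h y * (l * fejer (l * (x - y)))\<bar> \<le> H * (8 / (pi * l * x\<^sup>2)) * indicator {-R..R} y"
        proof (rule AE_I2)
          fix y
          show "\<bar>h y * (l * fejer (l * (x - y)))\<bar> \<le> H * (8 / (pi * l * x\<^sup>2)) * indicator {-R..R} y"
          proof (cases "\<bar>y\<bar> \<le> R")
            case True
            have xy: "\<bar>x\<bar> / 2 \<le> \<bar>x - y\<bar>" using True x(1) by linarith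
            then have ne: "x - y \<noteq> 0" using x by auto
            have "l * fejer (l * (x - y)) \<le> l * (2 / (pi * (l * (x - y))\<^sup>2))"
              using fejer_le_inverse_square[of "l * (x - y)"] l(1) ne by (intro mult_left_mono) auto
            also have "\<dots> = 2 / (pi * l * \<bar>x - y\<bar>\<^sup>2)"
            proof -
              have "l * (2 / (pi * (l * w)\<^sup>2)) = 2 / (pi * l * \<bar>w\<bar>\<^sup>2)" if "w \<noteq> 0" for w
                using l(1) that by (simp add: power_mult_distrib power2_eq_square)
              then show ?thesis using ne .
            qed
            also have "\<dots> \<le> 2 / (pi * l * (\<bar>x\<bar> / 2)\<^sup>2)"
              using xy x l(1) ne by (intro divide_left_mono mult_left_mono power_mono mult_pos_pos) auto
            also have "\<dots> = 8 / (pi * l * x\<^sup>2)" by (simp add: power_divide)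
            finally have "\<bar>h y\<bar> * (l * fejer (l * (x - y))) \<le> H * (8 / (pi * l * x\<^sup>2))"
              using H[of y] H0 l(1) fejer_nonneg by (intro mult_mono) auto
            then show ?thesis using True l(1) fejer_nonneg[of "l * (x - y)"] by (simp add: abs_mult abs_le_iff)
          next
            case False
            then show ?thesis using R(2)[of y] by (auto simp: indicator_def abs_le_iff)
          qed
        qed
        show "AE y in lborel. 0 \<le> H * (8 / (pi * l * x\<^sup>2)) * indicator {-R..R} y"
          using H0 l(1) by (intro AE_I2) simp
      qed
      also have "\<dots> = 2 * R * H * 8 / l * (1 / (pi * x\<^sup>2))"
        using R(1) by (simp add: mult_ac)
      also have "\<dots> \<le> 2 * e / (1 + pi)\<^sup>2 * (1 / (pi * x\<^sup>2))"
      proof (rule mult_right_mono)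
        have "8 * R * H * (1 + pi)\<^sup>2 \<le> l * e" using l(3) e by (simp add: field_simps)
        moreover have "0 < (1 + pi)\<^sup>2" using pi_gt_zero by (intro zero_less_power) linarith
        ultimately show "2 * R * H * 8 / l \<le> 2 * e / (1 + pi)\<^sup>2"
          using l(1) by (simp add: pos_divide_le_eq pos_le_divide_eq mult_ac)
      qed simp
      also have "\<dots> = e * (2 / (pi * (\<bar>x\<bar> * (1 + pi))\<^sup>2))"
        unfolding power_mult_distrib power2_abs by (simp add: mult_ac)
      finally have le: "\<bar>?J\<bar> \<le> e * (2 / (pi * (\<bar>x\<bar> * (1 + pi))\<^sup>2))" .
      \<comment> \<open>As \<bar>x\<bar> \<ge> 1, one has \<bar>x\<bar> + pi \<le> \<bar>x\<bar> (1
        + pi); this is where the factor (1 + pi)^2 in the choice of \<open>l\<close> comes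
        from.\<close>
      have "0 < 1 + pi" "0 < \<bar>x\<bar> + pi" "0 < \<bar>x\<bar> * (1 + pi)" using x(2) pi_gt_zero by (auto intro!: mult_pos_pos add_pos_pos)
      then have "2 / (pi * (\<bar>x\<bar> * (1 + pi))\<^sup>2) \<le> 2 / (pi * (\<bar>x\<bar> + pi)\<^sup>2)"
        using x(2) mult_right_mono[of 1 "\<bar>x\<bar>" pi]
        by (intro divide_left_mono mult_left_mono power_mono mult_pos_pos zero_less_power) (auto simp: algebra_simps)
      also have "\<dots> \<le> fejer x + fejer (x + pi)" by (rule fejer_pair_lower_bound)
      finally have "e * (2 / (pi * (\<bar>x\<bar> * (1 + pi))\<^sup>2)) \<le> e * (fejer x + fejer (x + pi))"
        using e by (intro mult_left_mono) auto
      with le show ?thesis by (simp only: hx diff_0 abs_minus_cancel)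
    qed
  qed
qed

section \<open>Local limits from characteristic functions\<close>

text \<open>The derivative has modulus at most 1 because \<bar>z\<bar> \<le> 1 + z^2/2 \<le>
  exp(z^2/2). Shifts of bounded size therefore change the limiting Gaussian by
  O(1/\<sigma>_n).\<close>

lemma abs_exp_square_diff_le: "\<bar>exp (- (x\<^sup>2 / 2)) - exp (- (y\<^sup>2 / 2))\<bar> \<le> \<bar>x - y\<bar>" for x y :: real
proof -
  have D: "DERIV (\<lambda>x. exp (- (x\<^sup>2 / 2))) z :> - z * exp (- (z\<^sup>2 / 2))" for z :: real
    by (auto intro!: derivative_eq_intros)
  have b: "\<bar>- z * exp (- (z\<^sup>2 / 2))\<bar> \<le> 1" for z :: real
  proof -
    have "\<bar>z\<bar> \<le> 1 + z\<^sup>2 / 2" using zero_le_power2[of "\<bar>z\<bar> - 1"] by (simp add: power2_diff)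
    also have "\<dots> \<le> exp (z\<^sup>2 / 2)" by (rule exp_ge_add_one_self)
    finally show ?thesis by (simp add: abs_mult exp_minus field_simps)
  qed
  have "norm (exp (- (x\<^sup>2 / 2)) - exp (- (y\<^sup>2 / 2))) \<le> 1 * norm (x - y)"
    by (rule field_differentiable_bound[of UNIV])
       (use D b in \<open>auto simp: has_field_derivative_at_within\<close>)
  then show ?thesis by simp
qed

text \<open>An interface between Fourier analysis and probability: no dependence structure of
  \<open>S\<close> enters, only a limit at scale 1/\<tau>_n, an integrable bound at that scale, and
  decay away from the origin. The dominating function is integrable for \<open>lebesgue\<close>
  rather than \<open>lborel\<close> because Condition A provides it in this form.\<close>

locale local_limit = prob_space M for M :: "'a measure" +
  fixes S :: "nat \<Rightarrow> 'a \<Rightarrow> real" and \<sigma> \<tau> :: "nat \<Rightarrow> real" and c1 c2 :: real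
    and \<phi> :: "nat \<Rightarrow> real \<Rightarrow> complex"
  defines \<phi>_def: "\<phi> \<equiv> \<lambda>n t. expectation (\<lambda>\<omega>. iexp (t * S n \<omega>))"
  assumes S_measurable[measurable]: "\<And>n. S n \<in> borel_measurable M"
    and c1: "0 < c1"
    and scale: "\<And>n. c1 * \<tau> n \<le> \<sigma> n" "\<And>n. \<sigma> n \<le> c2 * \<tau> n"
    and \<tau>_top: "filterlim \<tau> at_top sequentially"
    and clt: "\<And>w. (\<lambda>n. \<phi> n (w / \<tau> n) - of_real (exp (- (w\<^sup>2 * (\<sigma> n / \<tau> n)\<^sup>2 / 2)))) \<longlonglongrightarrow> 0"
    and dominated: "\<exists>\<delta>>0. \<exists>D. integrable lebesgue D \<and> (\<forall>w. 0 \<le> D w) \<and>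
      (\<forall>\<^sub>F n in sequentially. \<forall>w. 1 \<le> \<bar>w\<bar> \<and> \<bar>w\<bar> \<le> \<delta> * \<tau> n \<longrightarrow> norm (\<phi> n (w / \<tau> n)) \<le> D w)"
    and off_origin: "\<And>\<delta> l \<epsilon>. 0 < \<delta> \<Longrightarrow> 0 < \<epsilon> \<Longrightarrow>
      \<forall>\<^sub>F n in sequentially. \<forall>t. \<delta> \<le> \<bar>t\<bar> \<and> \<bar>t\<bar> \<le> l \<longrightarrow> \<tau> n * norm (\<phi> n t) \<le> \<epsilon>"
begin

lemma \<phi>_measurable[measurable]: "\<phi> n \<in> borel_measurable borel"
  unfolding \<phi>_def by (rule iexp_expectation_measurable) simp

lemma norm_\<phi>_le_1: "norm (\<phi> n t) \<le> 1"
  unfolding \<phi>_def by (rule norm_iexp_expectation_le_1)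

lemma \<tau>_pos: "\<forall>\<^sub>F n in sequentially. 0 < \<tau> n"
  using \<tau>_top by (simp add: filterlim_at_top_dense)

lemma c2_pos: "0 < c2"
proof -
  obtain n where "0 < \<tau> n" using eventually_happens[OF \<tau>_pos] by auto
  moreover have "c1 * \<tau> n \<le> c2 * \<tau> n" using scale[of n] by linarith
  ultimately show ?thesis using c1 by (simp add: mult_le_cancel_right)
qed

text \<open>A Lebesgue measurable bound agrees almost everywhere with a Borel one, whence the
  exceptional null set in the conclusion. The indicator of [-1,1] supplies the bound on
  \<bar>w\<bar> < 1, where only \<bar>\<phi>\<bar> \<le> 1 is available.\<close>

lemma dominated_lborel:
  obtains \<delta> D where "0 < \<delta>" "integrable lborel D"
    "\<forall>\<^sub>F n in sequentially. AE w in lborel. \<bar>w\<bar> \<le> \<delta> * \<tau> n \<longrightarrow> norm (\<phi> n (w / \<tau> n)) \<le> D w"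
    "AE w in lborel. 0 \<le> D w"
proof -
  obtain \<delta> D where \<delta>: "0 < \<delta>" and D: "integrable lebesgue D" "\<And>w. 0 \<le> D w"
    and ev: "\<forall>\<^sub>F n in sequentially. \<forall>w. 1 \<le> \<bar>w\<bar> \<and> \<bar>w\<bar> \<le> \<delta> * \<tau> n \<longrightarrow> norm (\<phi> n (w / \<tau> n)) \<le> D w"
    using dominated by blast
  obtain D' where [measurable]: "D' \<in> borel_measurable lborel" and AE: "AE w in lborel. D w = D' w"
    using completion_ex_borel_measurable_real[of D lborel] D(1) by auto
  have "integrable lebesgue D'"
    using Bochner_Integration.integrable_cong_AE_imp[OF D(1) _ AE_completion[OF AE]]
    by (simp add: measurable_completion)
  then have D': "integrable lborel D'" by (simp add: integrable_completion)
  show thesis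
  proof (rule that[OF \<delta>, of "\<lambda>w. D' w + indicator {-1..1} w"])
    show "integrable lborel (\<lambda>w. D' w + indicator {-1..1} w)"
      using D' by (intro Bochner_Integration.integrable_add integrable_real_indicator) auto
    show "AE w in lborel. 0 \<le> D' w + indicator {-1..1} w"
      using AE
    proof eventually_elim
      fix w assume "D w = D' w"
      then show "0 \<le> D' w + indicator {-1..1} w" using D(2)[of w] by (auto simp: indicator_def)
    qed
    show "\<forall>\<^sub>F n in sequentially. AE w in lborel. \<bar>w\<bar> \<le> \<delta> * \<tau> n \<longrightarrow> norm (\<phi> n (w / \<tau> n)) \<le> D' w + indicator {-1..1} w"
      using ev
    proof eventually_elim
      case (elim n)
      show ?case using AE
      proof eventually_elim
        fix w assume w: "D w = D' w"
        show "\<bar>w\<bar> \<le> \<delta> * \<tau> n \<longrightarrow> norm (\<phi> n (w / \<tau> n)) \<le> D' w + indicator {-1..1} w"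
        proof (cases "1 \<le> \<bar>w\<bar>")
          case True
          have "(0::real) \<le> indicator {-1..1} w" by simp
          then show ?thesis using elim True w by (metis add_increasing2)
        next
          case False
          then show ?thesis using norm_\<phi>_le_1[of n "w / \<tau> n"] D(2)[of w] w by (auto simp: indicator_def)
        qed
      qed
    qed
  qed
qed

text \<open>Three frequency ranges. On \<bar>w\<bar> \<le> \<delta>\<tau>_n dominated convergence
  applies. Between \<delta>\<tau>_n and l\<tau>_n the characteristic function is o(1/\<tau>_n),
  which beats the length of the range. Beyond l\<tau>_n the triangle vanishes.\<close>

lemma char_gap_limit:
  assumes l: "0 < l"
  shows "(\<lambda>n. \<integral>w. char_gap (\<phi> n) l (\<sigma> n) (\<tau> n) w \<partial>lborel) \<longlonglongrightarrow> 0"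
proof (rule LIMSEQ_I)
  fix r :: real assume r: "0 < r"
  obtain \<delta> D where \<delta>: "0 < \<delta>" and D: "integrable lborel D" "AE w in lborel. 0 \<le> D w"
    and ev: "\<forall>\<^sub>F n in sequentially. AE w in lborel. \<bar>w\<bar> \<le> \<delta> * \<tau> n \<longrightarrow> norm (\<phi> n (w / \<tau> n)) \<le> D w"
    by (rule dominated_lborel)
  define q where "q n w = exp (- (w\<^sup>2 * (\<sigma> n / \<tau> n)\<^sup>2 / 2))" for n w
  define p where "p n w = of_real (triangle (w / (l * \<tau> n))) * \<phi> n (w / \<tau> n)" for n w
  \<comment> \<open>Only the characteristic function is cut off at \<delta>\<tau>_n; the Gaussian,
    dominated on the whole line, is kept, so that the remaining error consists of \<open>p\<close>
    alone.\<close>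
  define h where "h n w = norm (of_real (indicator {w. \<bar>w\<bar> \<le> \<delta> * \<tau> n} w) * p n w - of_real (q n w))" for n w
  have [measurable]: "q n \<in> borel_measurable borel" "p n \<in> borel_measurable borel" for n
    unfolding q_def[abs_def] p_def[abs_def] by measurable
  have [measurable]: "h n \<in> borel_measurable borel" for n unfolding h_def[abs_def] by measurable
  have q0: "0 \<le> q n w" for n w by (simp add: q_def)
  have p_norm: "norm (p n w) \<le> norm (\<phi> n (w / \<tau> n))" for n w
    using mult_right_mono[OF triangle_bounds(2) norm_ge_zero] triangle_bounds(1) by (simp add: p_def norm_mult)
  have q_le: "q n w \<le> exp (- (w\<^sup>2 * c1\<^sup>2 / 2))" if "0 < \<tau> n" for n w
  proof -
    have "c1 \<le> \<sigma> n / \<tau> n" using scale(1)[of n] that by (simp add: field_simps)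
    then have "c1\<^sup>2 \<le> (\<sigma> n / \<tau> n)\<^sup>2" using c1 by (intro power_mono) auto
    then show ?thesis unfolding q_def by (simp add: mult_left_mono)
  qed
  let ?G = "\<lambda>w. D w + exp (- (w\<^sup>2 * c1\<^sup>2 / 2))"
  have Gi: "integrable lborel ?G" using D(1) exp_square_integrable[OF c1] by simp
  have h_le: "\<forall>\<^sub>F n in sequentially. AE w in lborel. norm (h n w) \<le> ?G w"
    using ev \<tau>_pos
  proof eventually_elim
    case (elim n)
    show ?case using elim(1) D(2)
    proof eventually_elim
      fix w assume w: "\<bar>w\<bar> \<le> \<delta> * \<tau> n \<longrightarrow> norm (\<phi> n (w / \<tau> n)) \<le> D w" "0 \<le> D w"
      have "h n w \<le> norm (of_real (indicator {w. \<bar>w\<bar> \<le> \<delta> * \<tau> n} w) * p n w) + norm (of_real (q n w) :: complex)"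
        unfolding h_def by (rule norm_triangle_ineq4)
      also have "norm (of_real (indicator {w. \<bar>w\<bar> \<le> \<delta> * \<tau> n} w) * p n w) \<le> D w"
        using w p_norm[of n w] by (auto simp: indicator_def)
      finally show "norm (h n w) \<le> ?G w" using q_le[OF elim(2), of w] q0[of n w] by (simp add: h_def)
    qed
  qed
  have h_lim: "(\<lambda>n. h n w) \<longlonglongrightarrow> 0" for w
  proof -
    have t0: "(\<lambda>n. w / (l * \<tau> n)) \<longlonglongrightarrow> 0"
      using l by (intro tendsto_divide_0[OF tendsto_const] filterlim_at_top_imp_at_infinity filterlim_tendsto_pos_mult_at_top[OF tendsto_const _ \<tau>_top])
    have "(\<lambda>n. triangle (w / (l * \<tau> n))) \<longlonglongrightarrow> max 0 (1 - \<bar>0\<bar>)"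
      unfolding triangle_def by (intro tendsto_intros t0)
    then have t1: "(\<lambda>n. triangle (w / (l * \<tau> n)) - 1) \<longlonglongrightarrow> 0" by (simp add: LIM_zero_iff)
    have "(\<lambda>n. norm (\<phi> n (w / \<tau> n) - of_real (q n w)) + \<bar>triangle (w / (l * \<tau> n)) - 1\<bar>) \<longlonglongrightarrow> 0 + 0"
      using clt[of w] t1 by (intro tendsto_add tendsto_norm_zero tendsto_rabs_zero) (simp_all add: q_def)
    then have lim: "(\<lambda>n. norm (\<phi> n (w / \<tau> n) - of_real (q n w)) + \<bar>triangle (w / (l * \<tau> n)) - 1\<bar>) \<longlonglongrightarrow> 0" by simp
    have "\<forall>\<^sub>F n in sequentially. \<bar>w\<bar> / \<delta> \<le> \<tau> n" using \<tau>_top by (simp add: filterlim_at_top)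
    then have "\<forall>\<^sub>F n in sequentially. norm (h n w) \<le> norm (\<phi> n (w / \<tau> n) - of_real (q n w)) + \<bar>triangle (w / (l * \<tau> n)) - 1\<bar>"
    proof eventually_elim
      case (elim n)
      then have "\<bar>w\<bar> \<le> \<delta> * \<tau> n" using \<delta> by (simp add: field_simps)
      then have "h n w = norm ((\<phi> n (w / \<tau> n) - of_real (q n w)) + of_real (triangle (w / (l * \<tau> n)) - 1) * \<phi> n (w / \<tau> n))"
        by (simp add: h_def p_def algebra_simps)
      also have "\<dots> \<le> norm (\<phi> n (w / \<tau> n) - of_real (q n w)) + norm (of_real (triangle (w / (l * \<tau> n)) - 1) * \<phi> n (w / \<tau> n))"
        by (rule norm_triangle_ineq)
      also have "norm (of_real (triangle (w / (l * \<tau> n)) - 1) * \<phi> n (w / \<tau> n)) \<le> \<bar>triangle (w / (l * \<tau> n)) - 1\<bar> * 1"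
        unfolding norm_mult norm_of_real using norm_\<phi>_le_1 by (intro mult_left_mono) auto
      finally show ?case by (simp add: h_def)
    qed
    then show ?thesis using lim by (rule Lim_null_comparison)
  qed
  have "(\<lambda>n. \<integral>w. h n w \<partial>lborel) \<longlonglongrightarrow> 0"
  proof -
    obtain n0 where n0: "\<And>n. n0 \<le> n \<Longrightarrow> AE w in lborel. norm (h n w) \<le> ?G w"
      using h_le unfolding eventually_sequentially by blast
    \<comment> \<open>The bound holds only from \<open>n0\<close> on, so the sequence is shifted
      before passing to the limit.\<close>
    have "(\<lambda>n. \<integral>w. h (n + n0) w \<partial>lborel) \<longlonglongrightarrow> (\<integral>w. 0 \<partial>(lborel :: real measure))"
    proof (rule integral_dominated_convergence[where w = ?G])
      show "AE w in lborel. (\<lambda>n. h (n + n0) w) \<longlonglongrightarrow> 0"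
        using h_lim by (intro AE_I2 LIMSEQ_ignore_initial_segment)
    qed (use Gi n0 in auto)
    then show ?thesis by (simp add: LIMSEQ_offset)
  qed
  then have "\<forall>\<^sub>F n in sequentially. (\<integral>w. h n w \<partial>lborel) < r / 2"
    using r by (intro order_tendstoD) auto
  \<comment> \<open>The middle range lies in an interval of length 2l\<tau>_n on which the integrand
    is at most r/(8l\<tau>_n); it contributes at most r/4.\<close>
  moreover have "\<forall>\<^sub>F n in sequentially. \<forall>t. \<delta> \<le> \<bar>t\<bar> \<and> \<bar>t\<bar> \<le> l \<longrightarrow> \<tau> n * norm (\<phi> n t) \<le> r / (8 * l)"
    using \<delta> r l by (intro off_origin) auto
  ultimately have "\<forall>\<^sub>F n in sequentially. norm ((\<integral>w. char_gap (\<phi> n) l (\<sigma> n) (\<tau> n) w \<partial>lborel) - 0) < r"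
    using \<tau>_pos h_le
  proof eventually_elim
    case (elim n)
    note hn = elim(1) and off = elim(2) and tn = elim(3)
    have hi: "integrable lborel (h n)"
      by (rule Bochner_Integration.integrable_bound[OF Gi]) (use elim(4) in auto)
    have sn: "0 < \<sigma> n" using scale(1)[of n] mult_pos_pos[OF c1 tn] by linarith
    have gi: "integrable lborel (char_gap (\<phi> n) l (\<sigma> n) (\<tau> n))"
      unfolding \<phi>_def using l sn tn by (intro fejer_local_bound(1)) auto
    have ii: "integrable lborel (\<lambda>w. r / (8 * l) / \<tau> n * indicator {- (l * \<tau> n)..l * \<tau> n} w)"
      by (intro integrable_mult_right integrable_real_indicator) (auto simp: emeasure_lborel_Icc_eq)
    have gap: "char_gap (\<phi> n) l (\<sigma> n) (\<tau> n) w = norm (p n w - of_real (q n w))" for w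
      by (simp add: char_gap_def p_def q_def)
    have le: "char_gap (\<phi> n) l (\<sigma> n) (\<tau> n) w \<le> h n w + r / (8 * l) / \<tau> n * indicator {- (l * \<tau> n)..l * \<tau> n} w" for w
    proof (cases "\<bar>w\<bar> \<le> \<delta> * \<tau> n")
      case True
      then show ?thesis unfolding gap h_def using l r tn by simp
    next
      case far: False
      have "norm (p n w) \<le> r / (8 * l) / \<tau> n * indicator {- (l * \<tau> n)..l * \<tau> n} w"
      proof (cases "\<bar>w\<bar> \<le> l * \<tau> n")
        case True
        have "\<delta> \<le> \<bar>w / \<tau> n\<bar>" "\<bar>w / \<tau> n\<bar> \<le> l" using far True tn by (simp_all add: field_simps)
        then have "\<tau> n * norm (\<phi> n (w / \<tau> n)) \<le> r / (8 * l)" using off by blast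
        then have "norm (\<phi> n (w / \<tau> n)) \<le> r / (8 * l) / \<tau> n" using tn by (simp add: pos_le_divide_eq[OF tn] mult.commute del: divide_divide_eq_left)
        then show ?thesis using p_norm[of n w] True by (simp add: abs_le_iff)
      next
        case False
        then have "1 \<le> \<bar>w / (l * \<tau> n)\<bar>" using l tn by (simp add: field_simps)
        then have "p n w = 0" by (simp add: p_def triangle_eq_0)
        then show ?thesis using l r tn by (simp add: indicator_def)
      qed
      then show ?thesis unfolding gap using far norm_triangle_ineq4[of "p n w" "of_real (q n w)"] by (simp add: h_def)
    qed
    have "(\<integral>w. char_gap (\<phi> n) l (\<sigma> n) (\<tau> n) w \<partial>lborel) \<le> (\<integral>w. h n w + r / (8 * l) / \<tau> n * indicator {- (l * \<tau> n)..l * \<tau> n} w \<partial>lborel)"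
      using gi hi ii le by (intro integral_mono) auto
    also have "\<dots> = (\<integral>w. h n w \<partial>lborel) + r / (8 * l) / \<tau> n * (2 * (l * \<tau> n))"
      using hi ii l tn by simp
    also have "\<dots> < r" using hn l tn r by (simp add: field_simps)
    finally have "(\<integral>w. char_gap (\<phi> n) l (\<sigma> n) (\<tau> n) w \<partial>lborel) < r" .
    moreover have "0 \<le> (\<integral>w. char_gap (\<phi> n) l (\<sigma> n) (\<tau> n) w \<partial>lborel)"
      by (intro integral_nonneg_AE AE_I2) (simp add: char_gap_def)
    ultimately show ?case by simp
  qed
  then show "\<exists>n0. \<forall>n\<ge>n0. norm ((\<integral>w. char_gap (\<phi> n) l (\<sigma> n) (\<tau> n) w \<partial>lborel) - 0) < r"
    by (simp add: eventually_sequentially)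
qed

lemma fejer_local_limit:
  assumes l: "0 < l" and e: "0 < e"
  shows "\<forall>\<^sub>F n in sequentially. \<forall>u. \<bar>sqrt (2 * pi) * \<sigma> n * expectation (\<lambda>\<omega>. l * fejer (l * (S n \<omega> - u)))
    - exp (- (u\<^sup>2 / (2 * (\<sigma> n)\<^sup>2)))\<bar> \<le> e"
proof -
  have "\<forall>\<^sub>F n in sequentially. (\<integral>w. char_gap (\<phi> n) l (\<sigma> n) (\<tau> n) w \<partial>lborel) < e / c2"
    using char_gap_limit[OF l] e c2_pos by (intro order_tendstoD) auto
  then show ?thesis using \<tau>_pos
  proof eventually_elim
    case (elim n)
    have sn: "0 < \<sigma> n" using scale(1)[of n] mult_pos_pos[OF c1 elim(2)] by linarith
    have nn: "0 \<le> (\<integral>w. char_gap (\<phi> n) l (\<sigma> n) (\<tau> n) w \<partial>lborel)"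
      by (intro integral_nonneg_AE AE_I2) (simp add: char_gap_def)
    have "\<sigma> n / \<tau> n * (\<integral>w. char_gap (\<phi> n) l (\<sigma> n) (\<tau> n) w \<partial>lborel) \<le> c2 * (e / c2)"
      using elim scale(2)[of n] nn c2_pos by (intro mult_mono) (auto simp: field_simps)
    then show ?case
      using fejer_local_bound(2)[OF S_measurable l sn elim(2), of n] c2_pos unfolding \<phi>_def
      by (auto intro: order_trans)
  qed
qed

text \<open>With \<open>k\<close> the convolution of \<open>h\<close> with a narrow Fejer kernel,
  the expectation of \<open>k\<close> is an average of Fejer expectations over shifts in the support
  of \<open>h\<close>. The difference of \<open>h\<close> and \<open>k\<close> costs an expectation
  of two Fejer translates, bounded by the Fejer local limit at unit bandwidth.\<close>

lemma continuous_local_limit: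
  fixes h :: "real \<Rightarrow> real"
  assumes h: "continuous_on UNIV h" and supp: "compact (closure {x. h x \<noteq> 0})" and e: "0 < e"
  shows "\<forall>\<^sub>F n in sequentially. \<forall>u. \<bar>sqrt (2 * pi) * \<sigma> n * expectation (\<lambda>\<omega>. h (S n \<omega> - u))
    - exp (- (u\<^sup>2 / (2 * (\<sigma> n)\<^sup>2))) * (\<integral>x. h x \<partial>lborel)\<bar> \<le> e"
proof -
  have [measurable]: "h \<in> borel_measurable borel" using h by (rule borel_measurable_continuous_onI)
  obtain R0 where R0: "\<And>x. x \<in> closure {x. h x \<noteq> 0} \<Longrightarrow> \<bar>x\<bar> \<le> R0"
    using compact_imp_bounded[OF supp] by (auto simp: bounded_iff)
  define R where "R = max 1 R0"
  have R: "1 \<le> R" "h x = 0" if "R < \<bar>x\<bar>" for x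
    using R0[of x] closure_subset[of "{x. h x \<noteq> 0}"] that by (auto simp: R_def)
  have R1: "1 \<le> R" by (simp add: R_def)
  have "compact (h ` {-R..R})" using h by (intro compact_continuous_image) (auto intro: continuous_on_subset)
  then obtain H0 where H0: "\<And>x. x \<in> {-R..R} \<Longrightarrow> \<bar>h x\<bar> \<le> H0"
    using compact_imp_bounded by (fastforce simp: bounded_iff)
  define H where "H = max H0 0"
  have H: "\<bar>h x\<bar> \<le> H" for x
    using H0[of x] R(2)[of x] by (cases "\<bar>x\<bar> \<le> R") (auto simp: H_def abs_le_iff)
  have hi: "integrable lborel h"
  proof (rule Bochner_Integration.integrable_bound)
    show "integrable lborel (\<lambda>x. H * indicator {-R..R} x)"
      by (intro integrable_mult_right integrable_real_indicator) (auto simp: emeasure_lborel_Icc_eq)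
    show "AE x in lborel. norm (h x) \<le> norm (H * indicator {-R..R} x)"
    proof (rule AE_I2)
      fix x show "norm (h x) \<le> norm (H * indicator {-R..R} x)"
        using H[of x] R(2)[of x] by (cases "\<bar>x\<bar> \<le> R") (auto simp: abs_le_iff indicator_def)
    qed
  qed simp
  define I where "I = (\<integral>x. \<bar>h x\<bar> \<partial>lborel)"
  have I0: "0 \<le> I" by (simp add: I_def)
  \<comment> \<open>The tolerance is spent twice, on the Fejer limit and on the shift of the
    Gaussian: \<open>2 * e2 * I \<le> e / 2\<close>. Adding 1 to \<open>I\<close> covers the case
    \<open>I = 0\<close>.\<close>
  define e2 where "e2 = e / (4 * (I + 1))"
  have e2: "0 < e2" using e I0 by (simp add: e2_def)
  obtain l where l: "0 < l" and approx: "\<And>x. \<bar>h x - (\<integral>y. h y * (l * fejer (l * (x - y))) \<partial>lborel)\<bar> \<le> e / 8 * (fejer x + fejer (x + pi))"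
    using fejer_convolution_approx[OF h H R1 R(2), of "e / 8"] e by auto
  define k where "k x = (\<integral>y. h y * (l * fejer (l * (x - y))) \<partial>lborel)" for x
  have [measurable]: "k \<in> borel_measurable borel" unfolding k_def[abs_def] by measurable
  have \<sigma>_top: "filterlim \<sigma> at_top sequentially"
    by (rule filterlim_at_top_mono[OF filterlim_tendsto_pos_mult_at_top[OF tendsto_const c1 \<tau>_top]]) (simp add: scale)
  have "\<forall>\<^sub>F n in sequentially. R / e2 \<le> \<sigma> n" using \<sigma>_top by (simp add: filterlim_at_top)
  moreover have "\<forall>\<^sub>F n in sequentially. 0 < \<sigma> n" using \<sigma>_top by (simp add: filterlim_at_top_dense)
  ultimately show ?thesis
    using fejer_local_limit[OF l e2] fejer_local_limit[OF zero_less_one zero_less_one]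
  proof eventually_elim
    case (elim n)
    note sn = elim(2)
    define c where "c = sqrt (2 * pi) * \<sigma> n"
    have c: "0 < c" using sn by (simp add: c_def)
    define G where "G u = exp (- (u\<^sup>2 / (2 * (\<sigma> n)\<^sup>2)))" for u
    have G: "G u = exp (- ((u / \<sigma> n)\<^sup>2 / 2))" for u by (simp add: G_def power_divide mult.commute)
    have G1: "G u \<le> 1" for u by (simp add: G_def)
    have [measurable]: "G \<in> borel_measurable borel" unfolding G_def[abs_def] by measurable
    \<comment> \<open>The Gaussian is at most 1, and the Fejer limit with \<open>l = 1\<close> is
      used with tolerance 1. Two such terms turn the factor e/8 of the approximation into
      e/2.\<close>
    have F1: "c * expectation (\<lambda>\<omega>. fejer (S n \<omega> - u)) \<le> 2" for u
      using elim(4) G1[of u] unfolding c_def[symmetric] G_def[symmetric]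
      by (auto simp: abs_le_iff dest!: spec[of _ u])
    have fi: "integrable M (\<lambda>\<omega>. fejer (S n \<omega> - u))" for u
      using expectation_scaled_fejer(1)[OF S_measurable zero_less_one, of n u] by simp
    define A where "A u = expectation (\<lambda>\<omega>. l * fejer (l * (S n \<omega> - u)))" for u
    have A: "\<bar>c * A u - G u\<bar> \<le> e2" for u using elim(3) by (simp add: c_def A_def G_def)
    have [measurable]: "A \<in> borel_measurable borel" unfolding A_def[abs_def] by measurable
    show ?case
    proof
      fix u
      interpret pair_sigma_finite M lborel ..
      have bd: "\<bar>h y * (l * fejer (l * x))\<bar> \<le> l * (1 / (2 * pi)) * \<bar>h y\<bar>" for x y
        using mult_left_mono[OF mult_left_mono[OF fejer_le_const[of "l * x"] less_imp_le[OF l]] abs_ge_zero[of "h y"]] l fejer_nonneg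
        by (simp add: abs_mult mult_ac)
      have yi: "integrable lborel (\<lambda>y. h y * (l * fejer (l * (x - y))))" for x
        by (rule Bochner_Integration.integrable_bound[OF integrable_mult_right[OF integrable_abs[OF hi], of "l * (1 / (2 * pi))"]])
           (use bd l in \<open>auto intro!: AE_I2 simp: abs_mult\<close>)
      have prod: "integrable (M \<Otimes>\<^sub>M lborel) (case_prod (\<lambda>\<omega> y. h y * (l * fejer (l * (S n \<omega> - u - y)))))"
      proof (rule Fubini_integrable)
        show "integrable M (\<lambda>\<omega>. \<integral>y. norm (case (\<omega>, y) of (\<omega>, y) \<Rightarrow> h y * (l * fejer (l * (S n \<omega> - u - y)))) \<partial>lborel)"
        proof (rule integrable_const_bound)
          show "AE \<omega> in M. norm (\<integral>y. norm (case (\<omega>, y) of (\<omega>, y) \<Rightarrow> h y * (l * fejer (l * (S n \<omega> - u - y)))) \<partial>lborel)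
              \<le> (\<integral>y. l * (1 / (2 * pi)) * \<bar>h y\<bar> \<partial>lborel)"
          proof (rule AE_I2)
            fix \<omega>
            have "(\<integral>y. norm (h y * (l * fejer (l * (S n \<omega> - u - y)))) \<partial>lborel) \<le> (\<integral>y. l * (1 / (2 * pi)) * \<bar>h y\<bar> \<partial>lborel)"
              using bd by (intro integral_mono integrable_norm yi integrable_mult_right integrable_abs hi) simp
            then show "norm (\<integral>y. norm (case (\<omega>, y) of (\<omega>, y) \<Rightarrow> h y * (l * fejer (l * (S n \<omega> - u - y)))) \<partial>lborel)
              \<le> (\<integral>y. l * (1 / (2 * pi)) * \<bar>h y\<bar> \<partial>lborel)"
              by simp
          qed
        qed measurable
        show "AE \<omega> in M. integrable lborel (\<lambda>y. case (\<omega>, y) of (\<omega>, y) \<Rightarrow> h y * (l * fejer (l * (S n \<omega> - u - y))))"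
          using yi by simp
      qed measurable
      \<comment> \<open>Fubini moves the convolution variable out of the expectation and into the
        centre of the Fejer kernel.\<close>
      have Ek: "expectation (\<lambda>\<omega>. k (S n \<omega> - u)) = (\<integral>y. h y * A (u + y) \<partial>lborel)"
        unfolding k_def Fubini_integral[OF prod, symmetric] A_def by (simp add: diff_diff_eq)
      have Ai: "integrable lborel (\<lambda>y. h y * A (u + y))"
        using integrable_snd[OF prod] by (simp add: A_def diff_diff_eq)
      have "c * expectation (\<lambda>\<omega>. k (S n \<omega> - u)) - G u * (\<integral>y. h y \<partial>lborel) = (\<integral>y. h y * (c * A (u + y) - G u) \<partial>lborel)"
      proof -
        have "(\<integral>y. h y * (c * A (u + y) - G u) \<partial>lborel) = (\<integral>y. c * (h y * A (u + y)) - G u * h y \<partial>lborel)"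
          by (intro Bochner_Integration.integral_cong) (simp_all add: algebra_simps)
        then show ?thesis unfolding Ek using Ai hi by simp
      qed
      also have "\<bar>\<dots>\<bar> \<le> (\<integral>y. \<bar>h y * (c * A (u + y) - G u)\<bar> \<partial>lborel)"
        by (rule integral_abs_bound)
      also have "\<dots> \<le> (\<integral>y. 2 * e2 * \<bar>h y\<bar> \<partial>lborel)"
      proof (rule integral_mono_AE')
        show "integrable lborel (\<lambda>y. 2 * e2 * \<bar>h y\<bar>)" using hi by simp
        show "AE y in lborel. \<bar>h y * (c * A (u + y) - G u)\<bar> \<le> 2 * e2 * \<bar>h y\<bar>"
        proof (rule AE_I2)
          fix y
          show "\<bar>h y * (c * A (u + y) - G u)\<bar> \<le> 2 * e2 * \<bar>h y\<bar>"
          proof (cases "h y = 0")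
            case False
            then have "\<bar>y\<bar> \<le> R" using R(2)[of y] by force
            \<comment> \<open>Only shifts in the support of \<open>h\<close> matter; they move the
              argument of the Gaussian by at most R/\<sigma>_n.\<close>
            have "\<bar>G (u + y) - G u\<bar> \<le> \<bar>(u + y) / \<sigma> n - u / \<sigma> n\<bar>"
              unfolding G by (rule abs_exp_square_diff_le)
            also have "\<dots> = \<bar>y\<bar> / \<sigma> n" using sn by (simp add: add_divide_distrib)
            also have "\<dots> \<le> R / \<sigma> n" using \<open>\<bar>y\<bar> \<le> R\<close> sn by (simp add: divide_right_mono)
            also have "\<dots> \<le> e2" using elim(1) sn e2 by (simp add: field_simps)
            finally have "\<bar>c * A (u + y) - G u\<bar> \<le> 2 * e2" using A[of "u + y"] by linarith
            then show ?thesis unfolding abs_mult by (subst mult.commute) (intro mult_right_mono, auto)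
          qed simp
        qed
        show "AE y in lborel. 0 \<le> 2 * e2 * \<bar>h y\<bar>" using e2 by simp
      qed
      also have "\<dots> = 2 * e2 * I" using hi by (simp add: I_def)
      also have "\<dots> \<le> e / 2" using e I0 by (simp add: e2_def field_simps)
      finally have 1: "\<bar>c * expectation (\<lambda>\<omega>. k (S n \<omega> - u)) - G u * (\<integral>y. h y \<partial>lborel)\<bar> \<le> e / 2" .
      have hM: "integrable M (\<lambda>\<omega>. h (S n \<omega> - u))"
        using H by (intro integrable_const_bound[of _ H]) auto
      have kM: "integrable M (\<lambda>\<omega>. k (S n \<omega> - u))"
        using integrable_fst[OF prod] by (simp add: k_def)
      have "\<bar>expectation (\<lambda>\<omega>. h (S n \<omega> - u)) - expectation (\<lambda>\<omega>. k (S n \<omega> - u))\<bar>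
        = \<bar>expectation (\<lambda>\<omega>. h (S n \<omega> - u) - k (S n \<omega> - u))\<bar>"
        using hM kM by simp
      also have "\<dots> \<le> expectation (\<lambda>\<omega>. \<bar>h (S n \<omega> - u) - k (S n \<omega> - u)\<bar>)"
        by (rule integral_abs_bound)
      also have "\<dots> \<le> expectation (\<lambda>\<omega>. e / 8 * (fejer (S n \<omega> - u) + fejer (S n \<omega> - (u - pi))))"
      proof (rule integral_mono)
        show "integrable M (\<lambda>\<omega>. \<bar>h (S n \<omega> - u) - k (S n \<omega> - u)\<bar>)" using hM kM by simp
        show "integrable M (\<lambda>\<omega>. e / 8 * (fejer (S n \<omega> - u) + fejer (S n \<omega> - (u - pi))))"
          using fi[of u] fi[of "u - pi"] by simp
        fix \<omega>
        have "S n \<omega> - (u - pi) = (S n \<omega> - u) + pi" by simp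
        with approx[folded k_def, of "S n \<omega> - u"]
        show "\<bar>h (S n \<omega> - u) - k (S n \<omega> - u)\<bar> \<le> e / 8 * (fejer (S n \<omega> - u) + fejer (S n \<omega> - (u - pi)))"
          by (simp only:)
      qed
      also have "\<dots> = e / 8 * (expectation (\<lambda>\<omega>. fejer (S n \<omega> - u)) + expectation (\<lambda>\<omega>. fejer (S n \<omega> - (u - pi))))"
        using fi[of u] fi[of "u - pi"] by simp
      finally have "c * \<bar>expectation (\<lambda>\<omega>. h (S n \<omega> - u)) - expectation (\<lambda>\<omega>. k (S n \<omega> - u))\<bar>
        \<le> c * (e / 8 * (expectation (\<lambda>\<omega>. fejer (S n \<omega> - u)) + expectation (\<lambda>\<omega>. fejer (S n \<omega> - (u - pi)))))"
        using c by (intro mult_left_mono) auto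
      also have "\<dots> = e / 8 * (c * expectation (\<lambda>\<omega>. fejer (S n \<omega> - u)) + c * expectation (\<lambda>\<omega>. fejer (S n \<omega> - (u - pi))))"
        by (simp add: algebra_simps)
      also have "\<dots> \<le> e / 8 * (2 + 2)" using F1 e by (intro mult_left_mono add_mono) auto
      finally have 2: "\<bar>c * expectation (\<lambda>\<omega>. h (S n \<omega> - u)) - c * expectation (\<lambda>\<omega>. k (S n \<omega> - u))\<bar> \<le> e / 2"
        using c by (simp add: abs_mult flip: right_diff_distrib)
      show "\<bar>sqrt (2 * pi) * \<sigma> n * expectation (\<lambda>\<omega>. h (S n \<omega> - u))
          - exp (- (u\<^sup>2 / (2 * (\<sigma> n)\<^sup>2))) * (\<integral>x. h x \<partial>lborel)\<bar> \<le> e"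
        using 1 2 unfolding c_def[symmetric] G_def[symmetric] by linarith
    qed
  qed
qed

end

section \<open>Comparable probability measures and kernels\<close>

lemma nn_integral_le_of_emeasure_le:
  assumes sets: "sets Q = sets P"
    and le: "\<And>A. A \<in> sets P \<Longrightarrow> emeasure Q A \<le> c * emeasure P A"
    and f: "f \<in> borel_measurable P"
  shows "(\<integral>\<^sup>+x. f x \<partial>Q) \<le> c * (\<integral>\<^sup>+x. f x \<partial>P)"
proof -
  have [measurable_cong]: "sets Q = sets P" by fact
  have sp: "space Q = space P" by (rule sets_eq_imp_space_eq[OF sets])
  show ?thesis using f
  proof induction
    case (cong f g)
    then have "(\<integral>\<^sup>+x. f x \<partial>Q) = (\<integral>\<^sup>+x. g x \<partial>Q)" "(\<integral>\<^sup>+x. f x \<partial>P) = (\<integral>\<^sup>+x. g x \<partial>P)"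
      by (auto intro!: nn_integral_cong simp: sp)
    with cong show ?case by metis
  next
    case (set A)
    then show ?case using le[of A] by (simp add: sets)
  next
    case (mult u d)
    note [measurable] = \<open>u \<in> borel_measurable P\<close>
    have "d * (\<integral>\<^sup>+x. u x \<partial>Q) \<le> d * (c * (\<integral>\<^sup>+x. u x \<partial>P))"
      using mult by (intro mult_left_mono) auto
    then show ?case by (simp add: nn_integral_cmult mult.left_commute)
  next
    case (add u v)
    note [measurable] = \<open>u \<in> borel_measurable P\<close> \<open>v \<in> borel_measurable P\<close>
    have "(\<integral>\<^sup>+x. u x \<partial>Q) + (\<integral>\<^sup>+x. v x \<partial>Q) \<le> c * (\<integral>\<^sup>+x. u x \<partial>P) + c * (\<integral>\<^sup>+x. v x \<partial>P)"
      using add by (intro add_mono) auto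
    then show ?case by (simp add: nn_integral_add distrib_left add.commute)
  next
    case (seq U)
    note [measurable] = \<open>\<And>i. U i \<in> borel_measurable P\<close>
    have SUP_eq: "(SUP i. U i) = (\<lambda>x. SUP i. U i x)"
      by (simp add: fun_eq_iff image_comp)
    have "(\<integral>\<^sup>+x. (SUP i. U i) x \<partial>Q) = (SUP i. \<integral>\<^sup>+x. U i x \<partial>Q)"
      unfolding SUP_eq using seq by (intro nn_integral_monotone_convergence_SUP) auto
    also have "\<dots> \<le> (SUP i. c * \<integral>\<^sup>+x. U i x \<partial>P)"
      using seq by (intro SUP_mono) auto
    also have "\<dots> = c * (SUP i. \<integral>\<^sup>+x. U i x \<partial>P)"
      by (simp add: SUP_mult_left_ennreal)
    also have "\<dots> = c * (\<integral>\<^sup>+x. (SUP i. U i) x \<partial>P)"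
      unfolding SUP_eq using seq
      by (intro arg_cong[where f = "\<lambda>z. c * z"] nn_integral_monotone_convergence_SUP[symmetric]) auto
    finally show ?case .
  qed
qed

locale comparable_prob = P: prob_space P + Q: prob_space Q for P Q :: "'s measure" +
  fixes a b :: real
  assumes sets_eq[measurable_cong]: "sets Q = sets P"
    and a_pos: "0 < a"
    and lower: "\<And>A. A \<in> sets P \<Longrightarrow> a * measure P A \<le> measure Q A"
    and upper: "\<And>A. A \<in> sets P \<Longrightarrow> measure Q A \<le> b * measure P A"
begin

lemma space_eq: "space Q = space P"
  by (rule sets_eq_imp_space_eq[OF sets_eq])

lemma a_le_1: "a \<le> 1"
  using lower[of "space P"] Q.prob_space by (simp add: P.prob_space space_eq)

lemma b_ge_1: "1 \<le> b"
  using upper[of "space P"] Q.prob_space by (simp add: P.prob_space space_eq)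

lemma nn_integral_upper:
  assumes "f \<in> borel_measurable P"
  shows "(\<integral>\<^sup>+x. f x \<partial>Q) \<le> ennreal b * (\<integral>\<^sup>+x. f x \<partial>P)"
proof (rule nn_integral_le_of_emeasure_le[OF sets_eq _ assms])
  fix A assume "A \<in> sets P"
  with upper[of A] b_ge_1 show "emeasure Q A \<le> ennreal b * emeasure P A"
    by (simp add: P.emeasure_eq_measure Q.emeasure_eq_measure flip: ennreal_mult)
qed

lemma integrable_Q:
  fixes f :: "'s \<Rightarrow> 'c::{banach, second_countable_topology}"
  assumes "integrable P f" shows "integrable Q f"
proof -
  have [measurable]: "f \<in> borel_measurable P" using assms by simp
  have "(\<integral>\<^sup>+x. norm (f x) \<partial>Q) \<le> ennreal b * (\<integral>\<^sup>+x. norm (f x) \<partial>P)"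
    by (rule nn_integral_upper) simp
  also have "\<dots> < \<infinity>"
    using assms by (auto simp: integrable_iff_bounded ennreal_mult_less_top)
  finally show ?thesis by (simp add: integrable_iff_bounded)
qed

lemma integral_upper:
  fixes f :: "'s \<Rightarrow> real"
  assumes f: "integrable P f" and nn: "\<And>x. x \<in> space P \<Longrightarrow> 0 \<le> f x"
  shows "(\<integral>x. f x \<partial>Q) \<le> b * (\<integral>x. f x \<partial>P)"
proof -
  have [measurable]: "f \<in> borel_measurable P" using assms by simp
  have "ennreal (\<integral>x. f x \<partial>Q) = (\<integral>\<^sup>+x. f x \<partial>Q)"
    using nn by (intro nn_integral_eq_integral[symmetric] integrable_Q f AE_I2) (simp add: space_eq)
  also have "\<dots> \<le> ennreal b * (\<integral>\<^sup>+x. f x \<partial>P)"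
    by (rule nn_integral_upper) simp
  also have "(\<integral>\<^sup>+x. f x \<partial>P) = ennreal (\<integral>x. f x \<partial>P)"
    using nn by (intro nn_integral_eq_integral f AE_I2)
  finally show ?thesis
    using b_ge_1 nn by (simp add: integral_nonneg_AE flip: ennreal_mult)
qed

text \<open>The comparison of measures read backwards: \<open>P\<close> is at most
  \<open>1 / a\<close> times \<open>Q\<close>.\<close>

lemma integral_lower:
  fixes f :: "'s \<Rightarrow> real"
  assumes f: "integrable P f" and nn: "\<And>x. x \<in> space P \<Longrightarrow> 0 \<le> f x"
  shows "a * (\<integral>x. f x \<partial>P) \<le> (\<integral>x. f x \<partial>Q)"
proof -
  have [measurable]: "f \<in> borel_measurable P" using assms by simp
  have "ennreal (\<integral>x. f x \<partial>P) = (\<integral>\<^sup>+x. f x \<partial>P)"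
    using nn by (intro nn_integral_eq_integral[symmetric] f AE_I2)
  also have "\<dots> \<le> ennreal (1 / a) * (\<integral>\<^sup>+x. f x \<partial>Q)"
  proof (rule nn_integral_le_of_emeasure_le[OF sets_eq[symmetric]])
    fix A assume "A \<in> sets Q"
    with lower[of A] a_pos show "emeasure P A \<le> ennreal (1 / a) * emeasure Q A"
      by (simp add: P.emeasure_eq_measure Q.emeasure_eq_measure sets_eq field_simps flip: ennreal_mult)
  qed simp
  also have "(\<integral>\<^sup>+x. f x \<partial>Q) = ennreal (\<integral>x. f x \<partial>Q)"
    using nn by (intro nn_integral_eq_integral integrable_Q f AE_I2) (simp add: space_eq)
  finally have "ennreal (\<integral>x. f x \<partial>P) \<le> ennreal (1 / a * (\<integral>x. f x \<partial>Q))"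
    using a_pos by (subst ennreal_mult') auto
  moreover have "0 \<le> 1 / a * (\<integral>x. f x \<partial>Q)"
    using a_pos nn by (intro mult_nonneg_nonneg integral_nonneg_AE) (auto simp: space_eq)
  ultimately have "(\<integral>x. f x \<partial>P) \<le> 1 / a * (\<integral>x. f x \<partial>Q)"
    by simp
  then show ?thesis
    using a_pos by (simp add: field_simps)
qed

text \<open>The difference Q - aP is a nonnegative measure of mass 1 - a. It is not constructed;
  positivity is applied to the nonnegative function m - Re(w f) with a unimodular \<open>w\<close>
  adapted to the difference.\<close>

lemma norm_integral_diff_le:
  fixes f :: "'s \<Rightarrow> complex"
  assumes [measurable]: "f \<in> borel_measurable P"
    and bd: "\<And>x. x \<in> space P \<Longrightarrow> norm (f x) \<le> m"
  shows "norm ((\<integral>x. f x \<partial>Q) - a * (\<integral>x. f x \<partial>P)) \<le> (1 - a) * m"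
proof -
  have fP: "integrable P f" by (rule P.integrable_const_bound[of _ m]) (auto simp: bd)
  have fQ: "integrable Q f" by (rule integrable_Q[OF fP])
  define d where "d = (\<integral>x. f x \<partial>Q) - a * (\<integral>x. f x \<partial>P)"
  \<comment> \<open>This factor rotates \<open>d\<close> onto the positive real axis, which reduces
    the complex estimate to a real one without loss in the constant.\<close>
  define w where "w = cnj (sgn d)"
  have "norm w \<le> 1" by (simp add: w_def norm_sgn)
  have wd: "w * d = of_real (norm d)"
  proof (cases "d = 0")
    case False
    have "w * d = (d * cnj d) / of_real (norm d)" by (simp add: w_def sgn_eq)
    then show ?thesis using False by (simp add: power2_eq_square flip: complex_norm_square)
  qed simp
  have int: "integrable P (\<lambda>x. Re (w * f x))" "integrable Q (\<lambda>x. Re (w * f x))"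
    using fP fQ by (auto simp del: times_complex.sel)
  have le: "Re (w * f x) \<le> m" if "x \<in> space P" for x
  proof -
    have "Re (w * f x) \<le> norm (w * f x)" by (rule complex_Re_le_cmod)
    also have "\<dots> \<le> 1 * norm (f x)" unfolding norm_mult using \<open>norm w \<le> 1\<close> by (rule mult_right_mono) simp
    finally show ?thesis using bd[OF that] by simp
  qed
  have "a * (\<integral>x. m - Re (w * f x) \<partial>P) \<le> (\<integral>x. m - Re (w * f x) \<partial>Q)"
    using int le by (intro integral_lower) (auto simp del: times_complex.sel)
  then have "a * (m - (\<integral>x. Re (w * f x) \<partial>P)) \<le> m - (\<integral>x. Re (w * f x) \<partial>Q)"
    using int by (simp add: P.prob_space Q.prob_space del: times_complex.sel)
  moreover have "(\<integral>x. Re (w * f x) \<partial>P) = Re (w * (\<integral>x. f x \<partial>P))"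
    "(\<integral>x. Re (w * f x) \<partial>Q) = Re (w * (\<integral>x. f x \<partial>Q))"
    using fP fQ by (simp_all del: times_complex.sel)
  moreover have "Re (w * d) = Re (w * (\<integral>x. f x \<partial>Q)) - a * Re (w * (\<integral>x. f x \<partial>P))"
    unfolding d_def by (simp add: algebra_simps)
  ultimately have "Re (w * d) \<le> (1 - a) * m" by (simp add: algebra_simps del: times_complex.sel)
  then show ?thesis by (simp add: wd flip: d_def)
qed

lemma abs_integral_mean_zero_le:
  fixes f :: "'s \<Rightarrow> real"
  assumes [measurable]: "f \<in> borel_measurable P"
    and bd: "\<And>x. x \<in> space P \<Longrightarrow> \<bar>f x\<bar> \<le> m" and mz: "(\<integral>x. f x \<partial>P) = 0"
  shows "\<bar>\<integral>x. f x \<partial>Q\<bar> \<le> (1 - a) * m"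
  using norm_integral_diff_le[of "\<lambda>x. complex_of_real (f x)" m] bd by (simp add: mz)

text \<open>The variance of a unimodular function minimizes the quadratic distance to constants, so the
  lower bound on the kernel passes from second moments to variances.\<close>

lemma norm_integral_unimodular_le:
  fixes e :: "'s \<Rightarrow> complex"
  assumes [measurable]: "e \<in> borel_measurable P"
    and e1: "\<And>x. x \<in> space P \<Longrightarrow> norm (e x) = 1"
  shows "(norm (\<integral>x. e x \<partial>Q))\<^sup>2 \<le> 1 - a * (1 - (norm (\<integral>x. e x \<partial>P))\<^sup>2)"
proof -
  define c where "c = (\<integral>x. e x \<partial>Q)"
  define d where "d = (\<integral>x. e x \<partial>P)"
  have eP: "integrable P e" by (rule P.integrable_const_bound[of _ 1]) (auto simp: e1)
  have eQ: "integrable Q e" by (rule integrable_Q[OF eP])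
  have sq: "(norm (e x - c))\<^sup>2 = 1 + (norm c)\<^sup>2 - 2 * Re (cnj c * e x)" if "x \<in> space P" for x
  proof -
    have "complex_of_real ((norm (e x - c))\<^sup>2) = (e x - c) * cnj (e x - c)"
      by (rule complex_norm_square)
    also have "\<dots> = e x * cnj (e x) + c * cnj c - (cnj c * e x + cnj (cnj c * e x))"
      by (simp add: algebra_simps)
    also have "\<dots> = complex_of_real (1 + (norm c)\<^sup>2 - 2 * Re (cnj c * e x))"
      unfolding complex_norm_square[symmetric] complex_add_cnj using e1[OF that] by simp
    finally show ?thesis by (simp only: of_real_eq_iff)
  qed
  have int: "integrable P (\<lambda>x. Re (cnj c * e x))" "integrable Q (\<lambda>x. Re (cnj c * e x))"
    using eP eQ by (auto simp del: times_complex.sel)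
  have intsq: "integrable P (\<lambda>x. (norm (e x - c))\<^sup>2)"
    by (subst Bochner_Integration.integrable_cong[OF refl sq]) (use int in \<open>auto simp del: times_complex.sel\<close>)
  have "a * (\<integral>x. (norm (e x - c))\<^sup>2 \<partial>P) \<le> (\<integral>x. (norm (e x - c))\<^sup>2 \<partial>Q)"
    using intsq by (rule integral_lower) simp
  moreover have "(\<integral>x. (norm (e x - c))\<^sup>2 \<partial>P) = 1 + (norm c)\<^sup>2 - 2 * Re (cnj c * d)"
  proof -
    have "(\<integral>x. (norm (e x - c))\<^sup>2 \<partial>P) = (\<integral>x. 1 + (norm c)\<^sup>2 - 2 * Re (cnj c * e x) \<partial>P)"
      by (rule Bochner_Integration.integral_cong[OF refl sq])
    also have "\<dots> = 1 + (norm c)\<^sup>2 - 2 * (\<integral>x. Re (cnj c * e x) \<partial>P)"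
      using int by (simp add: P.prob_space del: times_complex.sel)
    also have "(\<integral>x. Re (cnj c * e x) \<partial>P) = Re (cnj c * d)"
      unfolding d_def using eP by (simp del: times_complex.sel)
    finally show ?thesis .
  qed
  moreover have "(\<integral>x. (norm (e x - c))\<^sup>2 \<partial>Q) = 1 + (norm c)\<^sup>2 - 2 * Re (cnj c * c)"
  proof -
    have "(\<integral>x. (norm (e x - c))\<^sup>2 \<partial>Q) = (\<integral>x. 1 + (norm c)\<^sup>2 - 2 * Re (cnj c * e x) \<partial>Q)"
      by (rule Bochner_Integration.integral_cong[OF refl sq]) (simp add: space_eq)
    also have "\<dots> = 1 + (norm c)\<^sup>2 - 2 * (\<integral>x. Re (cnj c * e x) \<partial>Q)"
      using int by (simp add: Q.prob_space del: times_complex.sel)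
    also have "(\<integral>x. Re (cnj c * e x) \<partial>Q) = Re (cnj c * c)"
      unfolding c_def using eQ by (simp del: times_complex.sel)
    finally show ?thesis .
  qed
  moreover have "Re (cnj c * c) = (norm c)\<^sup>2"
    unfolding cmod_power2 by (simp add: power2_eq_square)
  \<comment> \<open>The second moment about \<open>c\<close> under \<open>P\<close> exceeds the
    variance 1 - \<bar>d\<bar>^2 by exactly \<bar>d - c\<bar>^2, which is dropped.\<close>
  moreover have "0 \<le> (norm (d - c))\<^sup>2" by simp
  moreover have "(norm (d - c))\<^sup>2 = (norm d)\<^sup>2 + (norm c)\<^sup>2 - 2 * Re (cnj c * d)"
    unfolding cmod_power2 by (simp add: power2_eq_square algebra_simps)
  ultimately have "a * (1 - (norm d)\<^sup>2) \<le> a * (1 + (norm c)\<^sup>2 - 2 * Re (cnj c * d))"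
    "a * (1 + (norm c)\<^sup>2 - 2 * Re (cnj c * d)) \<le> 1 - (norm c)\<^sup>2"
    using a_pos by (auto intro!: mult_left_mono)
  then show ?thesis by (simp flip: c_def d_def)
qed

end

text \<open>Here \<open>Q k\<close> leads from time \<open>k\<close> to time \<open>Suc k\<close>, so it plays the role of the paper's \<open>Q\<^sub>k\<^sub>+\<^sub>1\<close>.\<close>

locale comparable_chain = prob_space M for M :: "'a measure" +
  fixes N :: "'s measure" and F :: "nat \<Rightarrow> 'a measure" and \<xi> :: "nat \<Rightarrow> 'a \<Rightarrow> 's"
    and Q :: "nat \<Rightarrow> 's \<Rightarrow> 's measure" and a b :: real
  assumes subalg: "\<And>k. subalgebra M (F k)"
    and F_Suc: "\<And>k. subalgebra (F (Suc k)) (F k)"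
    and adapted: "\<And>k. \<xi> k \<in> F k \<rightarrow>\<^sub>M N"
    and kernel: "\<And>k. Q k \<in> N \<rightarrow>\<^sub>M prob_algebra N"
    and transition: "\<And>k A B. A \<in> sets (F k) \<Longrightarrow> B \<in> sets N \<Longrightarrow>
          measure M (A \<inter> (\<xi> (Suc k) -` B \<inter> space M)) = (\<integral>\<omega>. indicator A \<omega> * measure (Q k (\<xi> k \<omega>)) B \<partial>M)"
    and a_pos: "0 < a"
    and comparable: "\<And>k x B. x \<in> space N \<Longrightarrow> B \<in> sets N \<Longrightarrow>
          a * measure (distr M N (\<xi> (Suc k))) B \<le> measure (Q k x) B \<and>
          measure (Q k x) B \<le> b * measure (distr M N (\<xi> (Suc k))) B"
begin

lemma \<xi>_measurable[measurable]: "\<xi> k \<in> M \<rightarrow>\<^sub>M N"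
  using measurable_from_subalg[OF subalg adapted] .

lemma \<xi>_space: "\<omega> \<in> space M \<Longrightarrow> \<xi> k \<omega> \<in> space N"
  using measurable_space[OF \<xi>_measurable] .

lemma kernel_subprob[measurable]: "Q k \<in> N \<rightarrow>\<^sub>M subprob_algebra N"
  using kernel by (rule measurable_prob_algebraD)

lemma F_measurable: "f \<in> F k \<rightarrow>\<^sub>M L \<Longrightarrow> f \<in> M \<rightarrow>\<^sub>M L"
  by (rule measurable_from_subalg[OF subalg])

lemma F_mono: "f \<in> F k \<rightarrow>\<^sub>M L \<Longrightarrow> f \<in> F (Suc k) \<rightarrow>\<^sub>M L"
  by (rule measurable_from_subalg[OF F_Suc])

lemma adapted_le: "i \<le> k \<Longrightarrow> \<xi> i \<in> F k \<rightarrow>\<^sub>M N"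
  by (induction k rule: dec_induct) (auto intro: adapted F_mono)

abbreviation P :: "nat \<Rightarrow> 's measure" where "P k \<equiv> distr M N (\<xi> k)"

lemma comparable_prob: "x \<in> space N \<Longrightarrow> comparable_prob (P (Suc k)) (Q k x) a b"
  using measurable_space[OF kernel, of x k] comparable[of x _ k] a_pos
  by (intro comparable_prob.intro comparable_prob_axioms.intro prob_space_distr)
     (auto simp: space_prob_algebra)

lemma space_N_nonempty: "space N \<noteq> {}"
  using \<xi>_space not_empty by blast

lemma a_le_1: "a \<le> 1" and b_ge_1: "1 \<le> b"
  using space_N_nonempty comparable_prob[THEN comparable_prob.a_le_1]
    comparable_prob[THEN comparable_prob.b_ge_1] by blast+

text \<open>The one-step conditional expectation as a function of the current state; polymorphic
  because both real correctors and complex exponentials pass through it.\<close>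

definition QI :: "nat \<Rightarrow> ('s \<Rightarrow> 'c) \<Rightarrow> 's \<Rightarrow> 'c::{banach, second_countable_topology}" where
  "QI k \<phi> x = (\<integral>y. \<phi> y \<partial>Q k x)"

lemma QI_measurable[measurable]:
  assumes "\<phi> \<in> borel_measurable N" shows "QI k \<phi> \<in> borel_measurable N"
  unfolding QI_def[abs_def]
  by (rule measurable_compose[OF kernel_subprob integral_measurable_subprob_algebra[OF assms]])

lemma integrable_P_bounded:
  fixes \<phi> :: "'s \<Rightarrow> 'c::{banach, second_countable_topology}"
  assumes "\<phi> \<in> borel_measurable N" "\<And>y. y \<in> space N \<Longrightarrow> norm (\<phi> y) \<le> C"
  shows "integrable (P k) \<phi>"
proof -
  interpret Pk: prob_space "P k" by (rule prob_space_distr) simp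
  show ?thesis using assms by (intro Pk.integrable_const_bound[of _ C]) auto
qed

lemma sets_Q: "x \<in> space N \<Longrightarrow> sets (Q k x) = sets N"
  using comparable_prob[THEN comparable_prob.sets_eq, of x k] by simp

lemma space_Q: "x \<in> space N \<Longrightarrow> space (Q k x) = space N"
  using sets_Q by (rule sets_eq_imp_space_eq)

lemma integrable_Q:
  fixes \<phi> :: "'s \<Rightarrow> 'c::{banach, second_countable_topology}"
  shows "integrable (P (Suc k)) \<phi> \<Longrightarrow> x \<in> space N \<Longrightarrow> integrable (Q k x) \<phi>"
  using comparable_prob[THEN comparable_prob.integrable_Q] .

text \<open>The upper kernel bound makes each transition map integrable functions to bounded ones.
  This is what keeps all correctors bounded although the summands are only square
  integrable.\<close>

lemma norm_QI_le:
  fixes \<phi> :: "'s \<Rightarrow> 'c::{banach, second_countable_topology}"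
  assumes "integrable (P (Suc k)) \<phi>" "x \<in> space N"
  shows "norm (QI k \<phi> x) \<le> b * (\<integral>y. norm (\<phi> y) \<partial>P (Suc k))"
proof -
  interpret C: comparable_prob "P (Suc k)" "Q k x" a b by (rule comparable_prob) fact
  have "norm (QI k \<phi> x) \<le> (\<integral>y. norm (\<phi> y) \<partial>Q k x)"
    unfolding QI_def by (rule integral_norm_bound)
  also have "\<dots> \<le> b * (\<integral>y. norm (\<phi> y) \<partial>P (Suc k))"
    using assms by (intro C.integral_upper) auto
  finally show ?thesis .
qed

lemma norm_QI_le_const:
  fixes \<phi> :: "'s \<Rightarrow> 'c::{banach, second_countable_topology}"
  assumes "\<phi> \<in> borel_measurable N" "\<And>y. y \<in> space N \<Longrightarrow> norm (\<phi> y) \<le> C" "x \<in> space N"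
  shows "norm (QI k \<phi> x) \<le> C"
proof -
  interpret C: comparable_prob "P (Suc k)" "Q k x" a b by (rule comparable_prob) fact
  have "integrable (P (Suc k)) \<phi>"
    using assms(1,2) by (rule integrable_P_bounded)
  then have "integrable (Q k x) \<phi>" using assms by (intro integrable_Q)
  have "norm (QI k \<phi> x) \<le> (\<integral>y. norm (\<phi> y) \<partial>Q k x)"
    unfolding QI_def by (rule integral_norm_bound)
  also have "\<dots> \<le> (\<integral>y. C \<partial>Q k x)"
    using assms \<open>integrable (Q k x) \<phi>\<close> by (intro integral_mono) (auto simp: space_Q)
  finally show ?thesis using C.Q.prob_space by simp
qed

text \<open>Induction on integrable functions, starting from the kernel identity for indicator
  functions.\<close>

lemma set_transition:
  fixes \<phi> :: "'s \<Rightarrow> real"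
  assumes "integrable (P (Suc k)) \<phi>" "A \<in> sets (F k)"
  shows "(\<integral>\<omega>. indicator A \<omega> * \<phi> (\<xi> (Suc k) \<omega>) \<partial>M) = (\<integral>\<omega>. indicator A \<omega> * QI k \<phi> (\<xi> k \<omega>) \<partial>M)"
  using assms(1)
proof induction
  have AM[measurable]: "A \<in> sets M" using assms(2) subalg[of k] by (auto simp: subalgebra_def)
  {
    fix \<phi> :: "'s \<Rightarrow> real" assume i: "integrable (P (Suc k)) \<phi>"
    then have [measurable]: "\<phi> \<in> borel_measurable N" by simp
    have "integrable M (\<lambda>\<omega>. indicator A \<omega> *\<^sub>R \<phi> (\<xi> (Suc k) \<omega>))"
      using integrable_distr[OF \<xi>_measurable i] by (intro integrable_mult_indicator) auto
    moreover have "integrable M (\<lambda>\<omega>. indicator A \<omega> *\<^sub>R QI k \<phi> (\<xi> k \<omega>))"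
      by (intro integrable_mult_indicator integrable_const_bound[OF AE_I2[OF norm_QI_le[OF i \<xi>_space]]]) auto
    ultimately have "integrable M (\<lambda>\<omega>. indicator A \<omega> * \<phi> (\<xi> (Suc k) \<omega>))"
      "integrable M (\<lambda>\<omega>. indicator A \<omega> * QI k \<phi> (\<xi> k \<omega>))" by simp_all
  } note int = this
  {
    case (base B c)
    then have B[measurable]: "B \<in> sets N" by simp
    have "(\<integral>\<omega>. indicator A \<omega> * (indicator B (\<xi> (Suc k) \<omega>) *\<^sub>R c) \<partial>M)
        = (\<integral>\<omega>. c * indicator (A \<inter> (\<xi> (Suc k) -` B \<inter> space M)) \<omega> \<partial>M)"
      by (intro Bochner_Integration.integral_cong) (auto split: split_indicator)
    also have "\<dots> = c * (\<integral>\<omega>. indicator A \<omega> * measure (Q k (\<xi> k \<omega>)) B \<partial>M)"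
      using transition[OF assms(2) B] AM by simp
    also have "\<dots> = (\<integral>\<omega>. indicator A \<omega> * QI k (\<lambda>x. indicator B x *\<^sub>R c) (\<xi> k \<omega>) \<partial>M)"
      unfolding integral_mult_right_zero[symmetric] QI_def
      using sets_Q[OF \<xi>_space] B
      by (intro Bochner_Integration.integral_cong) auto
    finally show ?case .
  next
    case (add f g)
    have "(\<integral>\<omega>. indicator A \<omega> * QI k (\<lambda>x. f x + g x) (\<xi> k \<omega>) \<partial>M) =
       (\<integral>\<omega>. indicator A \<omega> * QI k f (\<xi> k \<omega>) + indicator A \<omega> * QI k g (\<xi> k \<omega>) \<partial>M)"
      unfolding QI_def using add.hyps(1,2)[THEN integrable_Q[OF _ \<xi>_space]]
      by (intro Bochner_Integration.integral_cong) (auto simp: algebra_simps)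
    also have "\<dots> = (\<integral>\<omega>. indicator A \<omega> * f (\<xi> (Suc k) \<omega>) \<partial>M) + (\<integral>\<omega>. indicator A \<omega> * g (\<xi> (Suc k) \<omega>) \<partial>M)"
      using int[OF add.hyps(1)] int[OF add.hyps(2)] add.IH by simp
    also have "\<dots> = (\<integral>\<omega>. indicator A \<omega> * (f (\<xi> (Suc k) \<omega>) + g (\<xi> (Suc k) \<omega>)) \<partial>M)"
      using int[OF add.hyps(1)] int[OF add.hyps(2)] by (simp add: distrib_left)
    finally show ?case by simp
  next
    case (lim f s)
    have [measurable]: "f \<in> borel_measurable N" "\<And>i. s i \<in> borel_measurable N"
      using lim by auto
    have nf: "integrable (P (Suc k)) (\<lambda>y. 2 * norm (f y))" using lim by simp
    have "(\<lambda>i. \<integral>\<omega>. indicator A \<omega> * s i (\<xi> (Suc k) \<omega>) \<partial>M) \<longlonglongrightarrow> (\<integral>\<omega>. indicator A \<omega> * f (\<xi> (Suc k) \<omega>) \<partial>M)"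
    proof (rule integral_dominated_convergence)
      show "integrable M (\<lambda>\<omega>. 2 * norm (f (\<xi> (Suc k) \<omega>)))"
        using integrable_distr[OF \<xi>_measurable nf] .
      show "AE \<omega> in M. (\<lambda>i. indicator A \<omega> * s i (\<xi> (Suc k) \<omega>)) \<longlonglongrightarrow> indicator A \<omega> * f (\<xi> (Suc k) \<omega>)"
        using lim \<xi>_space by (intro AE_I2 tendsto_mult tendsto_const) auto
      show "AE \<omega> in M. norm (indicator A \<omega> * s i (\<xi> (Suc k) \<omega>)) \<le> 2 * norm (f (\<xi> (Suc k) \<omega>))" for i
        using lim \<xi>_space by (intro AE_I2) (auto simp: indicator_def)
    qed measurable
    moreover have "(\<lambda>i. \<integral>\<omega>. indicator A \<omega> * s i (\<xi> (Suc k) \<omega>) \<partial>M) \<longlonglongrightarrow> (\<integral>\<omega>. indicator A \<omega> * QI k f (\<xi> k \<omega>) \<partial>M)"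
      unfolding lim.IH
    proof (rule integral_dominated_convergence)
      \<comment> \<open>A constant majorant suffices, since a transition turns the integrable
        majorant \<open>2 * norm (f y)\<close> into a bounded function.\<close>
      show "integrable M (\<lambda>\<omega>. b * (\<integral>y. 2 * norm (f y) \<partial>P (Suc k)))" by simp
      show "AE \<omega> in M. (\<lambda>i. indicator A \<omega> * QI k (s i) (\<xi> k \<omega>)) \<longlonglongrightarrow> indicator A \<omega> * QI k f (\<xi> k \<omega>)"
      proof (intro AE_I2 tendsto_mult tendsto_const)
        fix \<omega> assume "\<omega> \<in> space M"
        then have x: "\<xi> k \<omega> \<in> space N" by (rule \<xi>_space)
        have [measurable_cong]: "sets (Q k (\<xi> k \<omega>)) = sets N" using x by (rule sets_Q)
        show "(\<lambda>i. QI k (s i) (\<xi> k \<omega>)) \<longlonglongrightarrow> QI k f (\<xi> k \<omega>)"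
          unfolding QI_def
          by (rule integral_dominated_convergence[where w = "\<lambda>y. 2 * norm (f y)"])
             (use lim integrable_Q[OF nf x] x in \<open>auto simp: space_Q\<close>)
      qed
      show "AE \<omega> in M. norm (indicator A \<omega> * QI k (s i) (\<xi> k \<omega>)) \<le> b * (\<integral>y. 2 * norm (f y) \<partial>P (Suc k))" for i
      proof (intro AE_I2)
        fix \<omega> assume "\<omega> \<in> space M"
        then have "norm (QI k (s i) (\<xi> k \<omega>)) \<le> b * (\<integral>y. norm (s i y) \<partial>P (Suc k))"
          using lim by (intro norm_QI_le \<xi>_space) auto
        also have "\<dots> \<le> b * (\<integral>y. 2 * norm (f y) \<partial>P (Suc k))"
          using lim nf b_ge_1 by (intro mult_left_mono integral_mono) auto
        finally show "norm (indicator A \<omega> * QI k (s i) (\<xi> k \<omega>)) \<le> b * (\<integral>y. 2 * norm (f y) \<partial>P (Suc k))"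
          by (auto simp: indicator_def)
      qed
    qed measurable
    ultimately show ?case by (rule LIMSEQ_unique)
  }
qed

text \<open>Sets of the past determine the conditional expectation, so \<open>QI k \<phi>\<close>
  composed with the state is a version of it. Consequently \<open>U\<close> may be unbounded as long
  as the product is integrable, as is the case for partial sums.\<close>

lemma real_transition:
  fixes \<phi> :: "'s \<Rightarrow> real"
  assumes \<phi>: "integrable (P (Suc k)) \<phi>"
    and U: "U \<in> borel_measurable (F k)"
    and int: "integrable M (\<lambda>\<omega>. U \<omega> * \<phi> (\<xi> (Suc k) \<omega>))"
  shows "integrable M (\<lambda>\<omega>. U \<omega> * QI k \<phi> (\<xi> k \<omega>))"
    and "(\<integral>\<omega>. U \<omega> * \<phi> (\<xi> (Suc k) \<omega>) \<partial>M) = (\<integral>\<omega>. U \<omega> * QI k \<phi> (\<xi> k \<omega>) \<partial>M)"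
proof -
  interpret S: finite_measure_subalgebra M "F k"
    by standard (rule subalg)
  have [measurable]: "\<phi> \<in> borel_measurable N" using \<phi> by simp
  have [measurable]: "U \<in> borel_measurable M" using U by (rule F_measurable)
  have QF: "(\<lambda>\<omega>. QI k \<phi> (\<xi> k \<omega>)) \<in> borel_measurable (F k)"
    by (rule measurable_compose[OF adapted]) measurable
  have "AE \<omega> in M. real_cond_exp M (F k) (\<lambda>\<omega>. \<phi> (\<xi> (Suc k) \<omega>)) \<omega> = QI k \<phi> (\<xi> k \<omega>)"
  proof (rule S.real_cond_exp_charact)
    show "integrable M (\<lambda>\<omega>. QI k \<phi> (\<xi> k \<omega>))"
      by (intro integrable_const_bound[OF AE_I2[OF norm_QI_le[OF \<phi> \<xi>_space]]]) auto
    show "integrable M (\<lambda>\<omega>. \<phi> (\<xi> (Suc k) \<omega>))" using \<phi> by (simp add: integrable_distr_eq)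
  qed (use set_transition[OF \<phi>] QF in \<open>simp_all add: set_lebesgue_integral_def\<close>)
  then have AE: "AE \<omega> in M. U \<omega> * real_cond_exp M (F k) (\<lambda>\<omega>. \<phi> (\<xi> (Suc k) \<omega>)) \<omega> = U \<omega> * QI k \<phi> (\<xi> k \<omega>)"
    by auto
  have *: "integrable M (\<lambda>\<omega>. U \<omega> * real_cond_exp M (F k) (\<lambda>\<omega>. \<phi> (\<xi> (Suc k) \<omega>)) \<omega>)"
    "(\<integral>\<omega>. U \<omega> * real_cond_exp M (F k) (\<lambda>\<omega>. \<phi> (\<xi> (Suc k) \<omega>)) \<omega> \<partial>M) = (\<integral>\<omega>. U \<omega> * \<phi> (\<xi> (Suc k) \<omega>) \<partial>M)"
    using int by (intro S.real_cond_exp_intg U; measurable)+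
  have m: "(\<lambda>\<omega>. U \<omega> * QI k \<phi> (\<xi> k \<omega>)) \<in> borel_measurable M" by measurable
  show "integrable M (\<lambda>\<omega>. U \<omega> * QI k \<phi> (\<xi> k \<omega>))"
    using Bochner_Integration.integrable_cong_AE_imp[OF *(1) m] AE by auto
  show "(\<integral>\<omega>. U \<omega> * \<phi> (\<xi> (Suc k) \<omega>) \<partial>M) = (\<integral>\<omega>. U \<omega> * QI k \<phi> (\<xi> k \<omega>) \<partial>M)"
    unfolding *(2)[symmetric] using AE by (intro integral_cong_AE) auto
qed

lemma QI_mean:
  fixes \<phi> :: "'s \<Rightarrow> real"
  assumes \<phi>: "integrable (P (Suc k)) \<phi>"
  shows "(\<integral>x. QI k \<phi> x \<partial>P k) = (\<integral>x. \<phi> x \<partial>P (Suc k))"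
    and "integrable (P k) (QI k \<phi>)"
proof -
  have [measurable]: "\<phi> \<in> borel_measurable N" using \<phi> by simp
  have i: "integrable M (\<lambda>\<omega>. 1 * \<phi> (\<xi> (Suc k) \<omega>))" using \<phi> by (simp add: integrable_distr_eq)
  show "(\<integral>x. QI k \<phi> x \<partial>P k) = (\<integral>x. \<phi> x \<partial>P (Suc k))"
    using real_transition(2)[OF \<phi> _ i] by (simp add: integral_distr)
  show "integrable (P k) (QI k \<phi>)"
    using real_transition(1)[OF \<phi> _ i] by (simp add: integrable_distr_eq)
qed

text \<open>The real statement for the four products of real and imaginary parts; boundedness
  provides all the integrability.\<close>

lemma complex_transition:
  fixes U :: "'a \<Rightarrow> complex" and \<phi> :: "'s \<Rightarrow> complex"
  assumes [measurable]: "\<phi> \<in> borel_measurable N" and \<phi>: "\<And>y. y \<in> space N \<Longrightarrow> norm (\<phi> y) \<le> C"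
    and U: "U \<in> borel_measurable (F k)" and UD: "\<And>\<omega>. \<omega> \<in> space M \<Longrightarrow> norm (U \<omega>) \<le> D"
  shows "(\<integral>\<omega>. U \<omega> * \<phi> (\<xi> (Suc k) \<omega>) \<partial>M) = (\<integral>\<omega>. U \<omega> * QI k \<phi> (\<xi> k \<omega>) \<partial>M)"
proof -
  have [measurable]: "U \<in> borel_measurable M" using U by (rule F_measurable)
  have UF: "(\<lambda>\<omega>. Re (U \<omega>)) \<in> borel_measurable (F k)" "(\<lambda>\<omega>. Im (U \<omega>)) \<in> borel_measurable (F k)"
    using U by auto
  have \<phi>i: "integrable (P (Suc k)) \<phi>"
    using assms(1,2) by (rule integrable_P_bounded)
  then have \<phi>r: "integrable (P (Suc k)) (\<lambda>y. Re (\<phi> y))" "integrable (P (Suc k)) (\<lambda>y. Im (\<phi> y))" by auto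
  have "norm (\<phi> y) \<le> \<bar>C\<bar>" "norm (QI k \<phi> y) \<le> \<bar>C\<bar>" if "y \<in> space N" for y
    using \<phi>[OF that] norm_QI_le_const[OF assms(1) \<phi> that, where k = k] by auto
  then have bd: "norm (U \<omega> * \<phi> (\<xi> (Suc k) \<omega>)) \<le> \<bar>D\<bar> * \<bar>C\<bar>" "norm (U \<omega> * QI k \<phi> (\<xi> k \<omega>)) \<le> \<bar>D\<bar> * \<bar>C\<bar>"
    if "\<omega> \<in> space M" for \<omega>
    unfolding norm_mult using UD[OF that] \<xi>_space[OF that] that by (intro mult_mono; force)+
  have i1: "integrable M (\<lambda>\<omega>. U \<omega> * \<phi> (\<xi> (Suc k) \<omega>))"
    and i2: "integrable M (\<lambda>\<omega>. U \<omega> * QI k \<phi> (\<xi> k \<omega>))"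
    by (intro integrable_const_bound[of _ "\<bar>D\<bar> * \<bar>C\<bar>"] AE_I2 bd; measurable)+
  have real_bd: "\<bar>u * v\<bar> \<le> \<bar>D\<bar> * \<bar>C\<bar>" if "\<omega> \<in> space M" "\<bar>u\<bar> \<le> norm (U \<omega>)" "\<bar>v\<bar> \<le> norm (\<phi> (\<xi> (Suc k) \<omega>))" for u v \<omega>
  proof -
    have "\<bar>u * v\<bar> \<le> norm (U \<omega>) * norm (\<phi> (\<xi> (Suc k) \<omega>))" unfolding abs_mult using that by (intro mult_mono) auto
    with bd(1)[OF that(1)] show ?thesis by (simp add: norm_mult)
  qed
  have ri: "integrable M (\<lambda>\<omega>. u (U \<omega>) * v (\<phi> (\<xi> (Suc k) \<omega>)))"
    if "u \<in> {Re, Im}" "v \<in> {Re, Im}" for u v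
    by (intro integrable_const_bound[of _ "\<bar>D\<bar> * \<bar>C\<bar>"] AE_I2)
       (use that in \<open>auto intro!: real_bd[unfolded abs_mult] abs_Re_le_cmod abs_Im_le_cmod simp: abs_mult\<close>)
  have QR: "QI k (\<lambda>y. Re (\<phi> y)) x = Re (QI k \<phi> x)" "QI k (\<lambda>y. Im (\<phi> y)) x = Im (QI k \<phi> x)"
    if "x \<in> space N" for x
    unfolding QI_def using integrable_Q[OF \<phi>i that] by auto
  have cong: "(\<integral>\<omega>. u (U \<omega>) * QI k (\<lambda>y. v (\<phi> y)) (\<xi> k \<omega>) \<partial>M) = (\<integral>\<omega>. u (U \<omega>) * v (QI k \<phi> (\<xi> k \<omega>)) \<partial>M)"
    "integrable M (\<lambda>\<omega>. u (U \<omega>) * QI k (\<lambda>y. v (\<phi> y)) (\<xi> k \<omega>)) \<longleftrightarrow> integrable M (\<lambda>\<omega>. u (U \<omega>) * v (QI k \<phi> (\<xi> k \<omega>)))"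
    if "v \<in> {Re, Im}" for u v :: "complex \<Rightarrow> real"
    using that QR \<xi>_space
    by (auto intro!: Bochner_Integration.integral_cong Bochner_Integration.integrable_cong)
  have T: "(\<integral>\<omega>. u (U \<omega>) * v (\<phi> (\<xi> (Suc k) \<omega>)) \<partial>M) = (\<integral>\<omega>. u (U \<omega>) * v (QI k \<phi> (\<xi> k \<omega>)) \<partial>M)"
    "integrable M (\<lambda>\<omega>. u (U \<omega>) * v (QI k \<phi> (\<xi> k \<omega>)))"
    if "u \<in> {Re, Im}" "v \<in> {Re, Im}" for u v
    using real_transition[of k "\<lambda>y. v (\<phi> y)" "\<lambda>\<omega>. u (U \<omega>)"] cong[OF that(2)] ri[OF that] that UF \<phi>r
    by auto
  show ?thesis
  proof (rule complex_eqI)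
    show "Re (\<integral>\<omega>. U \<omega> * \<phi> (\<xi> (Suc k) \<omega>) \<partial>M) = Re (\<integral>\<omega>. U \<omega> * QI k \<phi> (\<xi> k \<omega>) \<partial>M)"
      unfolding integral_Re[OF i1, symmetric] integral_Re[OF i2, symmetric] times_complex.sel
      using T[of Re Re] T[of Im Im] ri[of Re Re] ri[of Im Im] by simp
    show "Im (\<integral>\<omega>. U \<omega> * \<phi> (\<xi> (Suc k) \<omega>) \<partial>M) = Im (\<integral>\<omega>. U \<omega> * QI k \<phi> (\<xi> k \<omega>) \<partial>M)"
      unfolding integral_Im[OF i1, symmetric] integral_Im[OF i2, symmetric] times_complex.sel
      using T[of Re Im] T[of Im Re] ri[of Re Im] ri[of Im Re] by simp
  qed
qed

end

section \<open>Decay of the characteristic function\<close>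

text \<open>The product of the factors at k+1, k+3, ..., one for each full pair among the next
  \<open>j\<close> steps.\<close>

fun skip_prod :: "(nat \<Rightarrow> real) \<Rightarrow> nat \<Rightarrow> nat \<Rightarrow> real" where
  "skip_prod d 0 k = 1"
| "skip_prod d (Suc 0) k = 1"
| "skip_prod d (Suc (Suc j)) k = d (Suc k) * skip_prod d j (Suc (Suc k))"

lemma skip_prod_nonneg: "(\<And>k. 0 \<le> d k) \<Longrightarrow> 0 \<le> skip_prod d j k"
  by (induction d j k rule: skip_prod.induct) auto

text \<open>Pairings that start one step apart interlace: together they meet every index exactly
  once.\<close>

lemma skip_prod_mult: "skip_prod d (Suc j) k * skip_prod d j (Suc k) = (\<Prod>i\<in>{k<..k + j}. d i)"
proof (induction j arbitrary: k)
  case (Suc j)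
  have "{k<..k + Suc j} = insert (Suc k) {Suc k<..Suc k + j}" by auto
  then show ?case using Suc[of "Suc k"] by (simp add: mult_ac)
qed simp

section \<open>Backward recursion for conditional characteristic functions\<close>

context comparable_chain begin

text \<open>The conditional expectation of the product of the next \<open>j\<close> phases, given
  the state at time \<open>k\<close>.\<close>

primrec step_char :: "(nat \<Rightarrow> 's \<Rightarrow> complex) \<Rightarrow> nat \<Rightarrow> nat \<Rightarrow> 's \<Rightarrow> complex" where
  "step_char e 0 k = (\<lambda>x. 1)"
| "step_char e (Suc j) k = QI k (\<lambda>y. e (Suc k) y * step_char e j (Suc k) y)"

context
  fixes e :: "nat \<Rightarrow> 's \<Rightarrow> complex"
  assumes e_measurable[measurable]: "\<And>k. e k \<in> borel_measurable N"
    and e_norm: "\<And>k x. x \<in> space N \<Longrightarrow> norm (e k x) = 1"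
begin

lemma step_char_measurable[measurable]: "step_char e j k \<in> borel_measurable N"
  by (induction j arbitrary: k) simp_all

lemma norm_step_char_le_1: "x \<in> space N \<Longrightarrow> norm (step_char e j k x) \<le> 1"
  by (induction j arbitrary: k x) (auto intro!: norm_QI_le_const simp: norm_mult e_norm)

lemma expectation_step_char:
  assumes "k \<le> n"
  shows "expectation (\<lambda>\<omega>. \<Prod>i\<in>{0<..n}. e i (\<xi> i \<omega>))
    = expectation (\<lambda>\<omega>. (\<Prod>i\<in>{0<..k}. e i (\<xi> i \<omega>)) * step_char e (n - k) k (\<xi> k \<omega>))"
  using assms
proof (induction k rule: inc_induct)
  case (step k)
  define \<phi> where "\<phi> = (\<lambda>y. e (Suc k) y * step_char e (n - Suc k) (Suc k) y)"
  have j: "n - k = Suc (n - Suc k)" using step by simp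
  have split: "{0<..Suc k} = insert (Suc k) {0<..k}" by auto
  have "expectation (\<lambda>\<omega>. (\<Prod>i\<in>{0<..k}. e i (\<xi> i \<omega>)) * \<phi> (\<xi> (Suc k) \<omega>))
    = expectation (\<lambda>\<omega>. (\<Prod>i\<in>{0<..k}. e i (\<xi> i \<omega>)) * QI k \<phi> (\<xi> k \<omega>))"
  proof (rule complex_transition[where C = 1 and D = 1])
    show "(\<lambda>\<omega>. \<Prod>i\<in>{0<..k}. e i (\<xi> i \<omega>)) \<in> borel_measurable (F k)"
      by (intro borel_measurable_prod measurable_compose[OF adapted_le e_measurable]) auto
    show "norm (\<Prod>i\<in>{0<..k}. e i (\<xi> i \<omega>)) \<le> 1" if "\<omega> \<in> space M" for \<omega>
      using that by (simp add: prod_norm[symmetric] e_norm \<xi>_space)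
    show "norm (\<phi> y) \<le> 1" if "y \<in> space N" for y
      using that norm_step_char_le_1 by (simp add: \<phi>_def norm_mult e_norm)
  qed (simp add: \<phi>_def)
  then show ?case
    using step.IH by (simp add: j split \<phi>_def mult_ac)
qed simp

text \<open>One factor \<open>a\<close> is the weight of the marginal split off from a kernel. The
  other, together with 1/2, comes from the unimodular estimate after its square root has been
  linearized.\<close>

definition decay :: "nat \<Rightarrow> real" where
  "decay k = 1 - a\<^sup>2 / 2 * (1 - (norm (\<integral>x. e k x \<partial>P k))\<^sup>2)"

lemma norm_char_le_1: "norm (\<integral>x. e k x \<partial>P k) \<le> 1"
proof -
  interpret Pk: prob_space "P k" by (rule prob_space_distr) simp
  have "norm (\<integral>x. e k x \<partial>P k) \<le> (\<integral>x. norm (e k x) \<partial>P k)" by (rule integral_norm_bound)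
  also have "\<dots> = (\<integral>x. 1 \<partial>P k)" by (intro Bochner_Integration.integral_cong) (auto simp: e_norm)
  finally show ?thesis using Pk.prob_space by simp
qed

lemma decay_nonneg: "0 \<le> decay k"
proof -
  have "a\<^sup>2 / 2 * (1 - (norm (\<integral>x. e k x \<partial>P k))\<^sup>2) \<le> 1 * 1"
    using a_pos norm_char_le_1[of k] power_le_one[OF _ a_le_1, of 2]
    by (intro mult_mono) (simp_all add: power_le_one)
  then show ?thesis by (simp add: decay_def)
qed

text \<open>One of every two consecutive steps gains a factor: the kernel of the second step splits off
  \<open>a\<close> times its marginal, along which the first phase integrates independently.\<close>

lemma norm_step_char_Suc_Suc:
  assumes bd: "\<And>y. y \<in> space N \<Longrightarrow> norm (step_char e j (Suc (Suc k)) y) \<le> s" and x: "x \<in> space N"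
  shows "norm (step_char e (Suc (Suc j)) k x) \<le> decay (Suc k) * s"
proof -
  interpret C: comparable_prob "P (Suc k)" "Q k x" a b by (rule comparable_prob) fact
  have [measurable_cong]: "sets (Q k x) = sets N" using x by (rule sets_Q)
  define \<eta> where "\<eta> y = e (Suc (Suc k)) y * step_char e j (Suc (Suc k)) y" for y
  have [measurable]: "\<eta> \<in> borel_measurable N" unfolding \<eta>_def[abs_def] by measurable
  have \<eta>: "norm (\<eta> y) \<le> s" if "y \<in> space N" for y
    using bd[OF that] that by (simp add: \<eta>_def norm_mult e_norm)
  have s: "0 \<le> s" using bd[OF x] norm_ge_zero order_trans by blast
  define p where "p = (\<integral>y. \<eta> y \<partial>P (Suc (Suc k)))"
  have p: "norm p \<le> s"
  proof -
    interpret Pk: prob_space "P (Suc (Suc k))" by (rule prob_space_distr) simp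
    have "norm p \<le> (\<integral>y. norm (\<eta> y) \<partial>P (Suc (Suc k)))" unfolding p_def by (rule integral_norm_bound)
    also have "\<dots> \<le> (\<integral>y. s \<partial>P (Suc (Suc k)))"
      using \<eta> s by (intro integral_mono integrable_P_bounded[of _ s]) auto
    finally show ?thesis using Pk.prob_space by simp
  qed
  \<comment> \<open>The part \<open>a * p\<close> of the second transition does not depend on the
    intermediate state, so the first phase is integrated alone against it. The rest \<open>r\<close>
    has weight \<open>1 - a\<close> and yields no gain.\<close>
  define r where "r y = QI (Suc k) \<eta> y - a * p" for y
  have [measurable]: "r \<in> borel_measurable N" unfolding r_def[abs_def] by measurable
  have r: "norm (r y) \<le> (1 - a) * s" if "y \<in> space N" for y
    using comparable_prob.norm_integral_diff_le[OF comparable_prob[OF that], of \<eta> "Suc k" s] \<eta>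
    by (simp add: r_def QI_def p_def)
  define c where "c = (\<integral>y. e (Suc k) y \<partial>Q k x)"
  have int: "integrable (Q k x) (e (Suc k))" "integrable (Q k x) (\<lambda>y. e (Suc k) y * r y)"
    using integrable_Q[OF integrable_P_bounded[of "e (Suc k)" 1] x]
      integrable_Q[OF integrable_P_bounded[of "\<lambda>y. e (Suc k) y * r y" "(1 - a) * s"] x] r
    by (simp_all add: norm_mult e_norm)
  have "step_char e (Suc (Suc j)) k x = (\<integral>y. a * p * e (Suc k) y + e (Suc k) y * r y \<partial>Q k x)"
    by (simp add: QI_def[of k] r_def \<eta>_def[abs_def] algebra_simps)
  also have "\<dots> = a * p * c + (\<integral>y. e (Suc k) y * r y \<partial>Q k x)"
    using int by (simp add: c_def)
  also have "norm \<dots> \<le> a * s * norm c + (1 - a) * s"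
  proof (rule order_trans[OF norm_triangle_ineq add_mono])
    show "norm (a * p * c) \<le> a * s * norm c"
      using a_pos p by (auto simp: norm_mult intro!: mult_right_mono mult_left_mono)
    have "norm (\<integral>y. e (Suc k) y * r y \<partial>Q k x) \<le> (\<integral>y. norm (e (Suc k) y * r y) \<partial>Q k x)"
      by (rule integral_norm_bound)
    also have "\<dots> \<le> (\<integral>y. (1 - a) * s \<partial>Q k x)"
      using r e_norm x by (intro integral_mono integrable_norm int) (auto simp: norm_mult space_Q)
    finally show "norm (\<integral>y. e (Suc k) y * r y \<partial>Q k x) \<le> (1 - a) * s"
      using C.Q.prob_space by simp
  qed
  finally have le: "norm (step_char e (Suc (Suc j)) k x) \<le> a * s * norm c + (1 - a) * s" .
  \<comment> \<open>The inequality 2\<bar>c\<bar> \<le> 1 + \<bar>c\<bar>^2 replaces a square root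
    by a linear bound.\<close>
  have "norm c \<le> 1 - a / 2 * (1 - (norm (\<integral>x. e (Suc k) x \<partial>P (Suc k)))\<^sup>2)"
  proof -
    have "(norm c)\<^sup>2 \<le> 1 - a * (1 - (norm (\<integral>x. e (Suc k) x \<partial>P (Suc k)))\<^sup>2)"
      unfolding c_def by (rule C.norm_integral_unimodular_le) (auto simp: e_norm)
    moreover have "2 * norm c \<le> 1 + (norm c)\<^sup>2"
      using zero_le_power2[of "1 - norm c"] by (simp add: power2_diff)
    ultimately show ?thesis by (simp add: algebra_simps)
  qed
  then have "a * s * norm c \<le> a * s * (1 - a / 2 * (1 - (norm (\<integral>x. e (Suc k) x \<partial>P (Suc k)))\<^sup>2))"
    using a_pos s by (intro mult_left_mono) auto
  with le show ?thesis
    by (simp add: decay_def algebra_simps power2_eq_square del: step_char.simps)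
qed

lemma norm_step_char_le:
  "x \<in> space N \<Longrightarrow> norm (step_char e j k x) \<le> skip_prod decay j k"
proof (induction j arbitrary: k x rule: induct_nat_012)
  case (1 k)
  have "norm (QI k (\<lambda>y. e (Suc k) y * 1) x) \<le> 1"
    using 1 by (intro norm_QI_le_const) (auto simp: e_norm)
  then show ?case by simp
next
  case (ge2 j k)
  show ?case using norm_step_char_Suc_Suc[OF ge2(1) ge2(3)] by simp
qed simp

text \<open>A step without gain, which shifts the pairing by one.\<close>

lemma norm_step_char_mono:
  assumes bd: "\<And>y. y \<in> space N \<Longrightarrow> norm (step_char e j (Suc k) y) \<le> s" and x: "x \<in> space N"
  shows "norm (step_char e (Suc j) k x) \<le> s"
  using x bd by (auto intro!: norm_QI_le_const simp: norm_mult e_norm)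

text \<open>A single pairing gains only at every other index. Bounding the same quantity by both
  pairings and multiplying recovers all indices, at the price of a square on the left. The last
  index is missing because a gain requires a subsequent transition.\<close>

lemma norm_expectation_prod_le:
  "(norm (expectation (\<lambda>\<omega>. \<Prod>i\<in>{0<..Suc n}. e i (\<xi> i \<omega>))))\<^sup>2 \<le> (\<Prod>i\<in>{0<..n}. decay i)"
proof -
  define z where "z = norm (expectation (\<lambda>\<omega>. \<Prod>i\<in>{0<..Suc n}. e i (\<xi> i \<omega>)))"
  have *: "z \<le> s" if s: "\<And>x. x \<in> space N \<Longrightarrow> norm (step_char e (Suc n) 0 x) \<le> s" for s
  proof -
    have "z = norm (expectation (\<lambda>\<omega>. step_char e (Suc n) 0 (\<xi> 0 \<omega>)))"
      unfolding z_def by (subst expectation_step_char[of 0]) auto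
    also have "\<dots> \<le> expectation (\<lambda>\<omega>. norm (step_char e (Suc n) 0 (\<xi> 0 \<omega>)))"
      by (rule integral_norm_bound)
    also have "0 \<le> s" using s space_N_nonempty norm_ge_zero order_trans by blast
    then have "expectation (\<lambda>\<omega>. norm (step_char e (Suc n) 0 (\<xi> 0 \<omega>))) \<le> expectation (\<lambda>\<omega>. s)"
      using s[OF \<xi>_space] by (intro integral_mono integrable_norm integrable_const_bound[of _ s]) auto
    finally show ?thesis by (simp add: prob_space)
  qed
  have "z * z \<le> skip_prod decay (Suc n) 0 * skip_prod decay n (Suc 0)"
  proof (rule mult_mono)
    show "z \<le> skip_prod decay (Suc n) 0" by (rule *) (rule norm_step_char_le)
    show "z \<le> skip_prod decay n (Suc 0)" by (rule *) (intro norm_step_char_mono norm_step_char_le)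
  qed (auto simp: z_def intro!: skip_prod_nonneg decay_nonneg)
  then show ?thesis unfolding skip_prod_mult by (simp add: z_def power2_eq_square)
qed

text \<open>Taking the root halves the exponent a^2/2. The missing last term is restored by the
  factor exp 1, since its contribution to the exponent is at most 1.\<close>

lemma norm_expectation_prod_le_exp:
  "norm (expectation (\<lambda>\<omega>. \<Prod>i\<in>{0<..n}. e i (\<xi> i \<omega>)))
     \<le> exp 1 * exp (- (a\<^sup>2 / 4 * (\<Sum>i\<in>{0<..n}. 1 - (norm (\<integral>x. e i x \<partial>P i))\<^sup>2)))"
proof (cases n)
  case 0
  then show ?thesis using prob_space by simp
next
  case (Suc m)
  define d where "d i = 1 - (norm (\<integral>x. e i x \<partial>P i))\<^sup>2" for i
  define z where "z = norm (expectation (\<lambda>\<omega>. \<Prod>i\<in>{0<..n}. e i (\<xi> i \<omega>)))"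
  have "z\<^sup>2 \<le> (\<Prod>i\<in>{0<..m}. decay i)"
    unfolding z_def Suc by (rule norm_expectation_prod_le)
  also have "\<dots> \<le> (\<Prod>i\<in>{0<..m}. exp (- (a\<^sup>2 / 2 * d i)))"
    using exp_ge_add_one_self[of "- (a\<^sup>2 / 2 * d i)" for i] decay_nonneg
    by (intro prod_mono) (simp add: d_def decay_def)
  also have "\<dots> = exp (- (a\<^sup>2 / 2 * (\<Sum>i\<in>{0<..m}. d i)))"
    by (simp only: exp_sum[OF finite_greaterThanAtMost, symmetric] sum_negf sum_distrib_left)
  also have "\<dots> = exp (- (a\<^sup>2 / 4 * (\<Sum>i\<in>{0<..m}. d i))) ^ 2"
    by (simp add: power2_eq_square flip: exp_add)
  finally have "z \<le> exp (- (a\<^sup>2 / 4 * (\<Sum>i\<in>{0<..m}. d i)))"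
    by (rule power2_le_imp_le) simp
  also have "\<dots> \<le> exp (1 - a\<^sup>2 / 4 * (\<Sum>i\<in>{0<..n}. d i))"
  proof -
    have "{0<..n} = insert n {0<..m}" using Suc by auto
    then have "(\<Sum>i\<in>{0<..n}. d i) = d n + (\<Sum>i\<in>{0<..m}. d i)" using Suc by simp
    moreover have "a\<^sup>2 / 4 * d n \<le> 1 * 1"
      using a_pos norm_char_le_1[of n] power_le_one[OF _ a_le_1, of 2]
      by (intro mult_mono) (simp_all add: power_le_one d_def)
    ultimately show ?thesis by (simp add: algebra_simps)
  qed
  finally show ?thesis by (simp add: z_def d_def mult_exp_exp)
qed

end

end

section \<open>Correctors and the central limit theorem\<close>

text \<open>In the sum, the shifted terms are again at most the full sum because
  \<open>s n = 0\<close> and \<open>s 0 \<ge> 0\<close>; the contraction then leaves a fraction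
  \<open>a\<close> of it on the left. In the maximum, C/a is the fixed point of the recursion with
  constant input \<open>C\<close>.\<close>

lemma backward_contraction:
  fixes s c :: "nat \<Rightarrow> real"
  assumes "0 < a" "a \<le> 1" "s n = 0" "\<And>k. 0 \<le> s k" "\<And>k. k < n \<Longrightarrow> s k \<le> c k + (1 - a) * s (Suc k)"
  shows sum_backward_contraction: "a * (\<Sum>k<n. s k) \<le> (\<Sum>k<n. c k)"
    and backward_contraction_le: "(\<And>k. k < n \<Longrightarrow> c k \<le> C) \<Longrightarrow> 0 \<le> C \<Longrightarrow> k \<le> n \<Longrightarrow> s k \<le> C / a"
proof -
  have "(\<Sum>k<n. s k) \<le> (\<Sum>k<n. c k + (1 - a) * s (Suc k))"
    using assms by (intro sum_mono) auto
  also have "\<dots> = (\<Sum>k<n. c k) + (1 - a) * (\<Sum>k<n. s (Suc k))"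
    by (simp add: sum.distrib sum_distrib_left)
  also have "(\<Sum>k<n. s (Suc k)) = (\<Sum>k<n. s k) - s 0"
    using sum_lessThan_telescope[of s n] assms(3) by (simp add: sum_subtractf)
  also have "(1 - a) * ((\<Sum>k<n. s k) - s 0) \<le> (1 - a) * (\<Sum>k<n. s k)"
    using assms by (intro mult_left_mono) auto
  finally show "a * (\<Sum>k<n. s k) \<le> (\<Sum>k<n. c k)" by (simp add: algebra_simps)
next
  assume C: "\<And>k. k < n \<Longrightarrow> c k \<le> C" "0 \<le> C" and "k \<le> n"
  from \<open>k \<le> n\<close> show "s k \<le> C / a"
  proof (induction k rule: inc_induct)
    case base then show ?case using assms C by simp
  next
    case (step k)
    have "s k \<le> C + (1 - a) * (C / a)"
      using assms(5)[of k] C(1)[of k] step mult_left_mono[OF step.IH, of "1 - a"] assms(2) by auto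
    then show ?case using assms(1) by (simp add: field_simps)
  qed
qed

section \<open>Correctors by backward recursion\<close>

context comparable_chain begin

text \<open>The sum of the conditional expectations, given the state at time \<open>k\<close>, of
  the \<open>j\<close> terms w_k, w_(k+1), .... Counting the remaining steps instead of the time
  makes the backward recursion structural.\<close>

primrec corrector :: "(nat \<Rightarrow> 's \<Rightarrow> real) \<Rightarrow> nat \<Rightarrow> nat \<Rightarrow> 's \<Rightarrow> real" where
  "corrector w 0 k = (\<lambda>x. 0)"
| "corrector w (Suc j) k = (\<lambda>x. w k x + QI k (corrector w j (Suc k)) x)"

primrec corrector_bound :: "(nat \<Rightarrow> real) \<Rightarrow> nat \<Rightarrow> nat \<Rightarrow> real" where
  "corrector_bound W 0 k = 0"
| "corrector_bound W (Suc j) k = W k + (1 - a) * corrector_bound W j (Suc k)"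

text \<open>A mean-zero forcing keeps the corrector at mean zero, so every transition contracts it
  by 1 - a, and the bounds \<open>p\<close> obey a linear recursion with this rate. The lemma serves
  twice: for the martingale corrector, through the quadratic and uniform bounds, and for the
  variance fluctuations, through the linear and uniform ones.\<close>

lemma corrector_exists:
  assumes w[measurable]: "\<And>k. w k \<in> borel_measurable N"
    and wW: "\<And>k x. k < n \<Longrightarrow> x \<in> space N \<Longrightarrow> \<bar>w k x\<bar> \<le> W k"
    and w_mean: "\<And>k. k < n \<Longrightarrow> (\<integral>x. w k x \<partial>P k) = 0"
    and W: "\<And>k. 0 \<le> W k"
  obtains \<Psi> :: "nat \<Rightarrow> 's \<Rightarrow> real" and p :: "nat \<Rightarrow> real" where
    "\<And>k. \<Psi> k \<in> borel_measurable N" "\<And>x. \<Psi> n x = 0"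
    "\<And>k x. k < n \<Longrightarrow> \<Psi> k x = w k x + QI k (\<Psi> (Suc k)) x"
    "\<And>k x. k \<le> n \<Longrightarrow> x \<in> space N \<Longrightarrow> \<bar>\<Psi> k x\<bar> \<le> p k"
    "\<And>k. k \<le> n \<Longrightarrow> (\<integral>x. \<Psi> k x \<partial>P k) = 0"
    "p n = 0" "\<And>k. 0 \<le> p k"
    "a * (\<Sum>k<n. p k) \<le> (\<Sum>k<n. W k)"
    "a\<^sup>2 * (\<Sum>k<n. (p k)\<^sup>2) \<le> (\<Sum>k<n. (W k)\<^sup>2)"
    "\<And>C. \<forall>k<n. W k \<le> C \<Longrightarrow> 0 \<le> C \<Longrightarrow> \<forall>k\<le>n. p k \<le> C / a"
proof -
  define \<Psi> where "\<Psi> k = corrector w (n - k) k" for k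
  define p where "p k = corrector_bound W (n - k) k" for k
  have \<Psi>_meas[measurable]: "\<Psi> k \<in> borel_measurable N" for k
  proof -
    have "corrector w j k \<in> borel_measurable N" for j
      by (induction j arbitrary: k) simp_all
    then show ?thesis by (simp add: \<Psi>_def)
  qed
  have \<Psi>n: "\<Psi> n x = 0" for x by (simp add: \<Psi>_def)
  have pn: "p n = 0" by (simp add: p_def)
  have Suc: "n - k = Suc (n - Suc k)" if "k < n" for k using that by simp
  have \<Psi>_step: "\<Psi> k x = w k x + QI k (\<Psi> (Suc k)) x" if "k < n" for k x
    unfolding \<Psi>_def Suc[OF that] by simp
  have p_step: "p k = W k + (1 - a) * p (Suc k)" if "k < n" for k
    unfolding p_def Suc[OF that] by simp
  have p: "0 \<le> p k" for k
  proof -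
    have "0 \<le> corrector_bound W j k" for j
      using W a_le_1 by (induction j arbitrary: k) simp_all
    then show ?thesis by (simp add: p_def)
  qed
  have *: "(\<forall>x\<in>space N. \<bar>\<Psi> k x\<bar> \<le> p k) \<and> (\<integral>x. \<Psi> k x \<partial>P k) = 0" if "k \<le> n" for k
    using that
  proof (induction k rule: inc_induct)
    case (step k)
    have "\<bar>QI k (\<Psi> (Suc k)) x\<bar> \<le> (1 - a) * p (Suc k)" if "x \<in> space N" for x
      using comparable_prob.abs_integral_mean_zero_le[OF comparable_prob[OF that], of "\<Psi> (Suc k)" k "p (Suc k)"] step.IH
      by (simp add: QI_def)
    then have "\<bar>\<Psi> k x\<bar> \<le> p k" if "x \<in> space N" for x
      unfolding \<Psi>_step[OF step(2)] p_step[OF step(2)]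
      using wW[OF step(2) that] that by (intro order_trans[OF abs_triangle_ineq] add_mono) auto
    moreover have "(\<integral>x. \<Psi> k x \<partial>P k) = 0"
    proof -
      have i: "integrable (P (Suc k)) (\<Psi> (Suc k))"
        using step.IH by (intro integrable_P_bounded[of _ "p (Suc k)"]) auto
      have "integrable (P k) (w k)"
        using wW[OF step(2)] by (intro integrable_P_bounded[of _ "W k"]) auto
      then show ?thesis
        using QI_mean[OF i] step.IH w_mean[OF step(2)] by (simp add: \<Psi>_step[OF step(2)])
    qed
    ultimately show ?case by auto
  qed (simp add: \<Psi>n pn)
  have sum_p: "a * (\<Sum>k<n. p k) \<le> (\<Sum>k<n. W k)"
    using a_pos a_le_1 pn p p_step by (intro sum_backward_contraction) auto
  have max_p: "\<forall>k\<le>n. p k \<le> C / a" if "\<forall>k<n. W k \<le> C" "0 \<le> C" for C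
    using a_pos a_le_1 pn p p_step that by (auto intro!: backward_contraction_le[of a p n W])
  have "a * (\<Sum>k<n. (p k)\<^sup>2) \<le> (\<Sum>k<n. (W k)\<^sup>2 / a)"
  proof (rule sum_backward_contraction)
    fix k assume "k < n"
    \<comment> \<open>Convexity of the square with weights \<open>a\<close> and
      \<open>1 - a\<close>, applied to \<open>p k\<close> as the mean of \<open>W k / a\<close> and
      \<open>p (Suc k)\<close>; the right side is the exact convexity defect.\<close>
    have "(W k)\<^sup>2 / a + (1 - a) * (p (Suc k))\<^sup>2 - (p k)\<^sup>2 = (1 - a) / a * (W k - a * p (Suc k))\<^sup>2"
      unfolding p_step[OF \<open>k < n\<close>] using a_pos by (simp add: field_simps power2_eq_square)
    also have "\<dots> \<ge> 0" using a_pos a_le_1 by simp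
    finally show "(p k)\<^sup>2 \<le> (W k)\<^sup>2 / a + (1 - a) * (p (Suc k))\<^sup>2" by simp
  qed (use a_pos a_le_1 pn in auto)
  then have sum_p2: "a\<^sup>2 * (\<Sum>k<n. (p k)\<^sup>2) \<le> (\<Sum>k<n. (W k)\<^sup>2)"
    using a_pos by (simp add: sum_divide_distrib[symmetric] field_simps power2_eq_square)
  show thesis
    using * by (intro that[of \<Psi> p] \<Psi>_meas \<Psi>n \<Psi>_step pn p sum_p sum_p2 max_p) auto
qed

end

section \<open>Moment and exponential estimates\<close>

lemma (in prob_space) abs_expectation_le_sqrt:
  fixes f :: "'a \<Rightarrow> real"
  assumes [measurable]: "f \<in> borel_measurable M" and i: "integrable M (\<lambda>x. (f x)\<^sup>2)"
  shows "integrable M f" "expectation (\<lambda>x. \<bar>f x\<bar>) \<le> sqrt (expectation (\<lambda>x. (f x)\<^sup>2))"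
proof -
  show f: "integrable M f"
    by (rule square_integrable_imp_integrable[OF assms])
  have "variance (\<lambda>x. \<bar>f x\<bar>) = expectation (\<lambda>x. \<bar>f x\<bar>\<^sup>2) - (expectation (\<lambda>x. \<bar>f x\<bar>))\<^sup>2"
    using f i by (intro variance_eq) auto
  moreover have "0 \<le> variance (\<lambda>x. \<bar>f x\<bar>)" by (rule variance_positive)
  ultimately have "(expectation (\<lambda>x. \<bar>f x\<bar>))\<^sup>2 \<le> expectation (\<lambda>x. (f x)\<^sup>2)" by simp
  then show "expectation (\<lambda>x. \<bar>f x\<bar>) \<le> sqrt (expectation (\<lambda>x. (f x)\<^sup>2))"
    by (rule real_le_rsqrt)
qed

lemma integrable_square_add:
  fixes f g :: "'a \<Rightarrow> real"
  assumes [measurable]: "f \<in> borel_measurable M" "g \<in> borel_measurable M"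
    and f: "integrable M (\<lambda>x. (f x)\<^sup>2)" and g: "integrable M (\<lambda>x. (g x)\<^sup>2)"
  shows "integrable M (\<lambda>x. f x * g x)" "integrable M (\<lambda>x. (f x + g x)\<^sup>2)"
proof -
  have fg: "integrable M (\<lambda>x. (f x)\<^sup>2 + (g x)\<^sup>2)" using f g by simp
  have le: "\<bar>x * y\<bar> \<le> x\<^sup>2 + y\<^sup>2" for x y :: real
    using zero_le_power2[of "\<bar>x\<bar> - \<bar>y\<bar>"] mult_nonneg_nonneg[OF abs_ge_zero abs_ge_zero, of x y]
    unfolding power2_diff abs_mult power2_abs by linarith
  show i: "integrable M (\<lambda>x. f x * g x)"
    using le by (intro Bochner_Integration.integrable_bound[OF fg]) auto
  then show "integrable M (\<lambda>x. (f x + g x)\<^sup>2)"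
    using f g by (simp add: power2_sum mult.assoc)
qed

lemma exp_neg_approx: "0 \<le> y \<Longrightarrow> \<bar>exp (- y) - 1 + y\<bar> \<le> y\<^sup>2 / 2" for y :: real
proof -
  assume y: "0 \<le> y"
  have "exp (- y) \<le> 1 - y + y\<^sup>2 / 2"
  proof -
    define D where "D z = 1 - z + z\<^sup>2 / 2 - exp (- z)" for z :: real
    have "D 0 \<le> D y"
    proof (rule DERIV_nonneg_imp_nondecreasing[OF y])
      fix z :: real
      have "DERIV D z :> -1 + z + exp (- z)"
        unfolding D_def by (auto intro!: derivative_eq_intros)
      moreover have "0 \<le> -1 + z + exp (- z)"
        using exp_ge_add_one_self[of "- z"] by simp
      ultimately show "\<exists>d. DERIV D z :> d \<and> 0 \<le> d" by blast
    qed
    then show ?thesis by (simp add: D_def)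
  qed
  moreover have "1 - y \<le> exp (- y)" using exp_ge_add_one_self[of "- y"] by simp
  ultimately show ?thesis by (simp add: abs_le_iff)
qed

text \<open>The quadratic bound serves where a summand is large, where Lindeberg's condition takes
  over; the cubic one serves elsewhere.\<close>

lemma iexp_second_order:
  "norm (iexp z - (1 + \<i> * z - z\<^sup>2 / 2)) \<le> z\<^sup>2"
  "norm (iexp z - (1 + \<i> * z - z\<^sup>2 / 2)) \<le> \<bar>z\<bar> ^ 3"
proof -
  have eq: "(\<Sum>k\<le>2. (\<i> * complex_of_real z) ^ k / fact k) = 1 + \<i> * z - z\<^sup>2 / 2"
    by (simp add: numeral_2_eq_2 mult_ac)
  show "norm (iexp z - (1 + \<i> * z - z\<^sup>2 / 2)) \<le> z\<^sup>2"
    using iexp_approx2[of z 2] unfolding eq by (simp add: power2_eq_square)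
  have "norm (iexp z - (1 + \<i> * z - z\<^sup>2 / 2)) \<le> \<bar>z\<bar> ^ 3 / fact 3"
    using iexp_approx1[of z 2] unfolding eq by (simp add: numeral_3_eq_3)
  also have "\<dots> \<le> \<bar>z\<bar> ^ 3" by (simp add: fact_numeral)
  finally show "norm (iexp z - (1 + \<i> * z - z\<^sup>2 / 2)) \<le> \<bar>z\<bar> ^ 3" .
qed

section \<open>Martingale decomposition of the partial sums\<close>

locale centered_chain = comparable_chain +
  fixes x0 and g :: "nat \<Rightarrow> 'b \<Rightarrow> real"
  assumes \<xi>_0: "\<And>\<omega>. \<omega> \<in> space M \<Longrightarrow> \<xi> 0 \<omega> = x0"
    and g_measurable[measurable]: "\<And>k. g k \<in> borel_measurable N"
    and g_square: "\<And>k. integrable (P k) (\<lambda>x. (g k x)\<^sup>2)"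
    and g_mean: "\<And>k. (\<integral>x. g k x \<partial>P k) = 0"
begin

definition \<rho> :: "nat \<Rightarrow> real" where "\<rho> k = sqrt (\<integral>x. (g k x)\<^sup>2 \<partial>P k)"

definition S :: "nat \<Rightarrow> 'a \<Rightarrow> real" where "S k \<omega> = (\<Sum>i\<in>{0<..k}. g i (\<xi> i \<omega>))"

lemma \<rho>_nonneg: "0 \<le> \<rho> k" by (simp add: \<rho>_def)

lemma \<rho>_square: "(\<rho> k)\<^sup>2 = (\<integral>x. (g k x)\<^sup>2 \<partial>P k)" by (simp add: \<rho>_def)

lemma S_Suc: "S (Suc k) \<omega> = S k \<omega> + g (Suc k) (\<xi> (Suc k) \<omega>)"
proof -
  have "{0<..Suc k} = insert (Suc k) {0<..k}" by auto
  then show ?thesis by (simp add: S_def)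
qed

lemma S_adapted: "S k \<in> borel_measurable (F k)"
  unfolding S_def[abs_def]
  by (intro borel_measurable_sum measurable_compose[OF adapted_le g_measurable]) auto

lemma S_measurable[measurable]: "S k \<in> borel_measurable M"
  using S_adapted by (rule F_measurable)

lemma S_square: "integrable M (\<lambda>\<omega>. (S k \<omega>)\<^sup>2)"
proof (induction k)
  case (Suc k)
  then show ?case unfolding S_Suc
    using integrable_distr[OF \<xi>_measurable g_square]
    by (intro integrable_square_add) auto
qed (simp add: S_def)

lemma g_integrable: "integrable (P k) (g k)" "(\<integral>x. \<bar>g k x\<bar> \<partial>P k) \<le> \<rho> k"
proof -
  interpret Pk: prob_space "P k" by (rule prob_space_distr) simp
  show "integrable (P k) (g k)" "(\<integral>x. \<bar>g k x\<bar> \<partial>P k) \<le> \<rho> k"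
    unfolding \<rho>_def by (rule Pk.abs_expectation_le_sqrt; simp add: g_square)+
qed

end

text \<open>The horizon \<open>n\<close> is fixed. Since \<theta> vanishes at time \<open>n\<close>,
  the martingale ends exactly at \<open>S n\<close> and no boundary error arises. The deterministic
  numbers \<open>m k\<close> bound the correctors at every state.\<close>

locale corrected_chain = centered_chain +
  fixes n :: nat and \<theta> :: "nat \<Rightarrow> 'b \<Rightarrow> real" and m :: "nat \<Rightarrow> real"
  assumes \<theta>_measurable[measurable]: "\<And>k. \<theta> k \<in> borel_measurable N"
    and \<theta>_n: "\<And>x. \<theta> n x = 0"
    and \<theta>_step: "\<And>k x. k < n \<Longrightarrow> x \<in> space N \<Longrightarrow> \<theta> k x = QI k (\<lambda>y. g (Suc k) y + \<theta> (Suc k) y) x"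
    and \<theta>_bound: "\<And>k x. k \<le> n \<Longrightarrow> x \<in> space N \<Longrightarrow> \<bar>\<theta> k x\<bar> \<le> m k"
    and \<theta>_mean: "\<And>k. k \<le> n \<Longrightarrow> (\<integral>x. \<theta> k x \<partial>P k) = 0"
    and m_n: "m n = 0"
    and m_nonneg: "\<And>k. 0 \<le> m k"
begin

text \<open>The increment of the martingale from time \<open>k\<close> to \<open>Suc k\<close> is
  \<open>u (Suc k)\<close> at the new state minus \<open>\<theta> k\<close> at the old one.\<close>

definition u where "u k x = g k x + \<theta> k x"

lemma u_measurable[measurable]: "u k \<in> borel_measurable N"
  unfolding u_def[abs_def] by measurable

lemma \<theta>_integrable: "k \<le> n \<Longrightarrow> integrable (P k) (\<theta> k)"
  and \<theta>_square: "k \<le> n \<Longrightarrow> integrable (P k) (\<lambda>x. (\<theta> k x)\<^sup>2)"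
proof -
  assume k: "k \<le> n"
  show "integrable (P k) (\<theta> k)"
    by (rule integrable_P_bounded[of _ "m k"]) (simp_all add: \<theta>_bound[OF k])
  have "norm ((\<theta> k x)\<^sup>2) \<le> (m k)\<^sup>2" if "x \<in> space N" for x
    using power_mono[OF \<theta>_bound[OF k that], of 2] by simp
  then show "integrable (P k) (\<lambda>x. (\<theta> k x)\<^sup>2)"
    by (rule integrable_P_bounded[rotated]) measurable
qed

lemma u_integrable: "k \<le> n \<Longrightarrow> integrable (P k) (u k)"
  unfolding u_def[abs_def] using g_integrable \<theta>_integrable by auto

lemma u_square: "k \<le> n \<Longrightarrow> integrable (P k) (\<lambda>x. (u k x)\<^sup>2)"
  unfolding u_def by (intro integrable_square_add(2) g_square \<theta>_square) measurable

lemma u_mean: "k \<le> n \<Longrightarrow> (\<integral>x. u k x \<partial>P k) = 0"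
  unfolding u_def by (simp add: g_integrable(1) \<theta>_integrable \<theta>_mean g_mean)

lemma QI_u: "k < n \<Longrightarrow> x \<in> space N \<Longrightarrow> QI k (u (Suc k)) x = \<theta> k x"
  using \<theta>_step[of k x] by (simp add: u_def[abs_def])

definition u_moment where "u_moment k = (\<integral>x. (u k x)\<^sup>2 \<partial>P k)"

lemma u_moment_nonneg: "0 \<le> u_moment k" by (simp add: u_moment_def)

lemma u_moment_le: "k \<le> n \<Longrightarrow> u_moment k \<le> 2 * (\<rho> k)\<^sup>2 + 2 * (m k)\<^sup>2"
proof -
  assume k: "k \<le> n"
  interpret Pk: prob_space "P k" by (rule prob_space_distr) simp
  have "u_moment k \<le> (\<integral>x. 2 * (g k x)\<^sup>2 + 2 * (m k)\<^sup>2 \<partial>P k)"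
    unfolding u_moment_def
  proof (rule integral_mono)
    fix x assume "x \<in> space (P k)"
    then have "(\<theta> k x)\<^sup>2 \<le> (m k)\<^sup>2" using power_mono[OF \<theta>_bound[OF k, of x], of 2] by simp
    moreover have "(u k x)\<^sup>2 \<le> 2 * (g k x)\<^sup>2 + 2 * (\<theta> k x)\<^sup>2"
      using zero_le_power2[of "g k x - \<theta> k x"] unfolding u_def by (simp add: power2_eq_square algebra_simps)
    ultimately show "(u k x)\<^sup>2 \<le> 2 * (g k x)\<^sup>2 + 2 * (m k)\<^sup>2" by simp
  qed (use u_square[OF k] g_square in auto)
  also have "\<dots> = 2 * (\<rho> k)\<^sup>2 + 2 * (m k)\<^sup>2"
    using g_square Pk.prob_space by (simp add: \<rho>_square)
  finally show ?thesis .
qed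

text \<open>By the corrector equation, \<open>\<theta> k x\<close> is the mean of
  \<open>u (Suc k)\<close> under the kernel, so this is second moment minus squared mean of the
  martingale increment.\<close>

definition cond_var where "cond_var k x = QI k (\<lambda>y. (u (Suc k) y)\<^sup>2) x - (\<theta> k x)\<^sup>2"

lemma cond_var_measurable[measurable]: "cond_var k \<in> borel_measurable N"
  unfolding cond_var_def[abs_def] by measurable

lemma Q_u:
  assumes "k < n" "x \<in> space N"
  shows "integrable (Q k x) (u (Suc k))" "integrable (Q k x) (\<lambda>y. (u (Suc k) y)\<^sup>2)"
  using assms by (intro integrable_Q u_integrable u_square; simp)+

lemma cond_var_eq:
  assumes k: "k < n" and x: "x \<in> space N"
  shows "cond_var k x = (\<integral>y. (u (Suc k) y - \<theta> k x)\<^sup>2 \<partial>Q k x)"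
    "integrable (Q k x) (\<lambda>y. (u (Suc k) y - \<theta> k x)\<^sup>2)"
proof -
  interpret C: comparable_prob "P (Suc k)" "Q k x" a b by (rule comparable_prob) fact
  have eq: "(u (Suc k) y - \<theta> k x)\<^sup>2 = (u (Suc k) y)\<^sup>2 - 2 * \<theta> k x * u (Suc k) y + (\<theta> k x)\<^sup>2" for y
    by (simp add: power2_diff)
  show "integrable (Q k x) (\<lambda>y. (u (Suc k) y - \<theta> k x)\<^sup>2)"
    unfolding eq by (intro Bochner_Integration.integrable_add Bochner_Integration.integrable_diff
        integrable_mult_right Q_u[OF assms] C.Q.integrable_const)
  have "(\<integral>y. (u (Suc k) y - \<theta> k x)\<^sup>2 \<partial>Q k x)
    = (\<integral>y. (u (Suc k) y)\<^sup>2 \<partial>Q k x) - 2 * \<theta> k x * (\<integral>y. u (Suc k) y \<partial>Q k x) + (\<theta> k x)\<^sup>2"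
    unfolding eq using Q_u[OF assms] by (simp add: C.Q.prob_space)
  also have "\<dots> = cond_var k x"
    using QI_u[OF assms] unfolding cond_var_def QI_def by (simp add: power2_eq_square)
  finally show "cond_var k x = (\<integral>y. (u (Suc k) y - \<theta> k x)\<^sup>2 \<partial>Q k x)" ..
qed

text \<open>For the lower bound the kernel is replaced by \<open>a\<close> times the marginal; there
  \<open>u\<close> has mean zero, so its second moment about \<open>\<theta> k x\<close> is at least
  the one about 0. For the upper bound the squared mean is dropped.\<close>

lemma cond_var_bounds:
  assumes k: "k < n" and x: "x \<in> space N"
  shows "0 \<le> cond_var k x" "a * u_moment (Suc k) \<le> cond_var k x" "cond_var k x \<le> b * u_moment (Suc k)"
proof -
  interpret C: comparable_prob "P (Suc k)" "Q k x" a b by (rule comparable_prob) fact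
  have k': "Suc k \<le> n" using k by simp
  have i: "integrable (P (Suc k)) (\<lambda>y. (u (Suc k) y - \<theta> k x)\<^sup>2)"
    unfolding power2_diff using u_integrable[OF k'] u_square[OF k'] by simp
  have "(\<integral>y. (u (Suc k) y - \<theta> k x)\<^sup>2 \<partial>P (Suc k)) = u_moment (Suc k) + (\<theta> k x)\<^sup>2"
    unfolding power2_diff u_moment_def using u_integrable[OF k'] u_square[OF k'] u_mean[OF k'] C.P.prob_space by simp
  then have "a * u_moment (Suc k) \<le> a * (\<integral>y. (u (Suc k) y - \<theta> k x)\<^sup>2 \<partial>P (Suc k))"
    using a_pos by simp
  also have "\<dots> \<le> cond_var k x"
    unfolding cond_var_eq[OF assms] by (rule C.integral_lower[OF i]) simp
  finally show "a * u_moment (Suc k) \<le> cond_var k x" .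
  then show "0 \<le> cond_var k x" using mult_nonneg_nonneg[OF less_imp_le[OF a_pos] u_moment_nonneg] by (rule order_trans[rotated])
  have "cond_var k x \<le> QI k (\<lambda>y. (u (Suc k) y)\<^sup>2) x" by (simp add: cond_var_def)
  also have "\<dots> \<le> b * u_moment (Suc k)"
    unfolding QI_def u_moment_def using u_square[OF k'] by (intro C.integral_upper) auto
  finally show "cond_var k x \<le> b * u_moment (Suc k)" .
qed

definition mean_var where "mean_var k = (\<integral>x. cond_var k x \<partial>P k)"

lemma cond_var_integrable: "k < n \<Longrightarrow> integrable (P k) (cond_var k)"
proof -
  assume k: "k < n"
  have "norm (cond_var k x) \<le> b * u_moment (Suc k)" if "x \<in> space N" for x
    using cond_var_bounds(1,3)[OF k that] by simp
  then show ?thesis by (rule integrable_P_bounded[rotated]) measurable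
qed

lemma mean_var_bounds:
  assumes k: "k < n"
  shows "0 \<le> mean_var k" "a * u_moment (Suc k) \<le> mean_var k" "mean_var k \<le> b * u_moment (Suc k)"
proof -
  interpret Pk: prob_space "P k" by (rule prob_space_distr) simp
  show "0 \<le> mean_var k" "a * u_moment (Suc k) \<le> mean_var k"
    unfolding mean_var_def using cond_var_bounds[OF k]
    by (intro Pk.integral_ge_const cond_var_integrable[OF k] AE_I2; simp)+
  show "mean_var k \<le> b * u_moment (Suc k)"
    unfolding mean_var_def using cond_var_bounds[OF k]
    by (intro Pk.integral_le_const cond_var_integrable[OF k] AE_I2; simp)
qed

text \<open>The state at time 0 is constant, so a corrector of mean zero vanishes there; the
  martingale starts at 0.\<close>

lemma \<theta>_0: "\<omega> \<in> space M \<Longrightarrow> \<theta> 0 (\<xi> 0 \<omega>) = 0"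
proof -
  assume \<omega>: "\<omega> \<in> space M"
  have "0 = expectation (\<lambda>\<omega>. \<theta> 0 (\<xi> 0 \<omega>))"
    using \<theta>_mean[of 0] by (simp add: integral_distr)
  also have "\<dots> = expectation (\<lambda>\<omega>. \<theta> 0 x0)"
    by (intro Bochner_Integration.integral_cong) (auto simp: \<xi>_0)
  finally show ?thesis using \<omega> by (simp add: prob_space \<xi>_0)
qed

text \<open>Orthogonality of martingale increments, carried out one transition at a time; the cross
  term is evaluated by conditioning on the past.\<close>

lemma variance_S: "expectation (\<lambda>\<omega>. (S n \<omega>)\<^sup>2) = (\<Sum>k<n. mean_var k)"
proof -
  have "expectation (\<lambda>\<omega>. (S k \<omega> + \<theta> k (\<xi> k \<omega>))\<^sup>2) = (\<Sum>j<k. mean_var j)" if "k \<le> n" for k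
    using that
  proof (induction k)
    case 0
    have "expectation (\<lambda>\<omega>. (S 0 \<omega> + \<theta> 0 (\<xi> 0 \<omega>))\<^sup>2) = expectation (\<lambda>\<omega>. 0)"
      by (intro Bochner_Integration.integral_cong) (auto simp: \<theta>_0 S_def)
    then show ?case by simp
  next
    case (Suc k)
    then have k: "k < n" "k \<le> n" by auto
    have \<theta>2: "integrable M (\<lambda>\<omega>. (\<theta> k (\<xi> k \<omega>))\<^sup>2)"
      using integrable_distr[OF \<xi>_measurable \<theta>_square[OF k(2)]] .
    have u2: "integrable M (\<lambda>\<omega>. (u (Suc k) (\<xi> (Suc k) \<omega>))\<^sup>2)"
      using integrable_distr[OF \<xi>_measurable u_square[OF Suc.prems]] .
    have S\<theta>: "integrable M (\<lambda>\<omega>. S k \<omega> * \<theta> k (\<xi> k \<omega>))"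
      by (intro integrable_square_add S_square \<theta>2) measurable
    have Su: "integrable M (\<lambda>\<omega>. S k \<omega> * u (Suc k) (\<xi> (Suc k) \<omega>))"
      by (intro integrable_square_add S_square u2) measurable
    have "expectation (\<lambda>\<omega>. (S (Suc k) \<omega> + \<theta> (Suc k) (\<xi> (Suc k) \<omega>))\<^sup>2)
      = expectation (\<lambda>\<omega>. (S k \<omega>)\<^sup>2 + (u (Suc k) (\<xi> (Suc k) \<omega>))\<^sup>2 + 2 * (S k \<omega> * u (Suc k) (\<xi> (Suc k) \<omega>)))"
      by (intro Bochner_Integration.integral_cong) (auto simp: S_Suc u_def power2_eq_square algebra_simps)
    also have "\<dots> = expectation (\<lambda>\<omega>. (S k \<omega>)\<^sup>2) + u_moment (Suc k)
        + 2 * expectation (\<lambda>\<omega>. S k \<omega> * u (Suc k) (\<xi> (Suc k) \<omega>))"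
      using S_square u2 Su by (simp add: u_moment_def integral_distr)
    also have "expectation (\<lambda>\<omega>. S k \<omega> * u (Suc k) (\<xi> (Suc k) \<omega>)) = expectation (\<lambda>\<omega>. S k \<omega> * QI k (u (Suc k)) (\<xi> k \<omega>))"
      by (rule real_transition(2)[OF u_integrable[OF Suc.prems] S_adapted Su])
    also have "\<dots> = expectation (\<lambda>\<omega>. S k \<omega> * \<theta> k (\<xi> k \<omega>))"
      using \<xi>_space by (intro Bochner_Integration.integral_cong) (auto simp: QI_u[OF k(1)])
    finally have *: "expectation (\<lambda>\<omega>. (S (Suc k) \<omega> + \<theta> (Suc k) (\<xi> (Suc k) \<omega>))\<^sup>2) =
      expectation (\<lambda>\<omega>. (S k \<omega>)\<^sup>2) + u_moment (Suc k) + 2 * expectation (\<lambda>\<omega>. S k \<omega> * \<theta> k (\<xi> k \<omega>))" .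
    have "mean_var k = u_moment (Suc k) - (\<integral>x. (\<theta> k x)\<^sup>2 \<partial>P k)"
      unfolding mean_var_def cond_var_def u_moment_def using QI_mean[OF u_square[OF Suc.prems]] \<theta>_square[OF k(2)] by simp
    moreover have "expectation (\<lambda>\<omega>. (S k \<omega> + \<theta> k (\<xi> k \<omega>))\<^sup>2)
       = expectation (\<lambda>\<omega>. (S k \<omega>)\<^sup>2) + (\<integral>x. (\<theta> k x)\<^sup>2 \<partial>P k) + 2 * expectation (\<lambda>\<omega>. S k \<omega> * \<theta> k (\<xi> k \<omega>))"
      unfolding power2_sum using S_square \<theta>2 S\<theta> by (simp add: integral_distr mult.assoc)
    ultimately show ?case using Suc k * by simp
  qed
  from this[of n] show ?thesis by (simp add: \<theta>_n)
qed

text \<open>This direction excludes cancellation. Write g as u - \<theta>; nonnegativity of the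
  conditional variance bounds \<theta>^2 by the conditional second moment of the next
  \<open>u\<close>, so the marginal second moment of \<theta> is at most the next
  \<open>u_moment\<close>. Summation then counts each \<open>u_moment\<close> at most four
  times.\<close>

lemma sum_\<rho>_le: "(\<Sum>k<n. (\<rho> (Suc k))\<^sup>2) \<le> 4 * (\<Sum>k<n. u_moment (Suc k))"
proof -
  \<comment> \<open>Cut off at the horizon, where \<theta> vanishes and no further \<open>u\<close>
    is available.\<close>
  define U where "U k = (if k < n then u_moment (Suc k) else 0)" for k
  have "(\<rho> (Suc k))\<^sup>2 \<le> 2 * U k + 2 * U (Suc k)" if k: "k < n" for k
  proof -
    have k': "Suc k \<le> n" using k by simp
    have i: "integrable (P (Suc k)) (\<lambda>x. (u (Suc k) x)\<^sup>2)" "integrable (P (Suc k)) (\<lambda>x. (\<theta> (Suc k) x)\<^sup>2)"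
      using u_square[OF k'] \<theta>_square[OF k'] by auto
    have "(g (Suc k) x)\<^sup>2 \<le> 2 * (u (Suc k) x)\<^sup>2 + 2 * (\<theta> (Suc k) x)\<^sup>2" for x
      using zero_le_power2[of "u (Suc k) x + \<theta> (Suc k) x"] unfolding u_def by (simp add: power2_eq_square algebra_simps)
    then have "(\<rho> (Suc k))\<^sup>2 \<le> (\<integral>x. 2 * (u (Suc k) x)\<^sup>2 + 2 * (\<theta> (Suc k) x)\<^sup>2 \<partial>P (Suc k))"
      unfolding \<rho>_square using g_square i by (intro integral_mono) auto
    also have "\<dots> = 2 * U k + 2 * (\<integral>x. (\<theta> (Suc k) x)\<^sup>2 \<partial>P (Suc k))"
      using i k by (simp add: U_def u_moment_def)
    also have "(\<integral>x. (\<theta> (Suc k) x)\<^sup>2 \<partial>P (Suc k)) \<le> U (Suc k)"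
    proof (cases "Suc k < n")
      case True
      have "(\<theta> (Suc k) x)\<^sup>2 \<le> QI (Suc k) (\<lambda>y. (u (Suc (Suc k)) y)\<^sup>2) x" if "x \<in> space N" for x
        using cond_var_bounds(1)[OF True that] by (simp add: cond_var_def)
      then have "(\<integral>x. (\<theta> (Suc k) x)\<^sup>2 \<partial>P (Suc k)) \<le> (\<integral>x. QI (Suc k) (\<lambda>y. (u (Suc (Suc k)) y)\<^sup>2) x \<partial>P (Suc k))"
        using i True QI_mean(2)[OF u_square[of "Suc (Suc k)"]] by (intro integral_mono) auto
      also have "\<dots> = U (Suc k)"
        using True QI_mean(1)[OF u_square[of "Suc (Suc k)"]] by (simp add: U_def u_moment_def)
      finally show ?thesis .
    next
      case False
      then have "Suc k = n" using k by simp
      then show ?thesis by (simp add: \<theta>_n U_def)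
    qed
    finally show ?thesis by simp
  qed
  then have "(\<Sum>k<n. (\<rho> (Suc k))\<^sup>2) \<le> (\<Sum>k<n. 2 * U k + 2 * U (Suc k))"
    by (intro sum_mono) auto
  also have "\<dots> = 2 * (\<Sum>k<n. U k) + 2 * (\<Sum>k<n. U (Suc k))"
    by (simp add: sum.distrib sum_distrib_left)
  also have "(\<Sum>k<n. U (Suc k)) = (\<Sum>k<n. U k) - U 0"
    using sum_lessThan_telescope[of U n] by (simp add: sum_subtractf U_def)
  also have "0 \<le> U 0" by (simp add: U_def u_moment_nonneg)
  then have "2 * (\<Sum>k<n. U k) + 2 * ((\<Sum>k<n. U k) - U 0) \<le> 4 * (\<Sum>k<n. U k)" by simp
  also have "(\<Sum>k<n. U k) = (\<Sum>k<n. u_moment (Suc k))" by (simp add: U_def)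
  finally show ?thesis .
qed

end

section \<open>Gaussian approximation of the characteristic function\<close>

context corrected_chain begin

definition Z :: "real \<Rightarrow> nat \<Rightarrow> 'a \<Rightarrow> complex" where
  "Z t k \<omega> = iexp (t * (S k \<omega> + \<theta> k (\<xi> k \<omega>)))"

lemma norm_Z[simp]: "norm (Z t k \<omega>) = 1"
  by (simp add: Z_def)

lemma Z_adapted: "Z t k \<in> borel_measurable (F k)"
proof -
  note [measurable] = S_adapted adapted
  show ?thesis unfolding Z_def[abs_def] by measurable
qed

lemma Z_measurable[measurable]: "Z t k \<in> borel_measurable M"
  using Z_adapted by (rule F_measurable)

text \<open>The characteristic function of the next martingale increment, given the state at time
  \<open>k\<close>.\<close>

definition cond_char :: "real \<Rightarrow> nat \<Rightarrow> 'b \<Rightarrow> complex" where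
  "cond_char t k x = (\<integral>y. iexp (t * (u (Suc k) y - \<theta> k x)) \<partial>Q k x)"

lemma cond_char_eq: "cond_char t k x = iexp (- (t * \<theta> k x)) * QI k (\<lambda>y. iexp (t * u (Suc k) y)) x"
proof -
  have "iexp (t * (u (Suc k) y - \<theta> k x)) = iexp (- (t * \<theta> k x)) * iexp (t * u (Suc k) y)" for y
    by (simp add: algebra_simps flip: exp_add)
  then show ?thesis unfolding cond_char_def QI_def by simp
qed

lemma cond_char_measurable[measurable]: "cond_char t k \<in> borel_measurable N"
  unfolding cond_char_eq[abs_def] by measurable

lemma expectation_Z_Suc:
  "expectation (Z t (Suc k)) = expectation (\<lambda>\<omega>. Z t k \<omega> * cond_char t k (\<xi> k \<omega>))"
proof -
  have U: "(\<lambda>\<omega>. iexp (t * S k \<omega>)) \<in> borel_measurable (F k)"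
  proof -
    note [measurable] = S_adapted
    show ?thesis by measurable
  qed
  have "expectation (Z t (Suc k)) = expectation (\<lambda>\<omega>. iexp (t * S k \<omega>) * iexp (t * u (Suc k) (\<xi> (Suc k) \<omega>)))"
    unfolding Z_def S_Suc u_def by (simp add: algebra_simps flip: exp_add)
  also have "\<dots> = expectation (\<lambda>\<omega>. iexp (t * S k \<omega>) * QI k (\<lambda>y. iexp (t * u (Suc k) y)) (\<xi> k \<omega>))"
    by (rule complex_transition[OF _ _ U, where C = 1 and D = 1]) auto
  also have "\<dots> = expectation (\<lambda>\<omega>. Z t k \<omega> * cond_char t k (\<xi> k \<omega>))"
  proof (rule Bochner_Integration.integral_cong[OF refl])
    fix \<omega>
    have "iexp (t * S k \<omega>) = Z t k \<omega> * iexp (- (t * \<theta> k (\<xi> k \<omega>)))"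
      unfolding Z_def by (simp add: algebra_simps flip: exp_add)
    then show "iexp (t * S k \<omega>) * QI k (\<lambda>y. iexp (t * u (Suc k) y)) (\<xi> k \<omega>) = Z t k \<omega> * cond_char t k (\<xi> k \<omega>)"
      by (simp add: cond_char_eq)
  qed
  finally show ?thesis .
qed

definition tail :: "real \<Rightarrow> nat \<Rightarrow> real" where
  "tail L k = (\<integral>x. (g k x)\<^sup>2 * indicator {x. \<bar>g k x\<bar> \<ge> L} x \<partial>P k)"

lemma tail_integrable: "integrable (P k) (\<lambda>x. (g k x)\<^sup>2 * indicator {x. \<bar>g k x\<bar> \<ge> L} x)"
  by (rule Bochner_Integration.integrable_bound[OF g_square[of k]]) (auto simp: indicator_def)

text \<open>Let s be \<bar>g\<bar> plus the two corrector bounds, each at most L/2. If \<bar>g\<bar>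
  \<ge> L then s \<le> 2\<bar>g\<bar>, which gives the 4; otherwise s \<le> 2L and s^2 is at most
  three times the sum of squares, which gives the 6. The factor \<open>b\<close> passes from the
  kernel to the marginal.\<close>

definition remainder :: "real \<Rightarrow> real \<Rightarrow> nat \<Rightarrow> real" where
  "remainder t L k = b * (4 * t\<^sup>2 * tail L (Suc k) + 6 * \<bar>t\<bar> ^ 3 * L * ((\<rho> (Suc k))\<^sup>2 + (m k)\<^sup>2 + (m (Suc k))\<^sup>2))"

text \<open>A second-order Taylor expansion under the kernel: the linear term vanishes by the
  martingale property and the quadratic one gives the conditional variance. The error is dominated
  by a function \<open>G\<close> whose kernel integral is at most \<open>b\<close> times its
  marginal integral.\<close>

lemma cond_char_approx:
  assumes k: "k < n" and x: "x \<in> space N" and L: "m k \<le> L / 2" "m (Suc k) \<le> L / 2"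
  shows "norm (cond_char t k x - of_real (1 - t\<^sup>2 * cond_var k x / 2)) \<le> remainder t L k"
proof -
  interpret C: comparable_prob "P (Suc k)" "Q k x" a b by (rule comparable_prob) fact
  have [measurable_cong]: "sets (Q k x) = sets N" using x by (rule sets_Q)
  have L0: "0 \<le> L" using L m_nonneg[of k] by simp
  define z where "z y = t * (u (Suc k) y - \<theta> k x)" for y
  define G where "G y = 4 * t\<^sup>2 * ((g (Suc k) y)\<^sup>2 * indicator {y. \<bar>g (Suc k) y\<bar> \<ge> L} y)
      + 6 * \<bar>t\<bar> ^ 3 * L * ((g (Suc k) y)\<^sup>2 + ((m k)\<^sup>2 + (m (Suc k))\<^sup>2))" for y
  have [measurable]: "z \<in> borel_measurable N" unfolding z_def[abs_def] by measurable
  have Gi: "integrable (P (Suc k)) G"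
    unfolding G_def[abs_def] using tail_integrable[of "Suc k" L] g_square[of "Suc k"] by simp
  have G_int: "b * (\<integral>y. G y \<partial>P (Suc k)) = remainder t L k"
    unfolding G_def remainder_def tail_def using tail_integrable[of "Suc k" L] g_square[of "Suc k"] C.P.prob_space
    by (simp add: \<rho>_square add.assoc)
  have G0: "0 \<le> G y" for y
    unfolding G_def using L0 by (intro add_nonneg_nonneg mult_nonneg_nonneg) auto
  have zG: "norm (iexp (z y) - (1 + \<i> * z y - (z y)\<^sup>2 / 2)) \<le> G y" if y: "y \<in> space N" for y
  proof -
    define s where "s = \<bar>g (Suc k) y\<bar> + m k + m (Suc k)"
    have "\<bar>u (Suc k) y - \<theta> k x\<bar> \<le> s"
      using \<theta>_bound[of k x] \<theta>_bound[of "Suc k" y] k x y unfolding u_def s_def by simp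
    then have zs: "\<bar>z y\<bar> \<le> \<bar>t\<bar> * s" unfolding z_def abs_mult by (rule mult_left_mono) simp
    show ?thesis
    proof (cases "L \<le> \<bar>g (Suc k) y\<bar>")
      case True
      then have "\<bar>z y\<bar> \<le> \<bar>t\<bar> * (2 * \<bar>g (Suc k) y\<bar>)"
        using zs L unfolding s_def by (elim order_trans) (intro mult_left_mono, auto)
      then have "\<bar>z y\<bar>\<^sup>2 \<le> (\<bar>t\<bar> * (2 * \<bar>g (Suc k) y\<bar>))\<^sup>2" by (rule power_mono) simp
      also have "\<dots> \<le> G y"
        unfolding G_def using True L0 by (simp add: power_mult_distrib)
      finally show ?thesis using iexp_second_order(1)[of "z y"] by simp
    next
      case False
      have s0: "0 \<le> s" using m_nonneg unfolding s_def by simp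
      have sL: "s \<le> 2 * L" using False L unfolding s_def by simp
      have "\<bar>z y\<bar> ^ 3 \<le> (\<bar>t\<bar> * s) ^ 3" using zs by (rule power_mono) simp
      also have "\<dots> = \<bar>t\<bar> ^ 3 * (s * s\<^sup>2)" by (simp add: power_mult_distrib power3_eq_cube power2_eq_square)
      also have "\<dots> \<le> \<bar>t\<bar> ^ 3 * ((2 * L) * (3 * ((g (Suc k) y)\<^sup>2 + ((m k)\<^sup>2 + (m (Suc k))\<^sup>2))))"
      proof (intro mult_left_mono mult_mono sL)
        have "0 \<le> (\<bar>g (Suc k) y\<bar> - m k)\<^sup>2 + (\<bar>g (Suc k) y\<bar> - m (Suc k))\<^sup>2 + (m k - m (Suc k))\<^sup>2" by simp
        also have "\<dots> = 3 * (\<bar>g (Suc k) y\<bar>\<^sup>2 + ((m k)\<^sup>2 + (m (Suc k))\<^sup>2)) - s\<^sup>2"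
          unfolding s_def by algebra
        finally show "s\<^sup>2 \<le> 3 * ((g (Suc k) y)\<^sup>2 + ((m k)\<^sup>2 + (m (Suc k))\<^sup>2))" by simp
      qed (use L0 in auto)
      also have "\<dots> = G y" unfolding G_def using False by simp
      finally show ?thesis using iexp_second_order(2)[of "z y"] by simp
    qed
  qed
  have z: "integrable (Q k x) z" "integrable (Q k x) (\<lambda>y. (z y)\<^sup>2)"
    "(\<integral>y. z y \<partial>Q k x) = 0" "(\<integral>y. (z y)\<^sup>2 \<partial>Q k x) = t\<^sup>2 * cond_var k x"
    unfolding z_def[abs_def] power_mult_distrib
    using Q_u[OF k x] cond_var_eq[OF k x] QI_u[OF k x] by (simp_all add: QI_def C.Q.prob_space)
  have ei: "integrable (Q k x) (\<lambda>y. iexp (z y))"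
  proof (rule C.Q.integrable_const_bound[of _ 1])
    have "(\<lambda>y. iexp (z y)) \<in> borel_measurable N" by measurable
    then show "(\<lambda>y. iexp (z y)) \<in> borel_measurable (Q k x)"
      by (simp add: measurable_cong_sets[OF sets_Q[OF x] refl])
  qed simp
  have lin: "integrable (Q k x) (\<lambda>y. 1 + \<i> * z y - (z y)\<^sup>2 / 2)"
    using z by (auto simp flip: of_real_power)
  have "cond_char t k x - (1 - t\<^sup>2 * cond_var k x / 2) = (\<integral>y. iexp (z y) - (1 + \<i> * z y - (z y)\<^sup>2 / 2) \<partial>Q k x)"
  proof -
    have "(\<integral>y. 1 + \<i> * z y - (z y)\<^sup>2 / 2 \<partial>Q k x) = 1 - t\<^sup>2 * cond_var k x / 2"
      using z by (simp add: C.Q.prob_space del: of_real_power of_real_divide)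
    then show ?thesis
      using ei lin by (simp add: cond_char_def z_def)
  qed
  also have "norm \<dots> \<le> (\<integral>y. norm (iexp (z y) - (1 + \<i> * z y - (z y)\<^sup>2 / 2)) \<partial>Q k x)"
    by (rule integral_norm_bound)
  also have "\<dots> \<le> (\<integral>y. G y \<partial>Q k x)"
    using zG space_Q[OF x] by (intro integral_mono integrable_norm Bochner_Integration.integrable_diff ei lin C.integrable_Q Gi) auto
  also have "\<dots> \<le> b * (\<integral>y. G y \<partial>P (Suc k))"
    using Gi G0 by (rule C.integral_upper)
  finally show ?thesis unfolding G_int .
qed

text \<open>The Gaussian factor for the variance still to come. The product of
  \<open>damp t k\<close> with the expectation of \<open>Z t k\<close> interpolates between the
  Gaussian at k = 0 and the characteristic function of \<open>S n\<close> at k = n.\<close>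

definition damp :: "real \<Rightarrow> nat \<Rightarrow> real" where
  "damp t k = exp (- (t\<^sup>2 / 2 * (\<Sum>j\<in>{k..<n}. mean_var j)))"

lemma damp_Suc: "k < n \<Longrightarrow> damp t k = damp t (Suc k) * exp (- (t\<^sup>2 * mean_var k / 2))"
  by (simp add: damp_def sum.atLeast_Suc_lessThan algebra_simps flip: exp_add)

lemma damp_bounds: "0 \<le> damp t k" "damp t k \<le> 1"
  unfolding damp_def using mean_var_bounds(1) by (auto intro!: mult_nonneg_nonneg sum_nonneg)

text \<open>The second-order term that is left when one increment is exchanged for its Gaussian
  factor.\<close>

definition fluct :: "real \<Rightarrow> nat \<Rightarrow> 'b \<Rightarrow> real" where
  "fluct t k x = damp t (Suc k) * (cond_var k x - mean_var k)"

lemma fluct_measurable[measurable]: "fluct t k \<in> borel_measurable N"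
  unfolding fluct_def[abs_def] by measurable

lemma fluct_bound: "k < n \<Longrightarrow> x \<in> space N \<Longrightarrow> \<bar>fluct t k x\<bar> \<le> b * u_moment (Suc k)"
proof -
  assume k: "k < n" and x: "x \<in> space N"
  have "\<bar>cond_var k x - mean_var k\<bar> \<le> b * u_moment (Suc k)"
    using cond_var_bounds[OF k x] mean_var_bounds[OF k] by linarith
  moreover have "damp t (Suc k) * \<bar>cond_var k x - mean_var k\<bar> \<le> 1 * \<bar>cond_var k x - mean_var k\<bar>"
    using damp_bounds by (intro mult_right_mono) auto
  ultimately show ?thesis
    using damp_bounds by (simp add: fluct_def abs_mult)
qed

lemma fluct_mean: "k < n \<Longrightarrow> (\<integral>x. fluct t k x \<partial>P k) = 0"
proof -
  assume k: "k < n"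
  interpret Pk: prob_space "P k" by (rule prob_space_distr) simp
  show ?thesis
    unfolding fluct_def using cond_var_integrable[OF k] Pk.prob_space by (simp add: mean_var_def)
qed

text \<open>Exchanging one increment costs the Taylor remainder of \<open>cond_char\<close> and the
  quadratic error of the damping exponential. The fluctuation term is of the same order as the
  variance itself, so it is kept exactly and treated only after summation.\<close>

lemma expectation_Z_step:
  assumes k: "k < n" and L: "m k \<le> L / 2" "m (Suc k) \<le> L / 2"
  shows "norm (expectation (Z t (Suc k)) * damp t (Suc k) - expectation (Z t k) * damp t k
      + of_real (t\<^sup>2 / 2) * expectation (\<lambda>\<omega>. Z t k \<omega> * fluct t k (\<xi> k \<omega>)))
    \<le> remainder t L k + (t\<^sup>2 * mean_var k)\<^sup>2 / 8"
proof -
  define q where "q = exp (- (t\<^sup>2 * mean_var k / 2))"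
  define f where "f \<omega> = Z t k \<omega> * damp t (Suc k) * (cond_char t k (\<xi> k \<omega>) - q + of_real (t\<^sup>2 / 2 * (cond_var k (\<xi> k \<omega>) - mean_var k)))" for \<omega>
  have q: "\<bar>q - 1 + t\<^sup>2 * mean_var k / 2\<bar> \<le> (t\<^sup>2 * mean_var k)\<^sup>2 / 8"
    using exp_neg_approx[of "t\<^sup>2 * mean_var k / 2"] mean_var_bounds(1)[OF k] by (simp add: q_def power_divide)
  have cnd1: "norm (cond_char t k x) \<le> 1" if "x \<in> space N" for x
    unfolding cond_char_eq norm_mult using that by (auto intro!: norm_QI_le_const)
  have i1: "integrable M (\<lambda>\<omega>. Z t k \<omega> * cond_char t k (\<xi> k \<omega>))"
    using cnd1 \<xi>_space by (intro integrable_const_bound[of _ 1]) (auto simp: norm_mult)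
  have i2: "integrable M (Z t k)" by (intro integrable_const_bound[of _ 1]) auto
  have i3: "integrable M (\<lambda>\<omega>. Z t k \<omega> * fluct t k (\<xi> k \<omega>))"
    using fluct_bound[OF k] \<xi>_space by (intro integrable_const_bound[of _ "b * u_moment (Suc k)"]) (auto simp: norm_mult)
  have "expectation (Z t (Suc k)) * damp t (Suc k) - expectation (Z t k) * damp t k
      + of_real (t\<^sup>2 / 2) * expectation (\<lambda>\<omega>. Z t k \<omega> * fluct t k (\<xi> k \<omega>))
    = expectation (\<lambda>\<omega>. Z t k \<omega> * cond_char t k (\<xi> k \<omega>) * damp t (Suc k) - Z t k \<omega> * damp t k
        + of_real (t\<^sup>2 / 2) * (Z t k \<omega> * fluct t k (\<xi> k \<omega>)))"
    using i1 i2 i3 by (simp add: expectation_Z_Suc)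
  also have "\<dots> = expectation f"
    by (intro Bochner_Integration.integral_cong) (auto simp: f_def fluct_def damp_Suc[OF k] q_def algebra_simps)
  also have "norm \<dots> \<le> remainder t L k + (t\<^sup>2 * mean_var k)\<^sup>2 / 8"
  proof (rule order_trans[OF integral_norm_bound], rule integral_le_const)
    have fb: "norm (f \<omega>) \<le> remainder t L k + (t\<^sup>2 * mean_var k)\<^sup>2 / 8" if \<omega>: "\<omega> \<in> space M" for \<omega>
    proof -
      define x where "x = \<xi> k \<omega>"
      have x: "x \<in> space N" using \<xi>_space[OF \<omega>] by (simp add: x_def)
      have "cond_char t k x - q + of_real (t\<^sup>2 / 2 * (cond_var k x - mean_var k))
        = (cond_char t k x - of_real (1 - t\<^sup>2 * cond_var k x / 2)) - of_real (q - 1 + t\<^sup>2 * mean_var k / 2)"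
        by (simp add: field_simps)
      also have "norm \<dots> \<le> remainder t L k + (t\<^sup>2 * mean_var k)\<^sup>2 / 8"
        using cond_char_approx[OF k x L] q by (intro order_trans[OF norm_triangle_ineq4 add_mono]) (simp_all only: norm_of_real)
      finally have le: "norm (cond_char t k x - q + of_real (t\<^sup>2 / 2 * (cond_var k x - mean_var k))) \<le> remainder t L k + (t\<^sup>2 * mean_var k)\<^sup>2 / 8" .
      have "norm (f \<omega>) = damp t (Suc k) * norm (cond_char t k x - q + of_real (t\<^sup>2 / 2 * (cond_var k x - mean_var k)))"
        using damp_bounds by (simp add: f_def norm_mult x_def)
      also have "\<dots> \<le> 1 * norm (cond_char t k x - q + of_real (t\<^sup>2 / 2 * (cond_var k x - mean_var k)))"
        using damp_bounds by (intro mult_right_mono) auto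
      finally show ?thesis using le by simp
    qed
    then show "AE \<omega> in M. norm (f \<omega>) \<le> remainder t L k + (t\<^sup>2 * mean_var k)\<^sup>2 / 8" by auto
    have "f \<in> borel_measurable M" unfolding f_def[abs_def] by measurable
    then show "integrable M (\<lambda>\<omega>. norm (f \<omega>))"
      using fb by (intro integrable_norm integrable_const_bound[of _ "remainder t L k + (t\<^sup>2 * mean_var k)\<^sup>2 / 8"]) auto
  qed
  finally show ?thesis .
qed

text \<open>Here the conditional variances are replaced by their means: a second corrector turns the sum
  of fluctuations into a telescoping sum plus increments of \<open>Z\<close>, which are small.\<close>

lemma sum_fluct:
  assumes mono: "\<And>k. k < n \<Longrightarrow> \<rho> (Suc k) + m k + m (Suc k) \<le> D" and "0 \<le> D"
    and U: "\<And>k. k < n \<Longrightarrow> b * u_moment (Suc k) \<le> B" and "0 \<le> B"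
  shows "norm (\<Sum>k<n. expectation (\<lambda>\<omega>. Z t k \<omega> * fluct t k (\<xi> k \<omega>)))
    \<le> B / a + \<bar>t\<bar> * D * (\<Sum>k<n. b * u_moment (Suc k)) / a"
proof -
  \<comment> \<open>The second corrector: its forcing is the fluctuation, bounded by
    \<open>b * u_moment (Suc k)\<close>.\<close>
  obtain \<Psi> :: "nat \<Rightarrow> 'b \<Rightarrow> real" and p :: "nat \<Rightarrow> real" where
    [measurable]: "\<And>k. \<Psi> k \<in> borel_measurable N" and \<Psi>n: "\<And>x. \<Psi> n x = 0"
    and \<Psi>_step: "\<And>k x. k < n \<Longrightarrow> \<Psi> k x = fluct t k x + QI k (\<Psi> (Suc k)) x"
    and \<Psi>p: "\<And>k x. k \<le> n \<Longrightarrow> x \<in> space N \<Longrightarrow> \<bar>\<Psi> k x\<bar> \<le> p k"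
    and "\<And>k. k \<le> n \<Longrightarrow> (\<integral>x. \<Psi> k x \<partial>P k) = 0"
    and "p n = 0" and p0: "\<And>k. 0 \<le> p k"
    and sum_p: "a * (\<Sum>k<n. p k) \<le> (\<Sum>k<n. b * u_moment (Suc k))"
    and "a\<^sup>2 * (\<Sum>k<n. (p k)\<^sup>2) \<le> (\<Sum>k<n. (b * u_moment (Suc k))\<^sup>2)"
    and max_p: "\<And>C. \<forall>k<n. b * u_moment (Suc k) \<le> C \<Longrightarrow> 0 \<le> C \<Longrightarrow> \<forall>k\<le>n. p k \<le> C / a"
    by (rule corrector_exists[of "fluct t" n "\<lambda>k. b * u_moment (Suc k)", OF fluct_measurable fluct_bound fluct_mean
          mult_nonneg_nonneg[OF order_trans[OF zero_le_one b_ge_1] u_moment_nonneg]]) (assumption | rule that)+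
  define E where "E k = expectation (\<lambda>\<omega>. Z t k \<omega> * \<Psi> k (\<xi> k \<omega>))" for k
  define I where "I k = expectation (\<lambda>\<omega>. (Z t (Suc k) \<omega> - Z t k \<omega>) * \<Psi> (Suc k) (\<xi> (Suc k) \<omega>))" for k
  have int: "integrable M (\<lambda>\<omega>. Z t i \<omega> * \<Psi> j (\<xi> j \<omega>))" if "j \<le> n" for i j
    using \<Psi>p[OF that] \<xi>_space by (intro integrable_const_bound[of _ "p j"]) (auto simp: norm_mult)
  \<comment> \<open>The corrector equation writes the fluctuation as the current corrector minus the
    transition of the next one. Conditioning undoes that transition under the weight
    \<open>Z t k\<close>; exchanging this weight for \<open>Z t (Suc k)\<close> makes the sum
    telescope and produces \<open>I k\<close>.\<close>
  have step: "expectation (\<lambda>\<omega>. Z t k \<omega> * fluct t k (\<xi> k \<omega>)) = E k - E (Suc k) + I k" if k: "k < n" for k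
  proof -
    have iQ: "complex_of_real (QI k (\<Psi> (Suc k)) x) = QI k (\<lambda>y. complex_of_real (\<Psi> (Suc k) y)) x" for x
      by (simp add: QI_def)
    have "expectation (\<lambda>\<omega>. Z t k \<omega> * fluct t k (\<xi> k \<omega>))
      = expectation (\<lambda>\<omega>. Z t k \<omega> * \<Psi> k (\<xi> k \<omega>) - Z t k \<omega> * QI k (\<lambda>y. complex_of_real (\<Psi> (Suc k) y)) (\<xi> k \<omega>))"
      by (intro Bochner_Integration.integral_cong) (auto simp: \<Psi>_step[OF k] algebra_simps iQ)
    also have "\<dots> = E k - expectation (\<lambda>\<omega>. Z t k \<omega> * QI k (\<lambda>y. complex_of_real (\<Psi> (Suc k) y)) (\<xi> k \<omega>))"
    proof -
      have "norm (QI k (\<lambda>y. complex_of_real (\<Psi> (Suc k) y)) x) \<le> p (Suc k)" if "x \<in> space N" for x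
        using \<Psi>p k that by (intro norm_QI_le_const) auto
      then have "integrable M (\<lambda>\<omega>. Z t k \<omega> * QI k (\<lambda>y. complex_of_real (\<Psi> (Suc k) y)) (\<xi> k \<omega>))"
        using \<xi>_space by (intro integrable_const_bound[of _ "p (Suc k)"]) (auto simp: norm_mult)
      then show ?thesis using int k by (simp add: E_def)
    qed
    also have "expectation (\<lambda>\<omega>. Z t k \<omega> * QI k (\<lambda>y. complex_of_real (\<Psi> (Suc k) y)) (\<xi> k \<omega>))
      = expectation (\<lambda>\<omega>. Z t k \<omega> * \<Psi> (Suc k) (\<xi> (Suc k) \<omega>))"
      using \<Psi>p k by (intro complex_transition[where C = "p (Suc k)" and D = 1, symmetric] Z_adapted) auto
    also have "\<dots> = E (Suc k) - I k"
      using int k by (simp add: E_def I_def left_diff_distrib)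
    finally show ?thesis by simp
  qed
  \<comment> \<open>The corrector is bounded by \<open>p (Suc k)\<close>, and \<open>Z\<close>
    changes by at most \<bar>t\<bar> times the martingale increment, whose first absolute moment is
    at most \<open>D\<close>.\<close>
  have I: "norm (I k) \<le> \<bar>t\<bar> * D * p (Suc k)" if k: "k < n" for k
  proof -
    have gi: "integrable M (\<lambda>\<omega>. \<bar>g (Suc k) (\<xi> (Suc k) \<omega>)\<bar>)"
      using integrable_distr[OF \<xi>_measurable g_integrable(1)] by auto
    have "norm (I k) \<le> expectation (\<lambda>\<omega>. norm ((Z t (Suc k) \<omega> - Z t k \<omega>) * \<Psi> (Suc k) (\<xi> (Suc k) \<omega>)))"
      unfolding I_def by (rule integral_norm_bound)
    also have "\<dots> \<le> expectation (\<lambda>\<omega>. \<bar>t\<bar> * p (Suc k) * (\<bar>g (Suc k) (\<xi> (Suc k) \<omega>)\<bar> + (m k + m (Suc k))))"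
    proof (rule integral_mono)
      show "integrable M (\<lambda>\<omega>. norm ((Z t (Suc k) \<omega> - Z t k \<omega>) * \<Psi> (Suc k) (\<xi> (Suc k) \<omega>)))"
        unfolding left_diff_distrib using k by (intro integrable_norm Bochner_Integration.integrable_diff int) auto
      show "integrable M (\<lambda>\<omega>. \<bar>t\<bar> * p (Suc k) * (\<bar>g (Suc k) (\<xi> (Suc k) \<omega>)\<bar> + (m k + m (Suc k))))"
        using gi by simp
      fix \<omega> assume \<omega>: "\<omega> \<in> space M"
      define x y where "x = \<xi> k \<omega>" "y = \<xi> (Suc k) \<omega>"
      have xy: "x \<in> space N" "y \<in> space N" using \<xi>_space[OF \<omega>] by (auto simp: x_y_def)
      have "Z t (Suc k) \<omega> - Z t k \<omega> = Z t k \<omega> * (iexp (t * (u (Suc k) y - \<theta> k x)) - 1)"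
        unfolding Z_def S_Suc u_def x_y_def right_diff_distrib exp_add[symmetric] by (simp add: algebra_simps)
      then have "norm (Z t (Suc k) \<omega> - Z t k \<omega>) = norm (iexp (t * (u (Suc k) y - \<theta> k x)) - 1)"
        by (simp add: norm_mult)
      also have "\<dots> \<le> \<bar>t * (u (Suc k) y - \<theta> k x)\<bar>"
        using iexp_approx1[of "t * (u (Suc k) y - \<theta> k x)" 0] by simp
      also have "\<dots> \<le> \<bar>t\<bar> * (\<bar>g (Suc k) y\<bar> + (m k + m (Suc k)))"
        unfolding abs_mult using \<theta>_bound[of k x] \<theta>_bound[of "Suc k" y] k xy
        by (intro mult_left_mono) (auto simp: u_def)
      finally have "norm ((Z t (Suc k) \<omega> - Z t k \<omega>) * \<Psi> (Suc k) y) \<le> \<bar>t\<bar> * (\<bar>g (Suc k) y\<bar> + (m k + m (Suc k))) * p (Suc k)"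
        unfolding norm_mult using \<Psi>p[of "Suc k" y] k xy m_nonneg
        by (intro mult_mono) (auto intro!: mult_nonneg_nonneg add_nonneg_nonneg)
      then show "norm ((Z t (Suc k) \<omega> - Z t k \<omega>) * \<Psi> (Suc k) (\<xi> (Suc k) \<omega>))
          \<le> \<bar>t\<bar> * p (Suc k) * (\<bar>g (Suc k) (\<xi> (Suc k) \<omega>)\<bar> + (m k + m (Suc k)))"
        by (simp add: x_y_def mult_ac)
    qed
    also have "\<dots> = \<bar>t\<bar> * p (Suc k) * ((\<integral>y. \<bar>g (Suc k) y\<bar> \<partial>P (Suc k)) + (m k + m (Suc k)))"
      using gi by (simp add: integral_distr prob_space)
    also have "\<dots> \<le> \<bar>t\<bar> * p (Suc k) * D"
      using p0 g_integrable(2)[of "Suc k"] mono[OF k] by (intro mult_left_mono) auto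
    finally show ?thesis by (simp add: mult_ac)
  qed
  have "(\<Sum>k<n. expectation (\<lambda>\<omega>. Z t k \<omega> * fluct t k (\<xi> k \<omega>))) = (\<Sum>k<n. E k - E (Suc k)) + (\<Sum>k<n. I k)"
    by (simp add: step flip: sum.distrib)
  also have "(\<Sum>k<n. E k - E (Suc k)) = E 0"
    unfolding sum_lessThan_telescope' by (simp add: E_def \<Psi>n)
  also have "norm (E 0 + (\<Sum>k<n. I k)) \<le> B / a + (\<Sum>k<n. \<bar>t\<bar> * D * p (Suc k))"
  proof (intro order_trans[OF norm_triangle_ineq] add_mono)
    have "norm (E 0) \<le> expectation (\<lambda>\<omega>. norm (Z t 0 \<omega> * \<Psi> 0 (\<xi> 0 \<omega>)))"
      unfolding E_def by (rule integral_norm_bound)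
    also have "\<dots> \<le> p 0"
      using \<Psi>p[of 0] \<xi>_space by (intro integral_le_const integrable_norm int) (auto simp: norm_mult)
    also have "p 0 \<le> B / a" using max_p[of B] U \<open>0 \<le> B\<close> by simp
    finally show "norm (E 0) \<le> B / a" .
    show "norm (\<Sum>k<n. I k) \<le> (\<Sum>k<n. \<bar>t\<bar> * D * p (Suc k))"
      using I by (intro order_trans[OF norm_sum] sum_mono) auto
  qed
  also have "(\<Sum>k<n. \<bar>t\<bar> * D * p (Suc k)) = \<bar>t\<bar> * D * (\<Sum>k<n. p (Suc k))"
    by (simp add: sum_distrib_left)
  also have "\<dots> \<le> \<bar>t\<bar> * D * ((\<Sum>k<n. b * u_moment (Suc k)) / a)"
  proof (intro mult_left_mono)
    have "(\<Sum>k<n. p (Suc k)) = (\<Sum>k<n. p k) - p 0"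
      using sum_lessThan_telescope[of p n] \<open>p n = 0\<close> by (simp add: sum_subtractf)
    also have "\<dots> \<le> (\<Sum>k<n. b * u_moment (Suc k)) / a"
      using sum_p mult_nonneg_nonneg[OF less_imp_le[OF a_pos] p0[of 0]] a_pos by (simp add: field_simps)
    finally show "(\<Sum>k<n. p (Suc k)) \<le> (\<Sum>k<n. b * u_moment (Suc k)) / a" .
  qed (use \<open>0 \<le> D\<close> in auto)
  finally show ?thesis by simp
qed

text \<open>The step estimates are summed along the interpolation; at its ends
  \<open>\<theta> 0\<close> and \<open>\<theta> n\<close> vanish at the states visited, so both end
  values are exact.\<close>

lemma char_S_approx:
  assumes D: "\<And>k. k < n \<Longrightarrow> \<rho> (Suc k) + m k + m (Suc k) \<le> D" "0 \<le> D"
    and B: "\<And>k. k < n \<Longrightarrow> b * u_moment (Suc k) \<le> B" "0 \<le> B"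
    and L: "\<And>k. k \<le> n \<Longrightarrow> m k \<le> L / 2"
  shows "norm (expectation (\<lambda>\<omega>. iexp (t * S n \<omega>)) - exp (- (t\<^sup>2 / 2 * expectation (\<lambda>\<omega>. (S n \<omega>)\<^sup>2))))
    \<le> (\<Sum>k<n. remainder t L k + (t\<^sup>2 * mean_var k)\<^sup>2 / 8) + t\<^sup>2 / 2 * (B / a + \<bar>t\<bar> * D * (\<Sum>k<n. b * u_moment (Suc k)) / a)"
proof -
  define A where "A k = expectation (Z t k) * damp t k" for k
  define W where "W k = expectation (\<lambda>\<omega>. Z t k \<omega> * fluct t k (\<xi> k \<omega>))" for k
  have "expectation (Z t 0) = 1"
  proof -
    have "expectation (Z t 0) = expectation (\<lambda>\<omega>. 1)"
      by (intro Bochner_Integration.integral_cong) (auto simp: Z_def S_def \<theta>_0)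
    then show ?thesis by (simp add: prob_space)
  qed
  then have A0: "A 0 = exp (- (t\<^sup>2 / 2 * expectation (\<lambda>\<omega>. (S n \<omega>)\<^sup>2)))"
    by (simp add: A_def damp_def variance_S lessThan_atLeast0)
  have An: "A n = expectation (\<lambda>\<omega>. iexp (t * S n \<omega>))"
    by (simp add: A_def damp_def Z_def[abs_def] \<theta>_n)
  \<comment> \<open>The fluctuation terms are added and subtracted: inside the sum they make each
    step small, outside they are estimated jointly.\<close>
  have "A n - A 0 = (\<Sum>k<n. A (Suc k) - A k + of_real (t\<^sup>2 / 2) * W k) - of_real (t\<^sup>2 / 2) * (\<Sum>k<n. W k)"
    unfolding sum.distrib sum_lessThan_telescope by (simp add: sum_distrib_left)
  also have "norm \<dots> \<le> (\<Sum>k<n. remainder t L k + (t\<^sup>2 * mean_var k)\<^sup>2 / 8) + t\<^sup>2 / 2 * (B / a + \<bar>t\<bar> * D * (\<Sum>k<n. b * u_moment (Suc k)) / a)"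
  proof (intro order_trans[OF norm_triangle_ineq4] add_mono)
    show "norm (\<Sum>k<n. A (Suc k) - A k + of_real (t\<^sup>2 / 2) * W k) \<le> (\<Sum>k<n. remainder t L k + (t\<^sup>2 * mean_var k)\<^sup>2 / 8)"
    proof (rule order_trans[OF norm_sum], rule sum_mono)
      fix k assume "k \<in> {..<n}"
      then show "norm (A (Suc k) - A k + of_real (t\<^sup>2 / 2) * W k) \<le> remainder t L k + (t\<^sup>2 * mean_var k)\<^sup>2 / 8"
        using expectation_Z_step[of k L t] L[of k] L[of "Suc k"] by (simp add: A_def W_def)
    qed
    show "norm (of_real (t\<^sup>2 / 2) * (\<Sum>k<n. W k)) \<le> t\<^sup>2 / 2 * (B / a + \<bar>t\<bar> * D * (\<Sum>k<n. b * u_moment (Suc k)) / a)"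
    proof -
      have "norm (of_real (t\<^sup>2 / 2) * (\<Sum>k<n. W k)) = t\<^sup>2 / 2 * norm (\<Sum>k<n. W k)"
        by (simp only: norm_mult norm_of_real) simp
      also have "\<dots> \<le> t\<^sup>2 / 2 * (B / a + \<bar>t\<bar> * D * (\<Sum>k<n. b * u_moment (Suc k)) / a)"
        unfolding W_def by (rule mult_left_mono[OF sum_fluct[OF D B]]) simp_all
      finally show ?thesis .
    qed
  qed
  finally show ?thesis by (simp add: A0 An)
qed

end

section \<open>Existence of the corrector and a quantitative central limit theorem\<close>

context centered_chain begin

definition total :: "nat \<Rightarrow> real" where "total n = (\<Sum>k<n. (\<rho> (Suc k))\<^sup>2)"

text \<open>From \<open>u_moment_le\<close> (twice the sum of \<rho>^2 and m^2) and the quadratic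
  corrector bound, by which the m^2 sum up to at most b^2/a^2 times the \<rho>^2.\<close>

definition K :: real where "K = 2 * (1 + b\<^sup>2 / a\<^sup>2)"

text \<open>The forcing at time \<open>k\<close> is the transition of the next summand. It has mean
  zero and is bounded by \<open>b * \<rho> (Suc k)\<close>, because transitions map integrable
  functions to bounded ones.\<close>

lemma corrected_exists:
  obtains \<theta> m where "corrected_chain M N F \<xi> Q a b x0 g n \<theta> m"
    "a\<^sup>2 * (\<Sum>k<n. (m k)\<^sup>2) \<le> b\<^sup>2 * total n"
    "\<And>C. \<forall>k<n. b * \<rho> (Suc k) \<le> C \<Longrightarrow> 0 \<le> C \<Longrightarrow> \<forall>k\<le>n. m k \<le> C / a"
proof -
  have wW: "\<bar>QI k (g (Suc k)) x\<bar> \<le> b * \<rho> (Suc k)" if "x \<in> space N" for k x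
  proof -
    have "norm (QI k (g (Suc k)) x) \<le> b * (\<integral>y. norm (g (Suc k) y) \<partial>P (Suc k))"
      using g_integrable(1) that by (rule norm_QI_le)
    also have "\<dots> \<le> b * \<rho> (Suc k)"
      using g_integrable(2)[of "Suc k"] b_ge_1 by (intro mult_left_mono) auto
    finally show ?thesis by simp
  qed
  have w0: "(\<integral>x. QI k (g (Suc k)) x \<partial>P k) = 0" for k
    using QI_mean(1)[OF g_integrable(1), of k] g_mean by simp
  have W0: "0 \<le> b * \<rho> (Suc k)" for k using b_ge_1 \<rho>_nonneg by simp
  have wm: "QI k (g (Suc k)) \<in> borel_measurable N" for k by measurable
  obtain \<theta> m where
    1: "\<And>k. \<theta> k \<in> borel_measurable N" "\<And>x. \<theta> n x = 0"
    and 2: "\<And>k x. k < n \<Longrightarrow> \<theta> k x = QI k (g (Suc k)) x + QI k (\<theta> (Suc k)) x"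
    and 3: "\<And>k x. k \<le> n \<Longrightarrow> x \<in> space N \<Longrightarrow> \<bar>\<theta> k x\<bar> \<le> m k"
    and 4: "\<And>k. k \<le> n \<Longrightarrow> (\<integral>x. \<theta> k x \<partial>P k) = 0"
    and 5: "m n = 0" "\<And>k. 0 \<le> m k"
    and "a * (\<Sum>k<n. m k) \<le> (\<Sum>k<n. b * \<rho> (Suc k))"
    and 6: "a\<^sup>2 * (\<Sum>k<n. (m k)\<^sup>2) \<le> (\<Sum>k<n. (b * \<rho> (Suc k))\<^sup>2)"
    and 7: "\<And>C. \<forall>k<n. b * \<rho> (Suc k) \<le> C \<Longrightarrow> 0 \<le> C \<Longrightarrow> \<forall>k\<le>n. m k \<le> C / a"
    by (rule corrector_exists[where n = n, OF wm wW w0 W0]) (assumption | rule that)+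
  have "corrected_chain M N F \<xi> Q a b x0 g n \<theta> m"
  proof unfold_locales
    fix k x assume k: "k < n" and x: "x \<in> space N"
    have "integrable (Q k x) (g (Suc k))" "integrable (Q k x) (\<theta> (Suc k))"
      using 1(1) 3[of "Suc k"] k x
      by (auto intro!: integrable_Q g_integrable(1) integrable_P_bounded[of _ "m (Suc k)"])
    then show "\<theta> k x = QI k (\<lambda>y. g (Suc k) y + \<theta> (Suc k) y) x"
      using 2[OF k] by (simp add: QI_def)
  qed (use 1 3 4 5 in auto)
  moreover have "a\<^sup>2 * (\<Sum>k<n. (m k)\<^sup>2) \<le> b\<^sup>2 * total n"
    using 6 by (simp add: total_def sum_distrib_left power_mult_distrib)
  ultimately show thesis using 7 by (rule that)
qed

lemma corrected_U2:
  assumes "corrected_chain M N F \<xi> Q a b x0 g n \<theta> m"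
    and m2: "a\<^sup>2 * (\<Sum>k<n. (m k)\<^sup>2) \<le> b\<^sup>2 * total n"
  shows "(\<Sum>k<n. (m (Suc k))\<^sup>2) \<le> (\<Sum>k<n. (m k)\<^sup>2)" "(\<Sum>k<n. (m k)\<^sup>2) \<le> b\<^sup>2 / a\<^sup>2 * total n"
    "(\<Sum>k<n. corrected_chain.u_moment M N \<xi> g \<theta> (Suc k)) \<le> K * total n"
proof -
  interpret corrected_chain M N F \<xi> Q a b x0 g n \<theta> m by fact
  have "(\<Sum>k<n. (m (Suc k))\<^sup>2) = (\<Sum>k<n. (m k)\<^sup>2) - (m 0)\<^sup>2"
    using sum_lessThan_telescope[of "\<lambda>k. (m k)\<^sup>2" n] m_n by (simp add: sum_subtractf)
  then show 1: "(\<Sum>k<n. (m (Suc k))\<^sup>2) \<le> (\<Sum>k<n. (m k)\<^sup>2)" by simp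
  show 2: "(\<Sum>k<n. (m k)\<^sup>2) \<le> b\<^sup>2 / a\<^sup>2 * total n"
    using m2 a_pos by (simp add: field_simps)
  have "(\<Sum>k<n. u_moment (Suc k)) \<le> (\<Sum>k<n. 2 * (\<rho> (Suc k))\<^sup>2 + 2 * (m (Suc k))\<^sup>2)"
    by (intro sum_mono u_moment_le) auto
  also have "\<dots> = 2 * total n + 2 * (\<Sum>k<n. (m (Suc k))\<^sup>2)"
    by (simp add: sum.distrib sum_distrib_left total_def)
  also have "\<dots> \<le> K * total n" using 1 2 by (simp add: K_def algebra_simps)
  finally show "(\<Sum>k<n. u_moment (Suc k)) \<le> K * total n" .
qed

text \<open>Both bounds pass through the sum of the \<open>u_moment\<close>, which the conditional
  variances compare with the variance of the sum and the corrector estimates with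
  \<tau>_n^2.\<close>

lemma variance_S_bounds:
  "a / 4 * total n \<le> expectation (\<lambda>\<omega>. (S n \<omega>)\<^sup>2)" "expectation (\<lambda>\<omega>. (S n \<omega>)\<^sup>2) \<le> b * K * total n"
proof -
  obtain \<theta> m where C: "corrected_chain M N F \<xi> Q a b x0 g n \<theta> m"
    and m2: "a\<^sup>2 * (\<Sum>k<n. (m k)\<^sup>2) \<le> b\<^sup>2 * total n"
    by (rule corrected_exists[where n = n]) (assumption | rule that)+
  interpret corrected_chain M N F \<xi> Q a b x0 g n \<theta> m by fact
  have "a / 4 * total n \<le> a * (\<Sum>k<n. u_moment (Suc k))"
    using sum_\<rho>_le a_pos mult_left_mono[of "total n" "4 * (\<Sum>k<n. u_moment (Suc k))" "a / 4"] by (simp add: total_def)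
  also have "\<dots> \<le> expectation (\<lambda>\<omega>. (S n \<omega>)\<^sup>2)"
    unfolding variance_S sum_distrib_left by (intro sum_mono mean_var_bounds) auto
  finally show "a / 4 * total n \<le> expectation (\<lambda>\<omega>. (S n \<omega>)\<^sup>2)" .
  have "expectation (\<lambda>\<omega>. (S n \<omega>)\<^sup>2) \<le> b * (\<Sum>k<n. u_moment (Suc k))"
    unfolding variance_S sum_distrib_left by (intro sum_mono mean_var_bounds) auto
  also have "\<dots> \<le> b * (K * total n)"
    using corrected_U2(3)[OF C m2] b_ge_1 by (intro mult_left_mono) auto
  finally show "expectation (\<lambda>\<omega>. (S n \<omega>)\<^sup>2) \<le> b * K * total n" by simp
qed

text \<open>The three summands come from the Taylor remainders, the damping exponentials and the
  variance fluctuations, after the powers of \<tau> have cancelled.\<close>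

definition clt_const :: "real \<Rightarrow> real" where
  "clt_const s = b * (4 * s\<^sup>2 + 6 * \<bar>s\<bar> ^ 3 * (2 * b / a) * (1 + 2 * (b\<^sup>2 / a\<^sup>2)))
     + s ^ 4 * (b * K) * (b * K) / 8
     + s\<^sup>2 / 2 * (b * K / a + \<bar>s\<bar> * (1 + 2 * b / a) * (b * K) / a)"

text \<open>A single parameter \<eta> measures smallness: if all \<rho> are at most \<eta>\<tau>,
  the correctors are at most (b/a)\<eta>\<tau>, and each of the error terms becomes a multiple of
  \<eta>.\<close>

lemma char_S_clt:
  assumes \<eta>: "0 < \<eta>" "\<eta> \<le> 1" and \<tau>: "0 < \<tau>" "\<tau>\<^sup>2 = total n"
    and \<rho>: "\<And>k. k < n \<Longrightarrow> \<rho> (Suc k) \<le> \<eta> * \<tau>"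
    and lind: "(\<Sum>k<n. \<integral>x. (g (Suc k) x)\<^sup>2 * indicator {x. \<bar>g (Suc k) x\<bar> \<ge> 2 * b / a * \<eta> * \<tau>} x \<partial>P (Suc k)) \<le> \<eta> * \<tau>\<^sup>2"
  shows "norm (expectation (\<lambda>\<omega>. iexp (s / \<tau> * S n \<omega>)) - exp (- ((s / \<tau>)\<^sup>2 / 2 * expectation (\<lambda>\<omega>. (S n \<omega>)\<^sup>2))))
    \<le> clt_const s * \<eta>"
proof -
  obtain \<theta> m where C: "corrected_chain M N F \<xi> Q a b x0 g n \<theta> m"
    and m2: "a\<^sup>2 * (\<Sum>k<n. (m k)\<^sup>2) \<le> b\<^sup>2 * total n"
    and mC: "\<And>C. \<forall>k<n. b * \<rho> (Suc k) \<le> C \<Longrightarrow> 0 \<le> C \<Longrightarrow> \<forall>k\<le>n. m k \<le> C / a"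
    by (rule corrected_exists[where n = n]) (assumption | rule that)+
  interpret corrected_chain M N F \<xi> Q a b x0 g n \<theta> m by fact
  define t where "t = s / \<tau>"
  \<comment> \<open>Twice the uniform corrector bound, so that each corrector is at most L/2;
    \<open>D\<close> below bounds one summand in mean plus two correctors.\<close>
  define L where "L = 2 * b / a * \<eta> * \<tau>"
  define D where "D = (1 + 2 * b / a) * (\<eta> * \<tau>)"
  define B where "B = b * K * (\<eta> * \<tau>)\<^sup>2"
  have b0: "0 < b" using b_ge_1 by simp
  have K0: "0 < K" unfolding K_def using b0 a_pos by (simp add: add_pos_nonneg)
  have t2: "t\<^sup>2 * \<tau>\<^sup>2 = s\<^sup>2" and t3: "\<bar>t\<bar> ^ 3 * \<tau> ^ 3 = \<bar>s\<bar> ^ 3" and t4: "t ^ 4 * \<tau> ^ 4 = s ^ 4"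
    and t1: "\<bar>t\<bar> * \<tau> = \<bar>s\<bar>"
    using \<tau>(1) by (simp_all add: t_def power_divide abs_divide)
  have ml: "m k \<le> b / a * (\<eta> * \<tau>)" if "k \<le> n" for k
    using mC[of "b * (\<eta> * \<tau>)"] \<rho> b0 \<eta> \<tau> that by auto
  have U2m: "u_moment (Suc k) \<le> K * (\<eta> * \<tau>)\<^sup>2" if k: "k < n" for k
  proof -
    have "(\<rho> (Suc k))\<^sup>2 \<le> (\<eta> * \<tau>)\<^sup>2" using \<rho>[OF k] \<rho>_nonneg by (intro power_mono)
    moreover have "(m (Suc k))\<^sup>2 \<le> (b / a * (\<eta> * \<tau>))\<^sup>2" using ml k m_nonneg by (intro power_mono) auto
    ultimately show ?thesis using u_moment_le[of "Suc k"] k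
      by (simp add: K_def power_mult_distrib power_divide algebra_simps)
  qed
  have bU: "b * u_moment (Suc k) \<le> B" if "k < n" for k
    unfolding B_def mult.assoc by (rule mult_left_mono[OF U2m[OF that]]) (use b0 in simp)
  have U2s: "(\<Sum>k<n. b * u_moment (Suc k)) \<le> b * K * \<tau>\<^sup>2"
    using corrected_U2(3)[OF C m2] b0 \<tau>(2) by (simp add: sum_distrib_left[symmetric])
  have main: "norm (expectation (\<lambda>\<omega>. iexp (t * S n \<omega>)) - exp (- (t\<^sup>2 / 2 * expectation (\<lambda>\<omega>. (S n \<omega>)\<^sup>2))))
    \<le> (\<Sum>k<n. remainder t L k + (t\<^sup>2 * mean_var k)\<^sup>2 / 8) + t\<^sup>2 / 2 * (B / a + \<bar>t\<bar> * D * (\<Sum>k<n. b * u_moment (Suc k)) / a)"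
  proof (rule char_S_approx)
    show "\<rho> (Suc k) + m k + m (Suc k) \<le> D" if "k < n" for k
    proof -
      have "D = \<eta> * \<tau> + b / a * (\<eta> * \<tau>) + b / a * (\<eta> * \<tau>)" by (simp add: D_def algebra_simps)
      then show ?thesis using \<rho>[OF that] ml[of k] ml[of "Suc k"] that by linarith
    qed
    show "b * u_moment (Suc k) \<le> B" if "k < n" for k
      using bU that by simp
    show "m k \<le> L / 2" if "k \<le> n" for k using ml[OF that] by (simp add: L_def)
  qed (use b0 K0 a_pos \<eta> \<tau> in \<open>auto simp: D_def B_def\<close>)
  have rem: "(\<Sum>k<n. remainder t L k) \<le> b * (4 * s\<^sup>2 + 6 * \<bar>s\<bar> ^ 3 * (2 * b / a) * (1 + 2 * (b\<^sup>2 / a\<^sup>2))) * \<eta>"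
  proof -
    define T where "T = (\<Sum>k<n. tail L (Suc k))"
    define R where "R = (\<Sum>k<n. (\<rho> (Suc k))\<^sup>2 + (m k)\<^sup>2 + (m (Suc k))\<^sup>2)"
    have T: "T \<le> \<eta> * \<tau>\<^sup>2" using lind by (simp add: T_def tail_def L_def)
    have R: "R \<le> (1 + 2 * (b\<^sup>2 / a\<^sup>2)) * \<tau>\<^sup>2"
      using corrected_U2(1,2)[OF C m2] by (simp add: R_def sum.distrib total_def[symmetric] \<tau>(2) algebra_simps)
    have "(\<Sum>k<n. remainder t L k) = b * (4 * t\<^sup>2 * T + 6 * \<bar>t\<bar> ^ 3 * L * R)"
      unfolding remainder_def T_def R_def by (simp add: sum.distrib sum_distrib_left[symmetric])
    also have "\<dots> \<le> b * (4 * t\<^sup>2 * (\<eta> * \<tau>\<^sup>2) + 6 * \<bar>t\<bar> ^ 3 * L * ((1 + 2 * (b\<^sup>2 / a\<^sup>2)) * \<tau>\<^sup>2))"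
      using T R b0 a_pos \<eta> \<tau> by (intro mult_left_mono add_mono) (auto simp: L_def)
    also have "\<dots> = b * (4 * (t\<^sup>2 * \<tau>\<^sup>2) + 6 * (\<bar>t\<bar> ^ 3 * \<tau> ^ 3) * (2 * b / a) * (1 + 2 * (b\<^sup>2 / a\<^sup>2))) * \<eta>"
      by (simp add: L_def algebra_simps power2_eq_square power3_eq_cube)
    finally show ?thesis unfolding t2 t3 .
  qed
  have evs: "(\<Sum>k<n. (t\<^sup>2 * mean_var k)\<^sup>2 / 8) \<le> s ^ 4 * (b * K) * (b * K) / 8 * \<eta>"
  proof -
    have "(t\<^sup>2 * mean_var k)\<^sup>2 / 8 \<le> t ^ 4 * B / 8 * (b * u_moment (Suc k))" if k: "k < n" for k
    proof -
      have "mean_var k \<le> B" using mean_var_bounds(3)[OF k] bU[OF k] by simp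
      then have "mean_var k * mean_var k \<le> B * (b * u_moment (Suc k))"
        using mean_var_bounds[OF k] b0 K0 by (intro mult_mono) (auto simp: B_def)
      then have "t ^ 4 * (mean_var k * mean_var k) \<le> t ^ 4 * (B * (b * u_moment (Suc k)))"
        by (rule mult_left_mono) simp
      then show ?thesis by (simp add: power_mult_distrib power2_eq_square mult_ac numeral_eq_Suc)
    qed
    then have "(\<Sum>k<n. (t\<^sup>2 * mean_var k)\<^sup>2 / 8) \<le> (\<Sum>k<n. t ^ 4 * B / 8 * (b * u_moment (Suc k)))" by (intro sum_mono) auto
    also have "\<dots> = t ^ 4 * B / 8 * (\<Sum>k<n. b * u_moment (Suc k))"
      by (simp only: sum_distrib_left)
    also have "\<dots> \<le> t ^ 4 * B / 8 * (b * K * \<tau>\<^sup>2)"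
      by (rule mult_left_mono[OF U2s]) (use b0 K0 in \<open>auto simp: B_def\<close>)
    also have "\<dots> = (t ^ 4 * \<tau> ^ 4) * (b * K) * (b * K) / 8 * \<eta>\<^sup>2"
      by (simp add: B_def power_mult_distrib numeral_eq_Suc)
    also have "\<dots> \<le> (t ^ 4 * \<tau> ^ 4) * (b * K) * (b * K) / 8 * \<eta>"
      using \<eta> b0 K0 by (intro mult_left_mono) (auto simp: power2_eq_square mult_le_cancel_left1)
    finally show ?thesis unfolding t4 .
  qed
  have fl: "t\<^sup>2 / 2 * (B / a + \<bar>t\<bar> * D * (\<Sum>k<n. b * u_moment (Suc k)) / a)
    \<le> s\<^sup>2 / 2 * (b * K / a + \<bar>s\<bar> * (1 + 2 * b / a) * (b * K) / a) * \<eta>"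
  proof -
    have D0: "0 \<le> D" using b0 a_pos \<eta> \<tau> by (simp add: D_def)
    have "B \<le> b * K * (\<eta> * \<tau>\<^sup>2)"
    proof -
      have "(\<eta> * \<tau>)\<^sup>2 = \<eta> * (\<eta> * \<tau>\<^sup>2)" by (simp add: power2_eq_square)
      also have "\<dots> \<le> \<eta> * \<tau>\<^sup>2"
        using \<eta> mult_right_mono[OF \<eta>(2), of "\<tau>\<^sup>2"] by (intro mult_left_mono) auto
      finally show ?thesis unfolding B_def using b0 K0 by (intro mult_left_mono) auto
    qed
    then have "t\<^sup>2 / 2 * (B / a + \<bar>t\<bar> * D * (\<Sum>k<n. b * u_moment (Suc k)) / a)
      \<le> t\<^sup>2 / 2 * (b * K * (\<eta> * \<tau>\<^sup>2) / a + \<bar>t\<bar> * D * (b * K * \<tau>\<^sup>2) / a)"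
      using U2s a_pos D0 by (intro mult_left_mono add_mono divide_right_mono) auto
    also have "\<dots> = (t\<^sup>2 * \<tau>\<^sup>2) / 2 * (b * K / a + (\<bar>t\<bar> * \<tau>) * (1 + 2 * b / a) * (b * K) / a) * \<eta>"
      by (simp add: D_def algebra_simps add_divide_distrib)
    finally show ?thesis unfolding t2 t1 .
  qed
  show ?thesis
    using main rem evs fl unfolding clt_const_def t_def[symmetric] sum.distrib distrib_right by linarith
qed

end

section \<open>From the Markov property to comparable chains\<close>

lemma ereal_SUP_tendsto_0:
  fixes f :: "nat \<Rightarrow> real \<Rightarrow> real"
  assumes nonneg: "\<And>n u. 0 \<le> f n u"
    and small: "\<And>e. 0 < e \<Longrightarrow> \<forall>\<^sub>F n in sequentially. \<forall>u. f n u \<le> e"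
  shows "(\<lambda>n. SUP u. ereal (f n u)) \<longlonglongrightarrow> 0"
proof (rule order_tendstoI)
  fix a :: ereal assume "a < 0"
  have "0 \<le> (SUP u. ereal (f n u))" for n
    by (rule SUP_upper2[of 0]) (auto simp: nonneg)
  then show "\<forall>\<^sub>F n in sequentially. a < (SUP u. ereal (f n u))"
    using \<open>a < 0\<close> by (intro always_eventually allI) (rule less_le_trans)
next
  fix a :: ereal assume "0 < a"
  then obtain e where e: "0 < ereal e" "ereal e < a" using ereal_dense2 by blast
  then have "\<forall>\<^sub>F n in sequentially. \<forall>u. f n u \<le> e" by (intro small) simp
  then show "\<forall>\<^sub>F n in sequentially. (SUP u. ereal (f n u)) < a"
  proof eventually_elim
    case (elim n)
    then have "(SUP u. ereal (f n u)) \<le> ereal e" by (intro SUP_least) simp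
    then show ?case using e(2) by (rule le_less_trans)
  qed
qed

lemma generated_sigma_props:
  assumes "\<And>j. j \<in> J \<Longrightarrow> \<xi> j \<in> M \<rightarrow>\<^sub>M N"
  shows subalgebra_generated_sigma: "subalgebra M (generated_sigma M N \<xi> J)"
    and measurable_generated_sigma: "j \<in> J \<Longrightarrow> \<xi> j \<in> generated_sigma M N \<xi> J \<rightarrow>\<^sub>M N"
    and generated_sigma_mono: "J' \<subseteq> J \<Longrightarrow> subalgebra (generated_sigma M N \<xi> J) (generated_sigma M N \<xi> J')"
proof -
  let ?G = "\<lambda>J. \<Union>j\<in>J. {\<xi> j -` A \<inter> space M |A. A \<in> sets N}"
  have G: "?G J \<subseteq> sets M" using assms by (auto intro: measurable_sets)
  then have GP: "?G J \<subseteq> Pow (space M)" using sets.space_closed by blast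
  have space: "space (generated_sigma M N \<xi> K) = space M" for K
    by (simp add: generated_sigma_def space_measure_of_conv)
  have sets: "sets (generated_sigma M N \<xi> J) = sigma_sets (space M) (?G J)"
    unfolding generated_sigma_def using GP by (rule sets_measure_of)
  show "subalgebra M (generated_sigma M N \<xi> J)"
    unfolding subalgebra_def space sets using G by (auto intro!: sets.sigma_sets_subset)
  show "\<xi> j \<in> generated_sigma M N \<xi> J \<rightarrow>\<^sub>M N" if "j \<in> J"
  proof (rule measurableI)
    show "\<xi> j x \<in> space N" if "x \<in> space (generated_sigma M N \<xi> J)" for x
      using measurable_space[OF assms[OF \<open>j \<in> J\<close>]] that by (simp add: space)
    show "\<xi> j -` A \<inter> space (generated_sigma M N \<xi> J) \<in> sets (generated_sigma M N \<xi> J)" if "A \<in> sets N" for A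
      unfolding space sets using \<open>j \<in> J\<close> that by (intro sigma_sets.Basic) auto
  qed
  show "subalgebra (generated_sigma M N \<xi> J) (generated_sigma M N \<xi> J')" if "J' \<subseteq> J"
  proof -
    have "?G J' \<subseteq> ?G J" using that by blast
    moreover from this have "sets (generated_sigma M N \<xi> J') = sigma_sets (space M) (?G J')"
      unfolding generated_sigma_def using GP by (intro sets_measure_of) blast
    ultimately show ?thesis
      unfolding subalgebra_def space sets by (auto intro: sigma_sets_mono'[THEN subsetD])
  qed
qed

text \<open>Modifying the kernels on null sets makes the two-sided bounds hold at every point of the state
  space; a constant state at time \<open>0\<close> turns the first step into an ordinary transition.\<close>

lemma comparable_chain_exists:
  fixes Q :: "nat \<Rightarrow> 's \<Rightarrow> 's measure"
  assumes "prob_space M"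
    and markov: "markov_chain M N \<xi>"
    and trans: "regular_transitions M N \<xi> Q"
    and a: "0 < a"
    and bounds: "\<And>k. 2 \<le> k \<Longrightarrow> \<exists>S'\<in>sets N.
           measure (marginal M N \<xi> (k - 1)) S' = 1 \<and>
           (\<forall>A\<in>sets N. \<forall>x\<in>S'.
              a * measure (marginal M N \<xi> k) A \<le> measure (Q k x) A \<and>
              measure (Q k x) A \<le> b * measure (marginal M N \<xi> k) A)"
  obtains F x0 Q' where "comparable_chain M N F (\<lambda>k. if k = 0 then (\<lambda>_. x0) else \<xi> k) Q' a b"
proof -
  interpret prob_space M by fact
  have \<xi>[measurable]: "\<xi> k \<in> M \<rightarrow>\<^sub>M N" if "1 \<le> k" for k
    using markov that by (auto simp: markov_chain_def)
  obtain \<omega>0 where \<omega>0: "\<omega>0 \<in> space M" using not_empty by blast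
  \<comment> \<open>Any point of the state space would do; a value of the chain shows that there is
    one.\<close>
  define x0 where "x0 = \<xi> 1 \<omega>0"
  have x0: "x0 \<in> space N" using measurable_space[OF \<xi>[of 1] \<omega>0] by (simp add: x0_def)
  have "\<forall>k. \<exists>T. T \<in> sets N \<and> (2 \<le> k \<longrightarrow> measure (marginal M N \<xi> (k - 1)) T = 1 \<and>
      (\<forall>A\<in>sets N. \<forall>x\<in>T. a * measure (marginal M N \<xi> k) A \<le> measure (Q k x) A \<and>
              measure (Q k x) A \<le> b * measure (marginal M N \<xi> k) A))"
    using bounds by (metis sets.empty_sets)
  then obtain T where T[measurable]: "\<And>k. T k \<in> sets N"
    and T1: "\<And>k. 2 \<le> k \<Longrightarrow> measure (marginal M N \<xi> (k - 1)) (T k) = 1"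
    and TQ: "\<And>k A x. 2 \<le> k \<Longrightarrow> A \<in> sets N \<Longrightarrow> x \<in> T k \<Longrightarrow>
        a * measure (marginal M N \<xi> k) A \<le> measure (Q k x) A \<and> measure (Q k x) A \<le> b * measure (marginal M N \<xi> k) A"
    by metis
  have Qk: "Q k \<in> N \<rightarrow>\<^sub>M prob_algebra N" if "2 \<le> k" for k
    using trans that by (auto simp: regular_transitions_def)
  have marg: "prob_space (marginal M N \<xi> k)" "sets (marginal M N \<xi> k) = sets N" "space (marginal M N \<xi> k) = space N"
    if "1 \<le> k" for k
    using prob_space_distr[OF \<xi>[OF that]] by (simp_all add: marginal_def)
  have AE_T: "AE \<omega> in M. \<xi> k \<omega> \<in> T (Suc k)" if "1 \<le> k" for k
  proof -
    interpret m: prob_space "marginal M N \<xi> k" using marg that by blast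
    have "AE x in marginal M N \<xi> k. x \<in> T (Suc k)"
      using m.AE_prob_1[of "T (Suc k)"] T1[of "Suc k"] that by simp
    then show ?thesis unfolding marginal_def by (rule AE_distrD[OF \<xi>[OF that]])
  qed
  \<comment> \<open>Comparing total masses at one good point gives a \<le> 1 \<le> b. This is
    required wherever the modified kernel equals the marginal, since the bounds then compare that
    law with itself.\<close>
  obtain x2 where x2: "x2 \<in> T 2"
    using T1[of 2] by fastforce
  then have "x2 \<in> space N" using sets.sets_into_space[OF T] by blast
  then have "prob_space (Q 2 x2)" "sets (Q 2 x2) = sets N"
    using measurable_space[OF Qk[of 2]] by (auto simp: space_prob_algebra)
  then have "measure (Q 2 x2) (space N) = 1"
    using prob_space.prob_space sets_eq_imp_space_eq by metis
  moreover have "measure (marginal M N \<xi> 2) (space N) = 1"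
    using prob_space.prob_space[OF marg(1)[of 2]] marg(3)[of 2] by simp
  ultimately have ab: "a \<le> 1" "1 \<le> b"
    using TQ[OF _ _ x2, of "space N"] by auto
  define \<xi>' where "\<xi>' k = (if k = 0 then (\<lambda>_. x0) else \<xi> k)" for k
  define F where "F k = generated_sigma M N \<xi> {1..k}" for k
  \<comment> \<open>Indices shift by one: \<open>Q' k\<close> leads out of time \<open>k\<close>,
    \<open>Q (Suc k)\<close> into time \<open>Suc k\<close>. Off the good set, and from time 0, the
    next state is drawn from its marginal law.\<close>
  define Q' where "Q' k x = (if 1 \<le> k \<and> x \<in> T (Suc k) then Q (Suc k) x else marginal M N \<xi> (Suc k))" for k x
  have \<xi>'_Suc: "\<xi>' (Suc k) = \<xi> (Suc k)" for k by (simp add: \<xi>'_def)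
  have sub: "subalgebra M (F k)" for k
    unfolding F_def by (rule subalgebra_generated_sigma) auto
  have cm: "(\<lambda>x. marginal M N \<xi> (Suc k)) \<in> N \<rightarrow>\<^sub>M prob_algebra N" for k
    using marg[of "Suc k"] by (intro measurable_const) (simp add: space_prob_algebra)
  have Q'_kernel: "Q' k \<in> N \<rightarrow>\<^sub>M prob_algebra N" for k
  proof (cases "1 \<le> k")
    case True
    then show ?thesis
      unfolding Q'_def[abs_def] using Qk[of "Suc k"] cm[of k] by (simp add: measurable_If_set)
  qed (use cm in \<open>simp add: Q'_def[abs_def]\<close>)
  have "comparable_chain M N F \<xi>' Q' a b"
  proof (intro comparable_chain.intro comparable_chain_axioms.intro)
    show "prob_space M" by fact
    show "subalgebra M (F k)" for k by (rule sub)
    show "subalgebra (F (Suc k)) (F k)" for k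
      unfolding F_def by (rule generated_sigma_mono) auto
    show "\<xi>' k \<in> F k \<rightarrow>\<^sub>M N" for k
      unfolding F_def \<xi>'_def using x0 by (auto intro!: measurable_generated_sigma)
    show "Q' k \<in> N \<rightarrow>\<^sub>M prob_algebra N" for k by (rule Q'_kernel)
    show "0 < a" by fact
    show "a * measure (distr M N (\<xi>' (Suc k))) B \<le> measure (Q' k x) B \<and>
        measure (Q' k x) B \<le> b * measure (distr M N (\<xi>' (Suc k))) B"
      if "x \<in> space N" "B \<in> sets N" for k x B
    proof (cases "1 \<le> k \<and> x \<in> T (Suc k)")
      case True
      then show ?thesis using TQ[of "Suc k" B x] that by (simp add: Q'_def \<xi>'_Suc marginal_def)
    next
      case False
      then have "Q' k x = distr M N (\<xi>' (Suc k))" by (auto simp: Q'_def \<xi>'_Suc marginal_def)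
      then show ?thesis
        using mult_right_mono[OF ab(1), of "measure (Q' k x) B"] mult_right_mono[OF ab(2), of "measure (Q' k x) B"] by simp
    qed
    show "measure M (A \<inter> (\<xi>' (Suc k) -` B \<inter> space M)) = (\<integral>\<omega>. indicator A \<omega> * measure (Q' k (\<xi>' k \<omega>)) B \<partial>M)"
      if A: "A \<in> sets (F k)" and B[measurable]: "B \<in> sets N" for k A B
    proof (cases "k = 0")
      case True
      \<comment> \<open>At time 0 the generating index set is empty and the past is trivial, so the
        transition identity reduces to total mass.\<close>
      have "sets (F k) = {{}, space M}"
        using True by (simp add: F_def generated_sigma_def sigma_sets_empty_eq)
      then show ?thesis
        using A True \<xi>[of 1] by (auto simp: Q'_def \<xi>'_Suc marginal_def measure_distr prob_space)
    next
      case False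
      then have k: "1 \<le> k" "2 \<le> Suc k" by auto
      interpret S: finite_measure_subalgebra M "F k" by standard (rule sub)
      define I where "I = (indicator (\<xi> (Suc k) -` B \<inter> space M) :: 'a \<Rightarrow> real)"
      have E[measurable]: "\<xi> (Suc k) -` B \<inter> space M \<in> sets M" by (rule measurable_sets[OF \<xi> B]) simp
      have AM[measurable]: "A \<in> sets M" using A sub[of k] by (auto simp: subalgebra_def)
      have i: "integrable M I" unfolding I_def using E by (intro integrable_real_indicator) (auto simp: emeasure_eq_measure)
      have AE1: "AE \<omega> in M. real_cond_exp M (F k) I \<omega> = measure (Q (Suc k) (\<xi> k \<omega>)) B"
      proof -
        have "AE \<omega> in M. real_cond_exp M (F k) I \<omega> = real_cond_exp M (generated_sigma M N \<xi> {k}) I \<omega>"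
          using markov k(2) B unfolding markov_chain_def F_def I_def by fastforce
        moreover have "AE \<omega> in M. real_cond_exp M (generated_sigma M N \<xi> {k}) I \<omega> = measure (Q (Suc k) (\<xi> k \<omega>)) B"
          using trans k(2) B unfolding regular_transitions_def I_def by fastforce
        ultimately show ?thesis by eventually_elim simp
      qed
      \<comment> \<open>The modification is invisible almost surely, because the chain visits the
        good set with probability 1.\<close>
      have AE2: "AE \<omega> in M. indicator A \<omega> * real_cond_exp M (F k) I \<omega> = indicator A \<omega> * measure (Q' k (\<xi>' k \<omega>)) B"
        using AE1 AE_T[OF k(1)] by eventually_elim (use k in \<open>auto simp: Q'_def \<xi>'_def\<close>)
      have Q'm: "(\<lambda>\<omega>. measure (Q' k (\<xi>' k \<omega>)) B) \<in> borel_measurable M"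
      proof -
        have "(\<lambda>x. measure (Q' k x) B) \<in> borel_measurable N"
          using measurable_compose[OF measurable_prob_algebraD[OF Q'_kernel] measurable_measure_subprob_algebra[OF B]] .
        then show ?thesis using measurable_compose[OF \<xi>[OF k(1)]] False by (simp add: \<xi>'_def)
      qed
      have "measure M (A \<inter> (\<xi>' (Suc k) -` B \<inter> space M)) = (\<integral>\<omega>. indicator (A \<inter> (\<xi> (Suc k) -` B \<inter> space M)) \<omega> \<partial>M)"
        using AM E by (simp add: \<xi>'_Suc)
      also have "\<dots> = (\<integral>\<omega>\<in>A. I \<omega> \<partial>M)"
        unfolding set_lebesgue_integral_def I_def by (intro Bochner_Integration.integral_cong) (auto simp: indicator_def)
      also have "\<dots> = (\<integral>\<omega>\<in>A. real_cond_exp M (F k) I \<omega> \<partial>M)"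
        using i A by (rule S.real_cond_exp_intA)
      also have "\<dots> = (\<integral>\<omega>. indicator A \<omega> * measure (Q' k (\<xi>' k \<omega>)) B \<partial>M)"
        unfolding set_lebesgue_integral_def using AE2 Q'm AM by (intro integral_cong_AE) auto
      finally show ?thesis .
    qed
  qed
  then show thesis unfolding \<xi>'_def by (rule that)
qed

section \<open>Asymptotics of the characteristic function of the sum\<close>

context centered_chain begin

lemma norm_char_S_le:
  "norm (expectation (\<lambda>\<omega>. iexp (t * S n \<omega>)))
    \<le> exp 1 * exp (- (a\<^sup>2 / 4 * (\<Sum>k=1..n. 1 - (norm (expectation (\<lambda>\<omega>. iexp (t * g k (\<xi> k \<omega>)))))\<^sup>2)))"
proof -
  have "(\<Prod>i\<in>{0<..n}. iexp (t * g i (\<xi> i \<omega>))) = iexp (t * S n \<omega>)" for \<omega>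
    by (simp add: S_def sum_distrib_left exp_sum)
  moreover have "(\<integral>x. iexp (t * g i x) \<partial>P i) = expectation (\<lambda>\<omega>. iexp (t * g i (\<xi> i \<omega>)))" for i
    by (rule integral_distr) measurable
  moreover have "{0<..n} = {1..n}" by auto
  ultimately show ?thesis
    using norm_expectation_prod_le_exp[of "\<lambda>i x. iexp (t * g i x)" n] by simp
qed

text \<open>Lindeberg's condition is used at two levels: at \<eta>/2 to make every single standard
  deviation at most \<eta>\<tau>_n, and at 2(b/a)\<eta>, the truncation level of the Taylor
  remainder.\<close>

lemma char_S_limit:
  fixes \<tau> :: "nat \<Rightarrow> real"
  assumes \<tau>: "\<And>n. 0 \<le> \<tau> n" "\<And>n. (\<tau> n)\<^sup>2 = total n" "filterlim \<tau> at_top sequentially"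
    and lindeberg: "\<And>\<epsilon>. 0 < \<epsilon> \<Longrightarrow> (\<lambda>n. 1 / (\<tau> n)\<^sup>2 *
      (\<Sum>k<n. \<integral>x. (g (Suc k) x)\<^sup>2 * indicator {x. \<bar>g (Suc k) x\<bar> \<ge> \<epsilon> * \<tau> n} x \<partial>P (Suc k))) \<longlonglongrightarrow> 0"
  shows "(\<lambda>n. expectation (\<lambda>\<omega>. iexp (s / \<tau> n * S n \<omega>))
      - exp (- ((s / \<tau> n)\<^sup>2 / 2 * expectation (\<lambda>\<omega>. (S n \<omega>)\<^sup>2)))) \<longlonglongrightarrow> 0"
proof (rule LIMSEQ_I)
  fix r :: real assume r: "0 < r"
  define T where "T \<epsilon> n k = (\<integral>x. (g k x)\<^sup>2 * indicator {x. \<bar>g k x\<bar> \<ge> \<epsilon> * \<tau> n} x \<partial>P k)" for \<epsilon> n k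
  define C where "C = \<bar>clt_const s\<bar> + 1"
  define \<eta> where "\<eta> = min 1 (r / (2 * C))"
  have C: "0 < C" by (simp add: C_def)
  have \<eta>: "0 < \<eta>" "\<eta> \<le> 1" "C * \<eta> < r"
  proof -
    show "0 < \<eta>" "\<eta> \<le> 1" using r C by (auto simp: \<eta>_def)
    have "C * \<eta> \<le> C * (r / (2 * C))" using C by (intro mult_left_mono) (auto simp: \<eta>_def)
    also have "\<dots> < r" using r C by simp
    finally show "C * \<eta> < r" .
  qed
  have b0: "0 < b" using b_ge_1 by simp
  have T: "\<forall>\<^sub>F n in sequentially. (\<Sum>k<n. T \<epsilon> n (Suc k)) \<le> e * (\<tau> n)\<^sup>2" if "0 < \<epsilon>" "0 < e" for \<epsilon> e
  proof -
    have "\<forall>\<^sub>F n in sequentially. 1 / (\<tau> n)\<^sup>2 * (\<Sum>k<n. T \<epsilon> n (Suc k)) < e"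
      using lindeberg[OF that(1)] that(2) unfolding T_def by (rule order_tendstoD)
    moreover have "\<forall>\<^sub>F n in sequentially. 0 < \<tau> n" using \<tau>(3) by (simp add: filterlim_at_top_dense)
    ultimately show ?thesis by eventually_elim (simp add: field_simps)
  qed
  have "\<forall>\<^sub>F n in sequentially. 0 < \<tau> n" using \<tau>(3) by (simp add: filterlim_at_top_dense)
  moreover have "\<forall>\<^sub>F n in sequentially. (\<Sum>k<n. T (\<eta> / 2) n (Suc k)) \<le> \<eta>\<^sup>2 / 2 * (\<tau> n)\<^sup>2"
    using \<eta> by (intro T) auto
  moreover have "\<forall>\<^sub>F n in sequentially. (\<Sum>k<n. T (2 * b / a * \<eta>) n (Suc k)) \<le> \<eta> * (\<tau> n)\<^sup>2"
    using \<eta> a_pos b0 by (intro T) auto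
  ultimately have "\<forall>\<^sub>F n in sequentially. norm (expectation (\<lambda>\<omega>. iexp (s / \<tau> n * S n \<omega>))
      - exp (- ((s / \<tau> n)\<^sup>2 / 2 * expectation (\<lambda>\<omega>. (S n \<omega>)\<^sup>2))) - 0) < r"
  proof eventually_elim
    case (elim n)
    have T0: "0 \<le> T \<epsilon> n k" for \<epsilon> k
      unfolding T_def by (intro integral_nonneg_AE AE_I2) auto
    \<comment> \<open>The second moment splits at level \<eta>\<tau>_n/2: the small values give
      \<eta>^2/4 and the tail at most \<eta>^2/2, in units of \<tau>_n^2, together below
      \<eta>^2.\<close>
    have \<rho>: "\<rho> (Suc k) \<le> \<eta> * \<tau> n" if k: "k < n" for k
    proof -
      interpret Pk: prob_space "P (Suc k)" by (rule prob_space_distr) simp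
      have ti: "integrable (P (Suc k)) (\<lambda>x. (g (Suc k) x)\<^sup>2 * indicator {x. \<bar>g (Suc k) x\<bar> \<ge> \<eta> / 2 * \<tau> n} x)"
        by (rule Bochner_Integration.integrable_bound[OF g_square[of "Suc k"]]) (auto simp: indicator_def)
      have "(\<rho> (Suc k))\<^sup>2 \<le> (\<integral>x. (\<eta> / 2 * \<tau> n)\<^sup>2 + (g (Suc k) x)\<^sup>2 * indicator {x. \<bar>g (Suc k) x\<bar> \<ge> \<eta> / 2 * \<tau> n} x \<partial>P (Suc k))"
        unfolding \<rho>_square
      proof (rule integral_mono)
        fix x
        show "(g (Suc k) x)\<^sup>2 \<le> (\<eta> / 2 * \<tau> n)\<^sup>2 + (g (Suc k) x)\<^sup>2 * indicator {x. \<bar>g (Suc k) x\<bar> \<ge> \<eta> / 2 * \<tau> n} x"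
        proof (cases "\<bar>g (Suc k) x\<bar> \<ge> \<eta> / 2 * \<tau> n")
          case False
          then have "\<bar>g (Suc k) x\<bar>\<^sup>2 \<le> (\<eta> / 2 * \<tau> n)\<^sup>2" by (intro power_mono) auto
          then show ?thesis using False by simp
        qed simp
      qed (use g_square ti in auto)
      also have "\<dots> = (\<eta> / 2 * \<tau> n)\<^sup>2 + T (\<eta> / 2) n (Suc k)"
        using ti Pk.prob_space by (simp add: T_def)
      also have "T (\<eta> / 2) n (Suc k) \<le> (\<Sum>k<n. T (\<eta> / 2) n (Suc k))"
        using k T0 by (intro member_le_sum) auto
      also note elim(2)
      also have "(\<eta> / 2 * \<tau> n)\<^sup>2 + \<eta>\<^sup>2 / 2 * (\<tau> n)\<^sup>2 \<le> (\<eta> * \<tau> n)\<^sup>2"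
        by (simp add: power_mult_distrib power_divide)
      finally have "(\<rho> (Suc k))\<^sup>2 \<le> (\<eta> * \<tau> n)\<^sup>2" by simp
      then show ?thesis
        by (rule power2_le_imp_le) (rule mult_nonneg_nonneg[OF less_imp_le[OF \<eta>(1)] \<tau>(1)])
    qed
    have "norm (expectation (\<lambda>\<omega>. iexp (s / \<tau> n * S n \<omega>))
        - exp (- ((s / \<tau> n)\<^sup>2 / 2 * expectation (\<lambda>\<omega>. (S n \<omega>)\<^sup>2)))) \<le> clt_const s * \<eta>"
      using elim(3) by (intro char_S_clt \<eta>(1,2) elim(1) \<tau>(2) \<rho>) (auto simp: T_def)
    also have "\<dots> \<le> C * \<eta>" using \<eta>(1) by (intro mult_right_mono) (auto simp: C_def)
    finally show ?case using \<eta>(3) by simp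
  qed
  then show "\<exists>n0. \<forall>n\<ge>n0. norm (expectation (\<lambda>\<omega>. iexp (s / \<tau> n * S n \<omega>))
      - exp (- ((s / \<tau> n)\<^sup>2 / 2 * expectation (\<lambda>\<omega>. (S n \<omega>)\<^sup>2))) - 0) < r"
    by (simp add: eventually_sequentially)
qed

end

text \<open>Near each u \<noteq> 0, Condition B turns the exponential bound into e \<tau>_n^(-c)
  with c > 1, so even \<tau>_n times it tends to 0. Compactness of the range \<delta> \<le>
  \<bar>t\<bar> \<le> L reduces uniformity to finitely many such neighbourhoods.\<close>

lemma uniform_decay_off_origin:
  fixes \<phi> :: "nat \<Rightarrow> real \<Rightarrow> complex" and d :: "nat \<Rightarrow> real \<Rightarrow> real"
  assumes \<tau>: "filterlim \<tau> at_top sequentially"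
    and \<phi>: "\<And>n t. norm (\<phi> n t) \<le> exp 1 * exp (- (\<gamma> / 8 * d n t))"
    and B: "\<And>u::real. u \<noteq> 0 \<Longrightarrow> \<exists>c>1. \<exists>l r. l < u \<and> u < r \<and>
             (\<exists>n0::nat. \<forall>t\<in>{l<..<r}. \<forall>n>n0. \<gamma> / (8 * ln (\<tau> n)) * d n t \<ge> c)"
    and \<delta>: "0 < \<delta>" and \<epsilon>: "0 < \<epsilon>"
  shows "\<forall>\<^sub>F n in sequentially. \<forall>t. \<delta> \<le> \<bar>t\<bar> \<and> \<bar>t\<bar> \<le> L \<longrightarrow> \<tau> n * norm (\<phi> n t) \<le> \<epsilon>"
proof -
  have local: "\<exists>U. open U \<and> u \<in> U \<and> (\<forall>\<^sub>F n in sequentially. \<forall>t\<in>U. \<tau> n * norm (\<phi> n t) \<le> \<epsilon>)" if u0: "u \<noteq> 0" for u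
  proof -
    obtain c l r n0 where c: "1 < c" and u: "l < u" "u < r"
      and n0: "\<And>t n. t \<in> {l<..<r} \<Longrightarrow> n0 < n \<Longrightarrow> c \<le> \<gamma> / (8 * ln (\<tau> n)) * d n t"
      using B[OF u0] by metis
    \<comment> \<open>The strict inequality c > 1 makes the exponent 1 - c negative.\<close>
    have "((\<lambda>x::real. exp 1 * x powr (1 - c)) \<longlongrightarrow> exp 1 * 0) at_top"
      using c by (intro tendsto_mult tendsto_const tendsto_neg_powr filterlim_ident) auto
    then have "(\<lambda>n. exp 1 * \<tau> n powr (1 - c)) \<longlonglongrightarrow> exp 1 * 0"
      using \<tau> by (rule filterlim_compose)
    then have "\<forall>\<^sub>F n in sequentially. exp 1 * \<tau> n powr (1 - c) < \<epsilon>"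
      using \<epsilon> by (intro order_tendstoD) auto
    moreover have "\<forall>\<^sub>F n in sequentially. 1 < \<tau> n" using \<tau> by (simp add: filterlim_at_top_dense)
    ultimately have "\<forall>\<^sub>F n in sequentially. \<forall>t\<in>{l<..<r}. \<tau> n * norm (\<phi> n t) \<le> \<epsilon>"
      using eventually_gt_at_top[of n0]
    proof eventually_elim
      case (elim n)
      show ?case
      proof
        fix t assume t: "t \<in> {l<..<r}"
        have ln: "0 < ln (\<tau> n)" using elim(2) by simp
        have "c * ln (\<tau> n) \<le> \<gamma> / (8 * ln (\<tau> n)) * d n t * ln (\<tau> n)"
          using n0[OF t elim(3)] ln by (intro mult_right_mono) auto
        also have "\<dots> = \<gamma> / 8 * d n t" using ln by simp
        finally have "norm (\<phi> n t) \<le> exp 1 * exp (- (c * ln (\<tau> n)))"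
          using \<phi>[of n t] by (elim order_trans) simp
        then have "\<tau> n * norm (\<phi> n t) \<le> \<tau> n * (exp 1 * exp (- (c * ln (\<tau> n))))"
          using elim(2) by (intro mult_left_mono) auto
        also have "\<dots> = exp 1 * \<tau> n powr (1 - c)"
        proof -
          have "\<tau> n * exp (- (c * ln (\<tau> n))) = exp (ln (\<tau> n)) * exp (- (c * ln (\<tau> n)))" using elim(2) by simp
          also have "\<dots> = exp (ln (\<tau> n) + - (c * ln (\<tau> n)))" by (rule exp_add[symmetric])
          also have "\<dots> = \<tau> n powr (1 - c)" using elim(2) by (simp add: powr_def algebra_simps)
          finally show ?thesis by simp
        qed
        finally show "\<tau> n * norm (\<phi> n t) \<le> \<epsilon>" using elim(1) by simp
      qed
    qed
    then show ?thesis using u by (intro exI[of _ "{l<..<r}"]) auto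
  qed
  define K where "K = cball 0 L - ball (0::real) \<delta>"
  have "compact K" unfolding K_def by (intro compact_diff) auto
  define C where "C = {U. open U \<and> (\<forall>\<^sub>F n in sequentially. \<forall>t\<in>U. \<tau> n * norm (\<phi> n t) \<le> \<epsilon>)}"
  have "K \<subseteq> \<Union>C"
  proof
    fix u assume "u \<in> K"
    then have "u \<noteq> 0" using \<delta> by (auto simp: K_def)
    from local[OF this] show "u \<in> \<Union>C" unfolding C_def by blast
  qed
  then obtain D where D: "D \<subseteq> C" "finite D" "K \<subseteq> \<Union>D"
    using compactE[OF \<open>compact K\<close>, of C] unfolding C_def by blast
  have "\<forall>\<^sub>F n in sequentially. \<forall>U\<in>D. \<forall>t\<in>U. \<tau> n * norm (\<phi> n t) \<le> \<epsilon>"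
    using D(1,2) by (intro eventually_ball_finite) (auto simp: C_def)
  then show ?thesis
  proof eventually_elim
    case (elim n)
    show ?case
    proof (intro allI impI)
      fix t assume "\<delta> \<le> \<bar>t\<bar> \<and> \<bar>t\<bar> \<le> L"
      then have "t \<in> K" by (auto simp: K_def)
      then show "\<tau> n * norm (\<phi> n t) \<le> \<epsilon>" using D(3) elim by blast
    qed
  qed
qed

section \<open>Verification of the local limit hypotheses for the chain\<close>

theorem theorem1:
  fixes M :: "'a measure" and N :: "'s measure"
    and \<xi> :: "nat \<Rightarrow> 'a \<Rightarrow> 's" and Q :: "nat \<Rightarrow> 's \<Rightarrow> 's measure"
    and g :: "nat \<Rightarrow> 's \<Rightarrow> real" and X :: "nat \<Rightarrow> 'a \<Rightarrow> real"
    and \<sigma> \<tau> :: "nat \<Rightarrow> real" and f :: "nat \<Rightarrow> real \<Rightarrow> complex"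
    and a b \<gamma> :: real
    and h :: "real \<Rightarrow> real"
  assumes "prob_space M"
    and "markov_chain M N \<xi>"
    and "regular_transitions M N \<xi> Q"
    and "\<And>j. 1 \<le> j \<Longrightarrow> g j \<in> borel_measurable N"
    and X: "\<And>j \<omega>. 1 \<le> j \<Longrightarrow> X j \<omega> = g j (\<xi> j \<omega>)"
    and "\<And>j. 1 \<le> j \<Longrightarrow> integrable M (\<lambda>\<omega>. (X j \<omega>)\<^sup>2)"
    and "\<And>j. 1 \<le> j \<Longrightarrow> (LINT \<omega>|M. X j \<omega>) = 0"
    and \<sigma>: "\<sigma> = sum_sd M X"
    and \<tau>: "\<tau> = root_sum_var M X"
    and f: "f = char_fun M X"
    and "filterlim (\<lambda>n. (\<tau> n)\<^sup>2) at_top sequentially"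
    and "a > 0"
    and bounds: "\<And>k. 2 \<le> k \<Longrightarrow> \<exists>S'\<in>sets N.
           measure (marginal M N \<xi> (k - 1)) S' = 1 \<and>
           (\<forall>A\<in>sets N. \<forall>x\<in>S'.
              a * measure (marginal M N \<xi> k) A \<le> measure (Q k x) A \<and>
              measure (Q k x) A \<le> b * measure (marginal M N \<xi> k) A)"
    and \<gamma>: "\<gamma> = a ^ 4 / b"
    and lindeberg: "\<And>\<epsilon>. \<epsilon> > 0 \<Longrightarrow>
           (\<lambda>n. 1 / (\<tau> n)\<^sup>2 *
              (\<Sum>k=1..n. LINT \<omega>|M. (X k \<omega>)\<^sup>2 * indicator {\<omega>. \<bar>X k \<omega>\<bar> \<ge> \<epsilon> * \<tau> n} \<omega>))
           \<longlonglongrightarrow> 0"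
    and condition_A: "\<exists>\<delta>>0. \<exists>n0::nat. \<exists>G::real \<Rightarrow> real.
           integrable lebesgue (\<lambda>u. exp (- G u)) \<and>
           (\<forall>n>n0. \<forall>u. 1 \<le> \<bar>u\<bar> \<and> \<bar>u\<bar> \<le> \<delta> * \<tau> n \<longrightarrow>
              \<gamma> / 8 * (\<Sum>k=1..n. 1 - (cmod (f k (u / \<tau> n)))\<^sup>2) > G u)"
    and condition_B: "\<And>u::real. u \<noteq> 0 \<Longrightarrow>
           \<exists>c>1. \<exists>l r. l < u \<and> u < r \<and>
             (\<exists>n0::nat. \<forall>t\<in>{l<..<r}. \<forall>n>n0.
                \<gamma> / (8 * ln (\<tau> n)) * (\<Sum>k=1..n. 1 - (cmod (f k t))\<^sup>2) \<ge> c)"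
    and "continuous_on UNIV h"
    and "compact (closure {x. h x \<noteq> 0})"
  shows "(\<lambda>n. SUP u::real. ereal
           \<bar>sqrt (2 * pi) * \<sigma> n * (LINT \<omega>|M. h (partial_sum X n \<omega> - u))
             - exp (- (u\<^sup>2 / (2 * (\<sigma> n)\<^sup>2))) * (LINT x|lebesgue. h x)\<bar>)
         \<longlonglongrightarrow> 0"
proof -
  interpret prob_space M by fact
  note g_meas[measurable] = assms(4)
  note X_square = assms(6) and X_mean = assms(7) and \<tau>2_top = assms(11) and a = \<open>0 < a\<close>
  have \<xi>[measurable]: "\<xi> k \<in> M \<rightarrow>\<^sub>M N" if "1 \<le> k" for k
    using assms(2) that by (auto simp: markov_chain_def)
  have X_eq: "X k = (\<lambda>\<omega>. g k (\<xi> k \<omega>))" if "1 \<le> k" for k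
    using X[OF that] by blast
  obtain F x0 Q' where chain: "comparable_chain M N F (\<lambda>k. if k = 0 then (\<lambda>_. x0) else \<xi> k) Q' a b"
    using comparable_chain_exists[OF assms(1,2,3) a bounds] by blast
  define \<xi>' where "\<xi>' k = (if k = 0 then (\<lambda>_. x0) else \<xi> k)" for k
  \<comment> \<open>The summand at the artificial time 0 is zero, so centering and square
    integrability hold there trivially.\<close>
  define g' where "g' k = (if k = 0 then (\<lambda>_. 0) else g k)" for k
  have \<xi>'_Suc: "\<xi>' (Suc k) = \<xi> (Suc k)" and g'_Suc: "g' (Suc k) = g (Suc k)" for k
    by (simp_all add: \<xi>'_def g'_def)
  interpret comparable_chain M N F \<xi>' Q' a b using chain by (simp add: \<xi>'_def[abs_def])
  have comp: "g' k (\<xi>' k \<omega>) = X k \<omega>" if "1 \<le> k" for k \<omega>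
    using that by (simp add: g'_def \<xi>'_def X_eq)
  interpret centered_chain M N F \<xi>' Q' a b x0 g'
  proof unfold_locales
    show "\<xi>' 0 \<omega> = x0" for \<omega> by (simp add: \<xi>'_def)
    show gm: "g' k \<in> borel_measurable N" for k by (simp add: g'_def)
    show "integrable (distr M N (\<xi>' k)) (\<lambda>x. (g' k x)\<^sup>2)" for k
    proof (cases "k = 0")
      case False
      then have "integrable M (\<lambda>\<omega>. (g' k (\<xi>' k \<omega>))\<^sup>2)" using X_square[of k] comp[of k] by simp
      then show ?thesis using gm[of k] by (subst integrable_distr_eq) auto
    qed (simp add: g'_def)
    show "(\<integral>x. g' k x \<partial>distr M N (\<xi>' k)) = 0" for k
    proof (cases "k = 0")
      case False
      have "(\<integral>x. g' k x \<partial>distr M N (\<xi>' k)) = expectation (\<lambda>\<omega>. g' k (\<xi>' k \<omega>))"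
        using gm[of k] by (intro integral_distr) auto
      then show ?thesis using False X_mean[of k] comp[of k] by simp
    qed (simp add: g'_def)
  qed
  have S: "S n = partial_sum X n" for n
  proof -
    have "{0<..n} = {1..n}" by auto
    then show ?thesis unfolding S_def[abs_def] partial_sum_def[abs_def] by (simp add: comp)
  qed
  have f_eq: "f k t = expectation (\<lambda>\<omega>. iexp (t * X k \<omega>))" if "1 \<le> k" for k t
    unfolding f char_fun_def char_def using that by (subst integral_distr) (auto simp: X_eq)
  have tot: "(\<tau> n)\<^sup>2 = total n" for n
  proof -
    have "total n = (\<Sum>k=1..n. expectation (\<lambda>\<omega>. (X k \<omega>)\<^sup>2))"
      unfolding total_def \<rho>_square One_nat_def sum.atLeast1_atMost_eq
      by (intro sum.cong refl, subst integral_distr) (auto simp: comp)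
    then show ?thesis
      by (simp add: \<tau> root_sum_var_def sum_nonneg)
  qed
  have \<tau>0: "0 \<le> \<tau> n" for n by (simp add: \<tau> root_sum_var_def sum_nonneg)
  have \<tau>_top: "filterlim \<tau> at_top sequentially"
  proof -
    have "filterlim (\<lambda>n. sqrt ((\<tau> n)\<^sup>2)) at_top sequentially"
      using \<tau>2_top by (rule filterlim_compose[OF sqrt_at_top])
    then show ?thesis using \<tau>0 by simp
  qed
  have \<sigma>0: "0 \<le> \<sigma> n" and \<sigma>2: "(\<sigma> n)\<^sup>2 = expectation (\<lambda>\<omega>. (S n \<omega>)\<^sup>2)" for n
    by (simp_all add: \<sigma> sum_sd_def S)
  define \<phi> where "\<phi> n t = expectation (\<lambda>\<omega>. iexp (t * S n \<omega>))" for n t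
  define d where "d n t = (\<Sum>k=1..n. 1 - (cmod (f k t))\<^sup>2)" for n t
  have \<phi>_le: "norm (\<phi> n t) \<le> exp 1 * exp (- (\<gamma> / 8 * d n t))" for n t
  proof -
    have "cmod (f k t) \<le> 1" if "1 \<le> k" for k
      unfolding f_eq[OF that] by (rule norm_iexp_expectation_le_1)
    then have d0: "0 \<le> d n t" unfolding d_def by (intro sum_nonneg) (simp add: power_le_one)
    \<comment> \<open>This transfers the decay estimate to the constant of Conditions A and B: a^4/b
      \<le> a^4 \<le> a^2 since a \<le> 1 \<le> b.\<close>
    have "\<gamma> \<le> a\<^sup>2"
    proof -
      have "a ^ 4 / b \<le> a ^ 4 / 1" using b_ge_1 by (intro divide_left_mono) auto
      also have "\<dots> \<le> a\<^sup>2" using a a_le_1 by (simp add: power_decreasing)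
      finally show ?thesis by (simp add: \<gamma>)
    qed
    then have "\<gamma> / 8 \<le> a\<^sup>2 / 4" using zero_le_power2[of a] by linarith
    then have "\<gamma> / 8 * d n t \<le> a\<^sup>2 / 4 * d n t" using d0 by (rule mult_right_mono)
    moreover have "norm (\<phi> n t) \<le> exp 1 * exp (- (a\<^sup>2 / 4 * d n t))"
      using norm_char_S_le[of t n] by (simp add: \<phi>_def d_def f_eq comp)
    ultimately show ?thesis by (elim order_trans) simp
  qed
  have lind: "(\<lambda>n. 1 / (\<tau> n)\<^sup>2 *
      (\<Sum>k<n. \<integral>x. (g' (Suc k) x)\<^sup>2 * indicator {x. \<bar>g' (Suc k) x\<bar> \<ge> \<epsilon> * \<tau> n} x \<partial>P (Suc k))) \<longlonglongrightarrow> 0"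
    if "0 < \<epsilon>" for \<epsilon>
  proof -
    have "(\<integral>x. (g' k x)\<^sup>2 * indicator {x. \<bar>g' k x\<bar> \<ge> \<epsilon> * \<tau> n} x \<partial>P k)
      = expectation (\<lambda>\<omega>. (X k \<omega>)\<^sup>2 * indicator {\<omega>. \<bar>X k \<omega>\<bar> \<ge> \<epsilon> * \<tau> n} \<omega>)" if "1 \<le> k" for k n
    proof -
      have [measurable]: "g' k \<in> borel_measurable N" by (rule g_measurable)
      have "(\<lambda>x. (g' k x)\<^sup>2 * indicator {x. \<bar>g' k x\<bar> \<ge> \<epsilon> * \<tau> n} x) \<in> borel_measurable N"
        by measurable
      then show ?thesis using that
        by (subst integral_distr) (auto simp: comp indicator_def intro!: Bochner_Integration.integral_cong)
    qed
    then show ?thesis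
      using lindeberg[OF that] unfolding One_nat_def sum.atLeast1_atMost_eq by simp
  qed
  have local: "local_limit M S \<sigma> \<tau> (sqrt (a / 4)) (sqrt (b * K))"
  proof (intro local_limit.intro local_limit_axioms.intro)
    show "prob_space M" by fact
    show "S n \<in> borel_measurable M" for n by (rule S_measurable)
    show "0 < sqrt (a / 4)" using a by simp
    show "sqrt (a / 4) * \<tau> n \<le> \<sigma> n" for n
    proof (rule power2_le_imp_le[OF _ \<sigma>0])
      show "(sqrt (a / 4) * \<tau> n)\<^sup>2 \<le> (\<sigma> n)\<^sup>2"
        unfolding power_mult_distrib tot \<sigma>2 using variance_S_bounds(1)[of n] a by simp
    qed
    have bK: "0 \<le> b * K" using b_ge_1 by (intro mult_nonneg_nonneg) (simp_all add: K_def)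
    show "\<sigma> n \<le> sqrt (b * K) * \<tau> n" for n
    proof (rule power2_le_imp_le)
      show "(\<sigma> n)\<^sup>2 \<le> (sqrt (b * K) * \<tau> n)\<^sup>2"
        unfolding power_mult_distrib tot \<sigma>2 using variance_S_bounds(2)[of n] bK by simp
      show "0 \<le> sqrt (b * K) * \<tau> n" using bK \<tau>0 by (intro mult_nonneg_nonneg) simp_all
    qed
    show "filterlim \<tau> at_top sequentially" by (rule \<tau>_top)
    have "(w / \<tau> n)\<^sup>2 / 2 * expectation (\<lambda>\<omega>. (S n \<omega>)\<^sup>2) = w\<^sup>2 * (\<sigma> n / \<tau> n)\<^sup>2 / 2" for w n
      by (simp add: \<sigma>2[symmetric] power_divide)
    then show "(\<lambda>n. expectation (\<lambda>\<omega>. iexp (w / \<tau> n * S n \<omega>)) - of_real (exp (- (w\<^sup>2 * (\<sigma> n / \<tau> n)\<^sup>2 / 2)))) \<longlonglongrightarrow> 0" for w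
      using char_S_limit[OF \<tau>0 tot \<tau>_top lind, of w] by simp
    show "\<exists>\<delta>>0. \<exists>D. integrable lebesgue D \<and> (\<forall>w. 0 \<le> D w) \<and>
      (\<forall>\<^sub>F n in sequentially. \<forall>w. 1 \<le> \<bar>w\<bar> \<and> \<bar>w\<bar> \<le> \<delta> * \<tau> n \<longrightarrow> norm (expectation (\<lambda>\<omega>. iexp (w / \<tau> n * S n \<omega>))) \<le> D w)"
    proof -
      obtain \<delta> n0 G where \<delta>: "0 < \<delta>" and G: "integrable lebesgue (\<lambda>u. exp (- G u))"
        and A: "\<And>n u. n0 < n \<Longrightarrow> 1 \<le> \<bar>u\<bar> \<Longrightarrow> \<bar>u\<bar> \<le> \<delta> * \<tau> n \<Longrightarrow> \<gamma> / 8 * d n (u / \<tau> n) > G u"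
        using condition_A unfolding d_def by metis
      have "norm (\<phi> n (w / \<tau> n)) \<le> exp 1 * exp (- G w)" if "n0 < n" "1 \<le> \<bar>w\<bar>" "\<bar>w\<bar> \<le> \<delta> * \<tau> n" for n w
        using \<phi>_le[of n "w / \<tau> n"] A[OF that] by (elim order_trans) simp
      then have "\<forall>\<^sub>F n in sequentially. \<forall>w. 1 \<le> \<bar>w\<bar> \<and> \<bar>w\<bar> \<le> \<delta> * \<tau> n \<longrightarrow> norm (\<phi> n (w / \<tau> n)) \<le> exp 1 * exp (- G w)"
        by (intro eventually_mono[OF eventually_gt_at_top[of n0]]) auto
      moreover have "integrable lebesgue (\<lambda>u. exp 1 * exp (- G u))" using G by simp
      moreover have "\<forall>w. 0 \<le> exp 1 * exp (- G w)" by simp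
      ultimately show ?thesis
        unfolding \<phi>_def using \<delta> by blast
    qed
    show "\<forall>\<^sub>F n in sequentially. \<forall>t. \<delta> \<le> \<bar>t\<bar> \<and> \<bar>t\<bar> \<le> l \<longrightarrow> \<tau> n * norm (expectation (\<lambda>\<omega>. iexp (t * S n \<omega>))) \<le> \<epsilon>"
      if "0 < \<delta>" "0 < \<epsilon>" for \<delta> l \<epsilon>
      by (rule uniform_decay_off_origin[OF \<tau>_top \<phi>_le[unfolded \<phi>_def] condition_B[folded d_def] that])
  qed
  interpret L: local_limit M S \<sigma> \<tau> "sqrt (a / 4)" "sqrt (b * K)" "\<lambda>n t. expectation (\<lambda>\<omega>. iexp (t * S n \<omega>))"
    by (rule local) simp
  have "h \<in> borel_measurable borel"
    using \<open>continuous_on UNIV h\<close> by (rule borel_measurable_continuous_onI)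
  \<comment> \<open>\<open>h\<close> is Borel measurable, so completing Lebesgue measure leaves its
    integral unchanged.\<close>
  then have leb: "(LINT x|lebesgue. h x) = (LINT x|lborel. h x)"
    by (intro integral_completion) simp
  show ?thesis
  proof (rule ereal_SUP_tendsto_0)
    fix e :: real assume "0 < e"
    then show "\<forall>\<^sub>F n in sequentially. \<forall>u. \<bar>sqrt (2 * pi) * \<sigma> n * (LINT \<omega>|M. h (partial_sum X n \<omega> - u))
             - exp (- (u\<^sup>2 / (2 * (\<sigma> n)\<^sup>2))) * (LINT x|lebesgue. h x)\<bar> \<le> e"
      using L.continuous_local_limit[OF \<open>continuous_on UNIV h\<close> \<open>compact (closure {x. h x \<noteq> 0})\<close>] by (simp add: S leb)
  qed simp
qed

end
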